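(* For every real number $T$ with $2 < T < 4$ there is a real number $S$ with $S\cdot T < 4$ such that the pair $(S,T)$ is a feasible space-time tradeoff for TSP.
   Context: TSP: given $n$ cities $c_1,\dots,c_n$ and real distances $d(c_i,c_j)$, compute the minimum over permutations $\pi$ of $[n]=\{1,\dots,n\}$ of $d(c_{\pi(n)},c_{\pi(1)})+\sum_{i=1}^{n-1} d(c_{\pi(i)},c_{\pi(i+1)})$ (the length of an optimal tour). A pair $(S,T)$ of reals is a feasible space-time tradeoff for TSP if there is an algorithm that solves every TSP instance on $n$ cities simultaneously in time $T^{n+o(n)}$ and space $S^{n+o(n)}$. *)

theory Defs
  imports Complex_Main "HOL-Combinatorics.Permutations" "HOL-Library.Landau_Symbols"
begin

text \<open>An instance is a number of cities \<open>n\<close> together with arbitrary real distances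
  \<open>d i j\<close> for \<open>i, j \<in> {1..n}\<close>; neither symmetry, nonnegativity nor the triangle
  inequality is assumed.\<close>

definition tour_length :: "nat \<Rightarrow> (nat \<Rightarrow> nat \<Rightarrow> real) \<Rightarrow> (nat \<Rightarrow> nat) \<Rightarrow> real" where
  "tour_length n d \<pi> = d (\<pi> n) (\<pi> 1) + (\<Sum>i = 1..n - 1. d (\<pi> i) (\<pi> (i + 1)))"

definition tsp_opt :: "nat \<Rightarrow> (nat \<Rightarrow> nat \<Rightarrow> real) \<Rightarrow> real" where
  "tsp_opt n d = Min (tour_length n d ` {\<pi>. \<pi> permutes {1..n}})"

text \<open>
  Algorithms are structured programs for a random access machine with two memories, one
  holding machine words (natural numbers) and one holding distance values (reals).
  Distances are opaque: they can be read from the read-only input, stored, added and compared,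
  and there is no conversion between the two kinds of data.

  A run is relative to a word length \<open>w\<close> and a memory size \<open>s\<close>: all words that occur must be
  below \<open>2 ^ w\<close> and all addresses below \<open>s\<close>, otherwise the run is stuck.
  With every distance value the semantics keeps the number of input distances it is a sum of,
  and this number must be below \<open>2 ^ w\<close> too. (If the input distances have \<open>b\<close> bits, a value
  then has at most \<open>b + w\<close> bits.) Without such limits on words and values an exponential amount
  of information could be kept in a single cell, and space would be meaningless.
\<close>

datatype wexp =
    Const nat
  | Cities
  | WLoad wexp
  | Plus wexp wexp
  | Minus wexp wexp
  | Times wexp wexp
  | Div wexp wexp
  | Mod wexp wexp

datatype vexp =
    VZero
  | Dist wexp wexp
  | VLoad wexp
  | VPlus vexp vexp

datatype bexp =
    WLess wexp wexp
  | VLess vexp vexp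
  | BNot bexp
  | BAnd bexp bexp

datatype com =
    Skip
  | WStore wexp wexp
  | VStore wexp vexp
  | Seq com com
  | Cond bexp com com
  | While bexp com

record state =
  words :: "nat \<Rightarrow> nat"
  vals :: "nat \<Rightarrow> nat \<times> real"  \<comment> \<open>number of summands, value\<close>

definition init_state :: state where
  "init_state = \<lparr>words = (\<lambda>_. 0), vals = (\<lambda>_. (0, 0))\<rparr>"

primrec wcost :: "wexp \<Rightarrow> nat" where
  "wcost (Const k) = 1"
| "wcost Cities = 1"
| "wcost (WLoad a) = 1 + wcost a"
| "wcost (Plus a b) = 1 + wcost a + wcost b"
| "wcost (Minus a b) = 1 + wcost a + wcost b"
| "wcost (Times a b) = 1 + wcost a + wcost b"
| "wcost (Div a b) = 1 + wcost a + wcost b"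
| "wcost (Mod a b) = 1 + wcost a + wcost b"

primrec vcost :: "vexp \<Rightarrow> nat" where
  "vcost VZero = 1"
| "vcost (Dist a b) = 1 + wcost a + wcost b"
| "vcost (VLoad a) = 1 + wcost a"
| "vcost (VPlus u v) = 1 + vcost u + vcost v"

primrec bcost :: "bexp \<Rightarrow> nat" where
  "bcost (WLess a b) = 1 + wcost a + wcost b"
| "bcost (VLess u v) = 1 + vcost u + vcost v"
| "bcost (BNot b) = 1 + bcost b"
| "bcost (BAnd b c) = 1 + bcost b + bcost c"

context
  fixes n :: nat and d :: "nat \<Rightarrow> nat \<Rightarrow> real"
begin

primrec weval :: "state \<Rightarrow> wexp \<Rightarrow> nat" where
  "weval \<sigma> (Const k) = k"
| "weval \<sigma> Cities = n"
| "weval \<sigma> (WLoad a) = words \<sigma> (weval \<sigma> a)"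
| "weval \<sigma> (Plus a b) = weval \<sigma> a + weval \<sigma> b"
| "weval \<sigma> (Minus a b) = weval \<sigma> a - weval \<sigma> b"
| "weval \<sigma> (Times a b) = weval \<sigma> a * weval \<sigma> b"
| "weval \<sigma> (Div a b) = weval \<sigma> a div weval \<sigma> b"
| "weval \<sigma> (Mod a b) = weval \<sigma> a mod weval \<sigma> b"

primrec veval :: "state \<Rightarrow> vexp \<Rightarrow> nat \<times> real" where
  "veval \<sigma> VZero = (0, 0)"
| "veval \<sigma> (Dist a b) = (1, d (weval \<sigma> a) (weval \<sigma> b))"
| "veval \<sigma> (VLoad a) = vals \<sigma> (weval \<sigma> a)"
| "veval \<sigma> (VPlus u v) =
     (fst (veval \<sigma> u) + fst (veval \<sigma> v), snd (veval \<sigma> u) + snd (veval \<sigma> v))"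

primrec beval :: "state \<Rightarrow> bexp \<Rightarrow> bool" where
  "beval \<sigma> (WLess a b) = (weval \<sigma> a < weval \<sigma> b)"
| "beval \<sigma> (VLess u v) = (snd (veval \<sigma> u) < snd (veval \<sigma> v))"
| "beval \<sigma> (BNot b) = (\<not> beval \<sigma> b)"
| "beval \<sigma> (BAnd b c) = (beval \<sigma> b \<and> beval \<sigma> c)"

context
  fixes w s :: nat
begin

primrec wlegal :: "state \<Rightarrow> wexp \<Rightarrow> bool" where
  "wlegal \<sigma> (Const k) = (k < 2 ^ w)"
| "wlegal \<sigma> Cities = (n < 2 ^ w)"
| "wlegal \<sigma> (WLoad a) = (wlegal \<sigma> a \<and> weval \<sigma> a < s \<and> words \<sigma> (weval \<sigma> a) < 2 ^ w)"
| "wlegal \<sigma> (Plus a b) = (wlegal \<sigma> a \<and> wlegal \<sigma> b \<and> weval \<sigma> a + weval \<sigma> b < 2 ^ w)"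
| "wlegal \<sigma> (Minus a b) = (wlegal \<sigma> a \<and> wlegal \<sigma> b)"
| "wlegal \<sigma> (Times a b) = (wlegal \<sigma> a \<and> wlegal \<sigma> b \<and> weval \<sigma> a * weval \<sigma> b < 2 ^ w)"
| "wlegal \<sigma> (Div a b) = (wlegal \<sigma> a \<and> wlegal \<sigma> b)"
| "wlegal \<sigma> (Mod a b) = (wlegal \<sigma> a \<and> wlegal \<sigma> b)"

primrec vlegal :: "state \<Rightarrow> vexp \<Rightarrow> bool" where
  "vlegal \<sigma> VZero = True"
| "vlegal \<sigma> (Dist a b) =
     (wlegal \<sigma> a \<and> wlegal \<sigma> b \<and> weval \<sigma> a \<in> {1..n} \<and> weval \<sigma> b \<in> {1..n} \<and> (1::nat) < 2 ^ w)"
| "vlegal \<sigma> (VLoad a) = (wlegal \<sigma> a \<and> weval \<sigma> a < s \<and> fst (vals \<sigma> (weval \<sigma> a)) < 2 ^ w)"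
| "vlegal \<sigma> (VPlus u v) =
     (vlegal \<sigma> u \<and> vlegal \<sigma> v \<and> fst (veval \<sigma> u) + fst (veval \<sigma> v) < 2 ^ w)"

primrec blegal :: "state \<Rightarrow> bexp \<Rightarrow> bool" where
  "blegal \<sigma> (WLess a b) = (wlegal \<sigma> a \<and> wlegal \<sigma> b)"
| "blegal \<sigma> (VLess u v) = (vlegal \<sigma> u \<and> vlegal \<sigma> v)"
| "blegal \<sigma> (BNot b) = blegal \<sigma> b"
| "blegal \<sigma> (BAnd b c) = (blegal \<sigma> b \<and> blegal \<sigma> c)"

text \<open>\<open>exec c \<sigma> t \<sigma>'\<close>: started in \<open>\<sigma>\<close>, the program \<open>c\<close> terminates in \<open>\<sigma>'\<close> after \<open>t\<close> elementary
  operations.\<close>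

inductive exec :: "com \<Rightarrow> state \<Rightarrow> nat \<Rightarrow> state \<Rightarrow> bool" where
  Skip: "exec Skip \<sigma> 1 \<sigma>"
| WStore: "\<lbrakk>wlegal \<sigma> a; weval \<sigma> a < s; wlegal \<sigma> e\<rbrakk> \<Longrightarrow>
    exec (WStore a e) \<sigma> (1 + wcost a + wcost e)
      (\<sigma>\<lparr>words := (words \<sigma>)(weval \<sigma> a := weval \<sigma> e)\<rparr>)"
| VStore: "\<lbrakk>wlegal \<sigma> a; weval \<sigma> a < s; vlegal \<sigma> e\<rbrakk> \<Longrightarrow>
    exec (VStore a e) \<sigma> (1 + wcost a + vcost e)
      (\<sigma>\<lparr>vals := (vals \<sigma>)(weval \<sigma> a := veval \<sigma> e)\<rparr>)"
| Seq: "\<lbrakk>exec c1 \<sigma> t1 \<sigma>'; exec c2 \<sigma>' t2 \<sigma>''\<rbrakk> \<Longrightarrow> exec (Seq c1 c2) \<sigma> (t1 + t2) \<sigma>''"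
| CondTrue: "\<lbrakk>blegal \<sigma> b; beval \<sigma> b; exec c1 \<sigma> t \<sigma>'\<rbrakk> \<Longrightarrow>
    exec (Cond b c1 c2) \<sigma> (1 + bcost b + t) \<sigma>'"
| CondFalse: "\<lbrakk>blegal \<sigma> b; \<not> beval \<sigma> b; exec c2 \<sigma> t \<sigma>'\<rbrakk> \<Longrightarrow>
    exec (Cond b c1 c2) \<sigma> (1 + bcost b + t) \<sigma>'"
| WhileFalse: "\<lbrakk>blegal \<sigma> b; \<not> beval \<sigma> b\<rbrakk> \<Longrightarrow> exec (While b c) \<sigma> (1 + bcost b) \<sigma>"
| WhileTrue: "\<lbrakk>blegal \<sigma> b; beval \<sigma> b; exec c \<sigma> t1 \<sigma>'; exec (While b c) \<sigma>' t2 \<sigma>''\<rbrakk> \<Longrightarrow>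
    exec (While b c) \<sigma> (1 + bcost b + t1 + t2) \<sigma>''"

end

end

text \<open>The output is the content of cell \<open>0\<close> of the value memory.\<close>

definition solves_tsp ::
  "com \<Rightarrow> nat \<Rightarrow> (nat \<Rightarrow> nat \<Rightarrow> real) \<Rightarrow> nat \<Rightarrow> nat \<Rightarrow> nat \<Rightarrow> bool" where
  "solves_tsp p n d w s t \<longleftrightarrow>
     (\<exists>\<sigma>. exec n d w s p init_state t \<sigma> \<and> snd (vals \<sigma> 0) = tsp_opt n d)"

text \<open>
  Every elementary operation is charged the word length \<open>w\<close>, and so is each of the \<open>s\<close> cells of
  either memory, so that long words bring no advantage. One program has to work for all \<open>n\<close>.
  Positivity of \<open>S\<close> and \<open>T\<close> is what makes the real powers meaningful.
\<close>

definition feasible_tradeoff :: "real \<Rightarrow> real \<Rightarrow> bool" where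
  "feasible_tradeoff S T \<longleftrightarrow> S > 0 \<and> T > 0 \<and>
     (\<exists>p f g. f \<in> o(\<lambda>n. real n) \<and> g \<in> o(\<lambda>n. real n) \<and>
        (\<forall>n\<ge>1. \<forall>d. \<exists>w s t. solves_tsp p n d w s t \<and>
           real (t * w) \<le> T powr (real n + f n) \<and>
           real (2 * s * w) \<le> S powr (real n + g n)))"

end

theory Submission
  imports Defs "HOL-Real_Asymp.Real_Asymp"
begin

text \<open>
  Fix a set of \<open>m\<close> cities. If \<open>N\<close> set systems of size at most \<open>C\<close> are such that every maximal chain of
  subsets lies in one of them, the dynamic program over subsets may be run once for every
  system, and it only meets sets of that system. Such covers multiply over disjoint groups
  of cities, which gives time \<open>(N C)\<^bsup>1/m\<^esup>\<close> and space \<open>C\<^bsup>1/m\<^esup>\<close> per city. Guessing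
  the first half of \<open>2 k\<close> cities turns a cover \<open>(k, N, C)\<close> into \<open>(2 k, (2 k choose k) N\<^sup>2, 2 C)\<close>. Since
  the central binomial coefficient is smaller than \<open>4\<^bsup>k\<^esup>\<close> by an unbounded factor, starting from
  all subsets of \<open>k\<close> cities with a slight constraint on six of them yields \<open>N C\<^sup>2 < 4\<^bsup>m\<^esup>\<close> and
  \<open>C\<^sup>2 < 2\<^bsup>m\<^esup>\<close>. Mixing in unconstrained cities
  gives every \<open>T \<in> (2, 2 sqrt 2]\<close>. Guessing the set of cities visited before the middle one maps
  \<open>(S, T)\<close> to \<open>(sqrt S, 2 sqrt T)\<close>, which preserves \<open>S T < 4\<close> and reaches all of \<open>(2, 4)\<close>.
\<close>

section \<open>Covers of maximal chains\<close>

text \<open>For a cover \<open>(m, N, C)\<close> the aim \<open>S * T < 4\<close> reads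
  \<open>N * C^2 < 4^m\<close>. All subsets (\<open>N = 1\<close>, \<open>C = 2^m\<close>) meet this
  with equality, so products of them gain nothing; guessing the first half is the only source of
  strictness. The gain is a constant factor for one fixed block size, but taken once per block it
  becomes exponential in \<open>n\<close>. The second condition \<open>C^2 < 2^m\<close> is what
  lets mixtures reach \<open>T = 2 * sqrt 2\<close>. Nothing larger is required of them, because
  squaring \<open>T / 4\<close> finitely often moves every ratio in \<open>(1/2, 1)\<close> into
  \<open>(1/2, 1 / sqrt 2]\<close>. Since \<open>T\<close> fixes block size, cover and recursion
  depth before \<open>n\<close> is known, the covers are hard-wired into the program as finite
  automata and the recursion is unrolled. The states of all automata are packed into one number,
  which serves as a table index, so the table stores no sets. All words have length linear in
  \<open>n\<close>; hence charging for word length costs a polynomial factor only, which disappears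
  in the \<open>o(n)\<close> of the exponent.\<close>

definition chain_cover :: "nat set \<Rightarrow> nat set set set \<Rightarrow> nat \<Rightarrow> bool" where
  "chain_cover V \<F> C \<longleftrightarrow> finite \<F> \<and> (\<forall>F\<in>\<F>. finite F \<and> card F \<le> C) \<and>
     (\<forall>xs. distinct xs \<and> set xs = V \<longrightarrow> (\<exists>F\<in>\<F>. \<forall>k. set (take k xs) \<in> F))"

text \<open>The bound depends on the size of the ground set alone, so that one hypothesis serves
  both a guessed half and its complement.\<close>

definition coverable :: "nat \<Rightarrow> nat \<Rightarrow> nat \<Rightarrow> bool" where
  "coverable m N C \<longleftrightarrow>
     (\<forall>V. finite V \<and> card V = m \<longrightarrow> (\<exists>\<F>. card \<F> \<le> N \<and> chain_cover V \<F> C))"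

lemma coverable_Pow: "coverable m 1 (2 ^ m)"
  unfolding coverable_def
proof (intro allI impI)
  fix V :: "nat set" assume V: "finite V \<and> card V = m"
  have "chain_cover V {Pow V} (2 ^ m)"
    using V by (auto simp: chain_cover_def card_Pow dest: in_set_takeD)
  then show "\<exists>\<F>. card \<F> \<le> 1 \<and> chain_cover V \<F> (2 ^ m)"
    by (intro exI[of _ "{Pow V}"]) simp
qed

text \<open>Splitting a list at \<open>k\<close> commutes with filtering. This projects a maximal
  chain of a disjoint union to maximal chains of its parts, as the product of covers
  demands.\<close>

lemma set_take_inter:
  "\<exists>l. set (take k xs) \<inter> V = set (take l (filter (\<lambda>x. x \<in> V) xs))"
proof -
  have "filter (\<lambda>x. x \<in> V) xs
      = filter (\<lambda>x. x \<in> V) (take k xs) @ filter (\<lambda>x. x \<in> V) (drop k xs)"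
    by (metis append_take_drop_id filter_append)
  then have "take (length (filter (\<lambda>x. x \<in> V) (take k xs))) (filter (\<lambda>x. x \<in> V) xs)
      = filter (\<lambda>x. x \<in> V) (take k xs)" by simp
  then show ?thesis by (metis Int_commute filter_set inter_set_filter)
qed

text \<open>Pair the systems and take all unions of a member of the one with a member of the other.
  A chain in \<open>V1 \<union> V2\<close> runs through such unions as soon as its two projections
  run through the factors, however they are interleaved.\<close>

lemma coverable_mult:
  assumes "coverable m1 N1 C1" "coverable m2 N2 C2"
  shows "coverable (m1 + m2) (N1 * N2) (C1 * C2)"
  unfolding coverable_def
proof (intro allI impI)
  fix V :: "nat set" assume V: "finite V \<and> card V = m1 + m2"
  then obtain V1 where V1: "V1 \<subseteq> V" "card V1 = m1" "finite V1"
    by (metis le_add1 obtain_subset_with_card_n)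
  define V2 where "V2 = V - V1"
  have V2: "card V2 = m2" "finite V2"
    using V V1 by (auto simp: V2_def card_Diff_subset)
  obtain \<F>1 where F1: "card \<F>1 \<le> N1" "chain_cover V1 \<F>1 C1"
    using assms(1) V1 by (auto simp: coverable_def)
  obtain \<F>2 where F2: "card \<F>2 \<le> N2" "chain_cover V2 \<F>2 C2"
    using assms(2) V2 by (auto simp: coverable_def)
  define J where "J = (\<lambda>(F1, F2). (\<lambda>(X, Y). X \<union> Y :: nat set) ` (F1 \<times> F2))"
  have fin: "finite (\<F>1 \<times> \<F>2)" using F1 F2 by (auto simp: chain_cover_def)
  have "card (J ` (\<F>1 \<times> \<F>2)) \<le> card (\<F>1 \<times> \<F>2)" by (rule card_image_le[OF fin])
  also have "\<dots> \<le> N1 * N2" using F1 F2 by (simp add: card_cartesian_product mult_le_mono)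
  finally have cN: "card (J ` (\<F>1 \<times> \<F>2)) \<le> N1 * N2" .
  have "chain_cover V (J ` (\<F>1 \<times> \<F>2)) (C1 * C2)"
    unfolding chain_cover_def
  proof (intro conjI ballI allI impI)
    show "finite (J ` (\<F>1 \<times> \<F>2))" using fin by simp
  next
    fix F assume "F \<in> J ` (\<F>1 \<times> \<F>2)"
    then obtain A B where AB: "A \<in> \<F>1" "B \<in> \<F>2" "F = (\<lambda>(X, Y). X \<union> Y) ` (A \<times> B)"
      by (auto simp: J_def)
    have f: "finite A" "finite B" "card A \<le> C1" "card B \<le> C2"
      using AB F1 F2 by (auto simp: chain_cover_def)
    then show "finite F" using AB by simp
    have "card F \<le> card (A \<times> B)" unfolding AB(3) using f by (intro card_image_le) simp
    also have "\<dots> \<le> C1 * C2" using f by (simp add: card_cartesian_product mult_le_mono)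
    finally show "card F \<le> C1 * C2" .
  next
    fix xs assume xs: "distinct xs \<and> set xs = V"
    obtain A where A: "A \<in> \<F>1" "\<And>k. set (take k (filter (\<lambda>x. x \<in> V1) xs)) \<in> A"
      using F1(2) xs V1(1) unfolding chain_cover_def
      by (elim conjE allE[of _ "filter (\<lambda>x. x \<in> V1) xs"]) auto
    obtain B where B: "B \<in> \<F>2" "\<And>k. set (take k (filter (\<lambda>x. x \<in> V2) xs)) \<in> B"
      using F2(2) xs unfolding chain_cover_def V2_def
      by (elim conjE allE[of _ "filter (\<lambda>x. x \<in> V - V1) xs"]) auto
    have "set (take k xs) \<in> J (A, B)" for k
    proof -
      have "set (take k xs) = (set (take k xs) \<inter> V1) \<union> (set (take k xs) \<inter> V2)"
        using xs by (auto simp: V2_def dest: in_set_takeD)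
      then show ?thesis
        using A(2) B(2) set_take_inter[of k xs V1] set_take_inter[of k xs V2]
        by (auto simp: J_def image_iff) (metis)
    qed
    then show "\<exists>F\<in>J ` (\<F>1 \<times> \<F>2). \<forall>k. set (take k xs) \<in> F" using A B by blast
  qed
  then show "\<exists>\<F>. card \<F> \<le> N1 * N2 \<and> chain_cover V \<F> (C1 * C2)" using cN by blast
qed

text \<open>A permutation is cut after \<open>k\<close> elements, and \<open>A\<close> is the set of
  its first half. Up to the cut the chain lies in a system for \<open>A\<close>, afterwards in
  \<open>A\<close> joined with a system for \<open>V - A\<close>. The two systems are used one after
  the other, hence their sizes add, whereas the choices of \<open>A\<close> and of both systems
  multiply.\<close>

lemma coverable_series:
  assumes "coverable k N C"
  shows "coverable (2 * k) ((2 * k choose k) * N\<^sup>2) (2 * C)"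
  unfolding coverable_def
proof (intro allI impI)
  fix V :: "nat set" assume V: "finite V \<and> card V = 2 * k"
  define \<A> where "\<A> = {A. A \<subseteq> V \<and> card A = k}"
  have finA: "finite \<A>" using V by (simp add: \<A>_def)
  have cardA: "card \<A> = (2 * k choose k)" using V by (simp add: \<A>_def n_subsets)
  have "\<forall>W. \<exists>\<F>. finite W \<and> card W = k \<longrightarrow> card \<F> \<le> N \<and> chain_cover W \<F> C"
    using assms by (auto simp: coverable_def)
  then obtain \<F> where F: "\<And>W. finite W \<Longrightarrow> card W = k \<Longrightarrow> card (\<F> W) \<le> N \<and> chain_cover W (\<F> W) C"
    by metis
  define J where "J = (\<lambda>A (F1, F2). F1 \<union> (\<union>) A ` F2 :: nat set set)"
  define \<G> where "\<G> = (\<Union>A\<in>\<A>. J A ` (\<F> A \<times> \<F> (V - A)))"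
  have FA: "card (\<F> A) \<le> N \<and> chain_cover A (\<F> A) C"
      "card (\<F> (V - A)) \<le> N \<and> chain_cover (V - A) (\<F> (V - A)) C" if "A \<in> \<A>" for A
  proof -
    have "finite A" "card A = k" "finite (V - A)" "card (V - A) = k"
      using that V by (auto simp: \<A>_def card_Diff_subset finite_subset)
    then show "card (\<F> A) \<le> N \<and> chain_cover A (\<F> A) C"
      "card (\<F> (V - A)) \<le> N \<and> chain_cover (V - A) (\<F> (V - A)) C" using F by auto
  qed
  have fin: "finite (\<F> A \<times> \<F> (V - A))" if "A \<in> \<A>" for A
    using FA[OF that] by (auto simp: chain_cover_def)
  have "card \<G> \<le> (\<Sum>A\<in>\<A>. card (J A ` (\<F> A \<times> \<F> (V - A))))"
    unfolding \<G>_def by (rule card_UN_le[OF finA])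
  also have "\<dots> \<le> (\<Sum>A\<in>\<A>. N\<^sup>2)"
  proof (rule sum_mono)
    fix A assume A: "A \<in> \<A>"
    have "card (J A ` (\<F> A \<times> \<F> (V - A))) \<le> card (\<F> A \<times> \<F> (V - A))"
      by (rule card_image_le[OF fin[OF A]])
    also have "\<dots> \<le> N * N" using FA[OF A] by (simp add: card_cartesian_product mult_le_mono)
    finally show "card (J A ` (\<F> A \<times> \<F> (V - A))) \<le> N\<^sup>2" by (simp add: power2_eq_square)
  qed
  finally have cG: "card \<G> \<le> (2 * k choose k) * N\<^sup>2" by (simp add: cardA)
  have "chain_cover V \<G> (2 * C)"
    unfolding chain_cover_def
  proof (intro conjI ballI allI impI)
    show "finite \<G>" using finA fin by (auto simp: \<G>_def)
  next
    fix F assume "F \<in> \<G>"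
    then obtain A P Q where *: "A \<in> \<A>" "P \<in> \<F> A" "Q \<in> \<F> (V - A)" "F = P \<union> (\<union>) A ` Q"
      by (auto simp: \<G>_def J_def)
    have f: "finite P" "finite Q" "card P \<le> C" "card Q \<le> C"
      using * FA[OF *(1)] by (auto simp: chain_cover_def)
    show "finite F" using f * by simp
    have "card F \<le> card P + card ((\<union>) A ` Q)" unfolding *(4) by (rule card_Un_le)
    also have "\<dots> \<le> card P + card Q" using f by (simp add: card_image_le)
    finally show "card F \<le> 2 * C" using f by simp
  next
    fix xs assume xs: "distinct xs \<and> set xs = V"
    then have len: "length xs = 2 * k" using V by (metis distinct_card)
    define A where "A = set (take k xs)"
    have A: "A \<in> \<A>"
      using xs len by (auto simp: \<A>_def A_def distinct_card dest: in_set_takeD)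
    have VA: "set (drop k xs) = V - A"
    proof -
      have "set (take k xs) \<inter> set (drop k xs) = {}"
        using xs set_take_disj_set_drop_if_distinct[of xs k k] by simp
      moreover have "set (take k xs) \<union> set (drop k xs) = V"
        using xs by (metis append_take_drop_id set_append)
      ultimately show ?thesis unfolding A_def by blast
    qed
    obtain P where P: "P \<in> \<F> A" "\<And>j. set (take j (take k xs)) \<in> P"
      using FA(1)[OF A] xs unfolding chain_cover_def A_def
      by (elim conjE allE[of _ "take k xs"]) auto
    obtain Q where Q: "Q \<in> \<F> (V - A)" "\<And>j. set (take j (drop k xs)) \<in> Q"
      using FA(2)[OF A] xs VA unfolding chain_cover_def
      by (elim conjE allE[of _ "drop k xs"]) auto
    have "set (take j xs) \<in> J A (P, Q)" for j
    proof (cases "j \<le> k")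
      case True
      then show ?thesis using P(2)[of j] by (simp add: J_def min_absorb1)
    next
      case False
      then have "take j xs = take k xs @ take (j - k) (drop k xs)"
        by (metis le_add_diff_inverse nat_le_linear take_add)
      then have "set (take j xs) = A \<union> set (take (j - k) (drop k xs))" by (simp add: A_def)
      then show ?thesis using Q(2) by (auto simp: J_def)
    qed
    then show "\<exists>F\<in>\<G>. \<forall>j. set (take j xs) \<in> F"
      using A P(1) Q(1) unfolding \<G>_def by blast
  qed
  then show "\<exists>\<F>. card \<F> \<le> (2 * k choose k) * N\<^sup>2 \<and> chain_cover V \<F> (2 * C)" using cG by blast
qed

lemma coverable_power: "coverable m N C \<Longrightarrow> coverable (q * m) (N ^ q) (C ^ q)"
proof (induction q)
  case 0
  then show ?case using coverable_Pow[of 0] by simp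
next
  case (Suc q)
  then show ?case using coverable_mult[of m N C "q * m"] by simp
qed

section \<open>Central binomial coefficients and a cover below the critical product\<close>

lemma central_binomial_Suc:
  "Suc k * (2 * Suc k choose Suc k) = 2 * (2 * k + 1) * (2 * k choose k)"
proof -
  have "Suc k * (2 * Suc k choose Suc k) = Suc (2 * k + 1) * (2 * k + 1 choose k)"
    using Suc_times_binomial_eq[of "2 * k + 1" k] by (simp del: binomial_Suc_Suc add: ac_simps)
  also have "(2 * k + 1 choose k) = (2 * k + 1 choose Suc k)"
    using binomial_symmetric[of k "2 * k + 1"] by (simp del: binomial_Suc_Suc)
  also have "Suc (2 * k + 1) * (2 * k + 1 choose Suc k) = 2 * (Suc k * (Suc (2 * k) choose Suc k))"
    by simp
  also have "Suc k * (Suc (2 * k) choose Suc k) = Suc (2 * k) * (2 * k choose k)"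
    using Suc_times_binomial_eq[of "2 * k" k] by (simp del: binomial_Suc_Suc add: ac_simps)
  finally show ?thesis by simp
qed

text \<open>The bound \<open>4^k / sqrt (2 * k + 1)\<close> on the central coefficient, squared to
  stay within the natural numbers. By the recurrence the induction step amounts to
  \<open>(2 * k + 1) * (2 * k + 3) \<le> 4 * (k + 1)^2\<close>.\<close>

lemma central_binomial_square_le: "(2 * k choose k)\<^sup>2 * (2 * k + 1) \<le> 16 ^ k"
proof (induction k)
  case (Suc k)
  define c where "c = (2 * k choose k)"
  define c' where "c' = (2 * Suc k choose Suc k)"
  have "Suc k * c' = 2 * (2 * k + 1) * c"
    unfolding c_def c'_def by (rule central_binomial_Suc)
  then have "(Suc k)\<^sup>2 * c'\<^sup>2 = (2 * (2 * k + 1) * c)\<^sup>2"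
    by (metis power_mult_distrib)
  then have "(Suc k)\<^sup>2 * (c'\<^sup>2 * (2 * Suc k + 1)) = (2 * (2 * k + 1) * c)\<^sup>2 * (2 * Suc k + 1)"
    by (simp only: mult.assoc[symmetric])
  also have "\<dots> = 4 * (2 * k + 1) * (2 * k + 3) * (c\<^sup>2 * (2 * k + 1))"
    by (simp add: power2_eq_square algebra_simps)
  also have "\<dots> \<le> 4 * (2 * k + 1) * (2 * k + 3) * 16 ^ k"
    using Suc unfolding c_def by (intro mult_left_mono) auto
  also have "\<dots> \<le> 16 * (Suc k)\<^sup>2 * 16 ^ k"
    by (intro mult_right_mono) (auto simp: power2_eq_square algebra_simps)
  finally have "(Suc k)\<^sup>2 * (c'\<^sup>2 * (2 * Suc k + 1)) \<le> (Suc k)\<^sup>2 * 16 ^ Suc k" by (simp add: ac_simps)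
  then show ?case unfolding c'_def[symmetric] by (simp only: mult_le_cancel1) simp
qed simp

text \<open>Applied to all subsets of \<open>k\<close> elements, the guess yields
  \<open>C = 2^(k + 1)\<close> on \<open>2 * k\<close> elements, so \<open>C^2\<close> exceeds
  \<open>2^(2 * k)\<close> by a factor 4. A preliminary guess on six elements shrinks
  \<open>C\<close> by a factor 4 at the price of a constant 20 in \<open>N\<close>. Then
  \<open>C = 2^(k - 1)\<close>, and \<open>N * C^2 < 4^(2 * k)\<close> becomes
  \<open>100 * (2 * k choose k) < 4^k\<close>, which holds for large \<open>k\<close>.\<close>

lemma coverable_subcritical:
  obtains m N C where "coverable m N C" "C\<^sup>2 < 2 ^ m" "N * C\<^sup>2 < 4 ^ m" "0 < m" "0 < N" "0 < C"
proof -
  \<comment> \<open>\<open>10000 = 100^2\<close>: this makes \<open>2 * k + 1\<close> exceed the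
    square of the factor 100 that has to be absorbed.\<close>
  obtain j :: nat where j: "10000 \<le> j" by blast
  define k where "k = 6 + j"
  have "coverable (2 * 3) ((2 * 3 choose 3) * 1\<^sup>2) (2 * 2 ^ 3)"
    by (rule coverable_series[OF coverable_Pow])
  \<comment> \<open>\<open>20 = 6 choose 3\<close>, and \<open>16 = 2 * 2^3\<close> is a quarter of
    \<open>2^6\<close>.\<close>
  then have "coverable 6 20 16" by (simp add: eval_nat_numeral)
  then have "coverable (6 + j) (20 * 1) (16 * 2 ^ j)"
    by (rule coverable_mult[OF _ coverable_Pow])
  then have cov: "coverable (2 * k) ((2 * k choose k) * 20\<^sup>2) (2 * (16 * 2 ^ j))"
    unfolding k_def by (intro coverable_series) simp
  define c where "c = (2 * k choose k)"
  have "(100 * c)\<^sup>2 < (4 ^ k)\<^sup>2"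
  proof -
    have "(100 * c)\<^sup>2 = c\<^sup>2 * 10000" by (simp add: power2_eq_square)
    also have "\<dots> < c\<^sup>2 * (2 * k + 1)" using j by (simp add: c_def k_def)
    also have "\<dots> \<le> 16 ^ k" unfolding c_def by (rule central_binomial_square_le)
    also have "(16::nat) ^ k = (4 ^ k)\<^sup>2"
      by (simp add: power2_eq_square power_mult_distrib[symmetric])
    finally show ?thesis .
  qed
  then have c: "100 * c < 4 ^ k" by (rule power_less_imp_less_base) simp
  have p: "(2::nat) ^ (2 * k) = 4 ^ k" "(4::nat) ^ (2 * k) = 4 ^ k * 4 ^ k"
    by (simp add: power_mult) (simp add: mult_2 power_add)
  have q: "4 * (2 * (16 * 2 ^ j))\<^sup>2 = (4::nat) ^ k"
    by (simp add: k_def power_add power2_eq_square power_mult_distrib[symmetric])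
  show thesis
  proof (rule that[OF cov])
    show "(2 * (16 * 2 ^ j))\<^sup>2 < (2::nat) ^ (2 * k)" unfolding p q[symmetric] by simp
    have "4 * ((2 * k choose k) * 20\<^sup>2 * (2 * (16 * 2 ^ j))\<^sup>2) = c * 400 * (4 * (2 * (16 * 2 ^ j))\<^sup>2)"
      by (simp add: c_def)
    also have "\<dots> = 4 * ((100 * c) * 4 ^ k)" unfolding q by simp
    also have "\<dots> < 4 * (4 ^ k * 4 ^ k)" using c by simp
    finally show "(2 * k choose k) * 20\<^sup>2 * (2 * (16 * 2 ^ j))\<^sup>2 < (4::nat) ^ (2 * k)" unfolding p by simp
  qed (auto simp: k_def)
qed

text \<open>With \<open>q\<close> copies of the cover above and \<open>p\<close> unconstrained elements both inequalities
  become linear in \<open>p / q\<close>, and they leave a nonempty open interval for it.\<close>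

lemma coverable_tradeoff:
  fixes T :: real
  assumes "2 < T" "T \<le> 2 * sqrt 2"
  obtains m N C where "coverable m N C" "0 < m" "0 < N" "2 \<le> C"
    "real (N * C) \<le> T ^ m" "real C * T ^ m < 4 ^ m"
proof -
  obtain m N C where cov: "coverable m N C" and c: "C\<^sup>2 < 2 ^ m" "N * C\<^sup>2 < 4 ^ m"
    and pos: "0 < m" "0 < N" "0 < C" by (rule coverable_subcritical)
  \<comment> \<open>The logarithmic excess of \<open>T\<close> over the classical time 2. The
    hypothesis \<open>T \<le> 2 * sqrt 2\<close> enters as
    \<open>\<theta> \<le> ln 2 / 2\<close>.\<close>
  define \<theta> where "\<theta> = ln T - ln 2"
  have \<theta>0: "0 < \<theta>" using assms by (simp add: \<theta>_def)
  have "ln T \<le> ln (2 * sqrt 2)" using assms by (subst ln_le_cancel_iff) auto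
  also have "\<dots> = ln 2 + ln 2 / 2" by (simp add: ln_mult ln_sqrt)
  finally have \<theta>1: "\<theta> \<le> ln 2 / 2" by (simp add: \<theta>_def)
  have l1: "2 * ln (real C) < m * ln 2"
  proof -
    have "ln (real C ^ 2) < ln (2 ^ m)"
      using c(1)[folded of_nat_less_iff[where 'a=real]] pos by (subst ln_less_cancel_iff) auto
    then show ?thesis using pos by (simp add: ln_realpow)
  qed
  have l2: "ln (real N) + 2 * ln (real C) < 2 * m * ln 2"
  proof -
    have "real (N * C\<^sup>2) < real (4 ^ m)" using c(2) by (simp only: of_nat_less_iff)
    then have "ln (real N * real C ^ 2) < ln (4 ^ m)" using pos by (subst ln_less_cancel_iff) auto
    moreover have "ln (4::real) = 2 * ln 2" using ln_realpow[of "2::real" 2] by simp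
    ultimately show ?thesis using pos by (simp add: ln_realpow ln_mult)
  qed
  \<comment> \<open>For \<open>x = p / q\<close> the time condition bounds \<open>x\<close> from
    below by the second argument of \<open>max\<close>, and the space condition is
    \<open>x < hi\<close>. The 0 forces \<open>p > 0\<close>, which later gives the final bound
    \<open>2 \<le> C\<close>.\<close>
  define lo where "lo = max 0 ((ln (real N) + ln (real C) - m * ln 2) / \<theta> - m)"
  define hi where "hi = (m * ln 2 - ln (real C)) / \<theta> - m"
  \<comment> \<open>\<open>N * C^2 < 4^m\<close> separates the two quotients by
    \<open>\<theta>\<close>; \<open>C^2 < 2^m\<close> together with
    \<open>\<theta> \<le> ln 2 / 2\<close> makes \<open>hi\<close> positive.\<close>
  have "lo < hi"
  proof -
    have "m * \<theta> \<le> m * (ln 2 / 2)" using \<theta>1 by (intro mult_left_mono) auto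
    then have "0 < hi" using l1 \<theta>0 by (simp add: hi_def field_simps)
    moreover have "(ln (real N) + ln (real C) - m * ln 2) / \<theta> < (m * ln 2 - ln (real C)) / \<theta>"
      using l2 \<theta>0 by (intro divide_strict_right_mono) auto
    ultimately show ?thesis by (simp add: lo_def hi_def)
  qed
  then obtain x where x: "x \<in> \<rat>" "lo < x" "x < hi" using Rats_dense_in_real by blast
  then have "0 < x" by (simp add: lo_def)
  then obtain p q :: nat where pq: "x = real p / real q" "0 < q"
    using x(1) by (metis Rats_abs_nat_div_natE abs_of_pos of_nat_0_less_iff gr0I)
  have "0 < p" using \<open>0 < x\<close> pq by (cases p) auto
  let ?m = "q * m + p" and ?N = "N ^ q * 1" and ?C = "C ^ q * 2 ^ p"
  have cov': "coverable ?m ?N ?C"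
    by (intro coverable_mult coverable_power cov coverable_Pow)
  have i1: "q * (ln (real N) + ln (real C)) + p * ln 2 \<le> ?m * ln T"
  proof -
    have "(ln (real N) + ln (real C) - m * ln 2) / \<theta> - m < real p / real q"
      using x(2) unfolding lo_def pq(1) by simp
    then have "q * (ln (real N) + ln (real C) - m * ln 2 - m * \<theta>) < p * \<theta>"
      using \<theta>0 pq(2) by (simp add: field_simps)
    then show ?thesis by (simp add: \<theta>_def algebra_simps)
  qed
  have i2: "q * ln (real C) + p * ln 2 + ?m * ln T < 2 * ?m * ln 2"
  proof -
    have "real p / real q < (m * ln 2 - ln (real C)) / \<theta> - m"
      using x(3) unfolding hi_def pq(1) by simp
    then have "p * \<theta> < q * (m * ln 2 - ln (real C) - m * \<theta>)"
      using \<theta>0 pq(2) by (simp add: field_simps)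
    then show ?thesis by (simp add: \<theta>_def algebra_simps)
  qed
  have T0: "0 < T" using assms by simp
  show thesis
  proof (rule that[OF cov'])
    show "0 < ?m" "0 < ?N" using pos pq by auto
    have "2 * 1 \<le> 2 ^ p * C ^ q" using pos \<open>0 < p\<close>
      by (intro mult_le_mono) (auto simp: self_le_power)
    then show "2 \<le> ?C" by (simp add: mult.commute)
    have "ln (real (?N * ?C)) = q * (ln (real N) + ln (real C)) + p * ln 2"
      using pos by (simp add: ln_mult ln_realpow algebra_simps)
    also have "\<dots> \<le> ln (T ^ ?m)" using i1 T0 by (simp add: ln_realpow)
    finally show "real (?N * ?C) \<le> T ^ ?m"
      using pos T0 by (subst (asm) ln_le_cancel_iff) auto
    have "ln (real ?C * T ^ ?m) = q * ln (real C) + p * ln 2 + ?m * ln T"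
      using pos T0 by (simp add: ln_mult ln_realpow)
    also have "\<dots> < ?m * (2 * ln 2)" using i2 by (simp add: algebra_simps)
    also have "2 * ln 2 = ln (4::real)" using ln_realpow[of "2::real" 2] by simp
    also have "?m * ln 4 = ln ((4::real) ^ ?m)" by (simp add: ln_realpow)
    finally show "real ?C * T ^ ?m < 4 ^ ?m"
      using pos T0 by (subst (asm) ln_less_cancel_iff) auto
  qed
qed

section \<open>Digits, automata and paths\<close>

definition digit :: "nat \<Rightarrow> nat \<Rightarrow> nat \<Rightarrow> nat" where
  "digit b x g = x div b ^ g mod b"

lemma digit_0: "digit b x 0 = x mod b"
  by (simp add: digit_def)

lemma digit_Suc: "digit b x (Suc g) = digit b (x div b) g"
  by (simp add: digit_def div_mult2_eq)

lemma digit_less: "0 < b \<Longrightarrow> digit b x g < b"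
  by (simp add: digit_def)

text \<open>Serves for two choices made all at once: an automaton for every group (base
  \<open>N\<close>) and the characteristic vector of the first half of a path (base 2).\<close>

lemma digits_exist:
  assumes "0 < b" "\<forall>g<G. f g < b"
  shows "\<exists>x<b ^ G. \<forall>g<G. digit b x g = f g"
  using assms(2)
proof (induction G arbitrary: f)
  case (Suc G)
  then have "\<exists>x<b ^ G. \<forall>g<G. digit b x g = f (Suc g)"
    by (intro Suc.IH) auto
  then obtain x where x: "x < b ^ G" "\<forall>g<G. digit b x g = f (Suc g)" by blast
  have f0: "f 0 < b" using Suc.prems by simp
  have "digit b (f 0 + b * x) g = f g" if "g < Suc G" for g
    using that x(2) f0 assms(1) by (cases g) (auto simp: digit_0 digit_Suc)
  moreover have "f 0 + b * x < b * b ^ G"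
  proof -
    have "f 0 + b * x < b * Suc x" using f0 by simp
    also have "\<dots> \<le> b * b ^ G" using x(1) by (intro mult_le_mono) auto
    finally show ?thesis .
  qed
  ultimately show ?case by auto
qed simp

lemma digit_update:
  assumes "j < b ^ G" "g < G" "v < b" "digit b j g \<le> v"
  defines "j' \<equiv> j + (v - digit b j g) * b ^ g"
  shows "j' < b ^ G" "h < G \<Longrightarrow> digit b j' h = (if h = g then v else digit b j h)"
proof -
  have "j + (v - digit b j g) * b ^ g < b ^ G \<and>
    (\<forall>h. digit b (j + (v - digit b j g) * b ^ g) h = (if h = g then v else digit b j h))"
    using assms(1,2,4)
  proof (induction g arbitrary: j G)
    case 0
    obtain G' where G': "G = Suc G'" using 0 by (cases G) auto
    define q where "q = j div b"
    have "j = b * q + j mod b" by (simp add: q_def)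
    then have e: "j + (v - j mod b) = b * q + v" using 0 by (simp add: digit_0)
    have q: "q < b ^ G'"
      using 0 assms(3) unfolding q_def G' by (simp add: less_mult_imp_div_less mult.commute)
    have "b * q + v < b * Suc q" using assms(3) by simp
    also have "\<dots> \<le> b * b ^ G'" using q by (intro mult_le_mono) auto
    finally have "b * q + v < b ^ G" by (simp add: G')
    moreover have "digit b (b * q + v) h = (if h = 0 then v else digit b j h)" for h
      using assms(3) by (cases h) (auto simp: digit_0 digit_Suc q_def)
    ultimately show ?case by (simp add: digit_0 e)
  next
    case (Suc g)
    obtain G' where G': "G = Suc G'" using Suc by (cases G) auto
    define q where "q = j div b"
    define D where "D = (v - digit b j (Suc g)) * b ^ g"
    have dg: "digit b j (Suc g) = digit b q g" by (simp add: digit_Suc q_def)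
    have q: "q < b ^ G'"
      using Suc assms(3) unfolding q_def G' by (simp add: less_mult_imp_div_less mult.commute)
    have IH: "q + D < b ^ G'" "\<And>h. digit b (q + D) h = (if h = g then v else digit b q h)"
      using Suc.IH[OF q] Suc.prems G' by (auto simp: dg D_def)
    have jD: "j + (v - digit b j (Suc g)) * b ^ Suc g = j mod b + b * (q + D)"
      by (simp add: q_def D_def algebra_simps)
    have jm: "j mod b < b" using assms(3) by simp
    have "j mod b + b * (q + D) < b * Suc (q + D)" using jm by simp
    also have "\<dots> \<le> b * b ^ G'" using IH(1) by (intro mult_le_mono) auto
    finally have "j mod b + b * (q + D) < b ^ G" by (simp add: G')
    moreover have "digit b (j mod b + b * (q + D)) h = (if h = Suc g then v else digit b j h)" for h
      using jm IH(2) by (cases h) (auto simp: digit_0 digit_Suc q_def)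
    ultimately show ?case unfolding jD by blast
  qed
  then show "j' < b ^ G" "h < G \<Longrightarrow> digit b j' h = (if h = g then v else digit b j h)"
    by (auto simp: j'_def)
qed

primrec accepts :: "(nat \<Rightarrow> nat \<Rightarrow> nat) \<Rightarrow> nat \<Rightarrow> nat list \<Rightarrow> bool" where
  "accepts f j [] \<longleftrightarrow> True"
| "accepts f j (x # xs) \<longleftrightarrow> f j x \<noteq> 0 \<and> accepts f (f j x) xs"

lemma accepts_append: "accepts f j (xs @ ys) \<Longrightarrow> accepts f j xs"
  by (induction xs arbitrary: j) auto

text \<open>A set system, numbered by increasing cardinality, as an automaton that reads a
  permutation while the set of letters read so far stays in the system. State \<open>0\<close> is the empty
  set, so the value \<open>0\<close> of the transition function is free to mean rejection.\<close>

lemma automaton_of_set_system: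
  fixes F :: "nat set set"
  assumes "finite F" "card F \<le> C" "0 < C" "\<forall>X\<in>F. finite X"
  shows "\<exists>f lab. lab 0 = {} \<and>
    (\<forall>j<C. \<forall>e. f j e < C \<and>
       (f j e \<noteq> 0 \<longrightarrow> j < f j e \<and> e \<notin> lab j \<and> lab (f j e) = insert e (lab j))) \<and>
    (\<forall>xs. distinct xs \<and> (\<forall>k. set (take k xs) \<in> F) \<longrightarrow> accepts f 0 xs)"
proof (cases "{} \<in> F")
  \<comment> \<open>No prefix chain can stay in \<open>F\<close>, as it starts with the empty set,
    so an automaton that always rejects will do.\<close>
  case False
  then have "\<not> (\<forall>k. set (take k xs) \<in> F)" for xs :: "nat list"
    by (metis empty_set take0)
  then show ?thesis
    by (intro exI[of _ "\<lambda>_ _. 0"] exI[of _ "\<lambda>_. {}"]) (use assms(3) in auto)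
next
  case True
  obtain ys where ys: "set ys = F" "distinct ys"
    using finite_distinct_list[OF assms(1)] by blast
  \<comment> \<open>Sorting by cardinality makes every insertion of a new element raise the index
    and puts the empty set at index 0.\<close>
  define l where "l = sort_key card ys"
  have l: "set l = F" "distinct l" "sorted (map card l)" using ys by (auto simp: l_def)
  have len: "length l \<le> C" using l assms(2) by (metis distinct_card)
  have pos: "0 < length l" using True l by (metis length_pos_if_in_set)
  have l0: "l ! 0 = {}"
  proof -
    obtain k where k: "k < length l" "l ! k = {}" using True l by (metis in_set_conv_nth)
    have "card (l ! 0) \<le> card (l ! k)"
      using sorted_nth_mono[OF l(3), of 0 k] k pos by simp
    then have "card (l ! 0) = 0" using k by simp
    moreover have "finite (l ! 0)" using assms(4) l(1) pos nth_mem by blast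
    ultimately show ?thesis by simp
  qed
  have ix: "\<exists>k. A \<in> F \<longrightarrow> k < length l \<and> l ! k = A" for A
    using l(1) by (metis in_set_conv_nth)
  then obtain ind where ind: "\<And>A. A \<in> F \<Longrightarrow> ind A < length l \<and> l ! ind A = A" by metis
  define f where "f = (\<lambda>j e. if j < length l \<and> e \<notin> l ! j \<and> insert e (l ! j) \<in> F
    then ind (insert e (l ! j)) else 0)"
  have step: "j < ind (insert e (l ! j))"
    if "j < length l" "e \<notin> l ! j" "insert e (l ! j) \<in> F" for j e
  proof (rule ccontr)
    assume "\<not> j < ind (insert e (l ! j))"
    then have "card (insert e (l ! j)) \<le> card (l ! j)"
      using sorted_nth_mono[OF l(3), of "ind (insert e (l ! j))" j] ind[OF that(3)] that(1) by simp
    moreover have "finite (l ! j)" using assms(4) l(1) that(1) nth_mem by blast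
    ultimately show False using that(2) by simp
  qed
  \<comment> \<open>The claim for state 0 is generalised to a state \<open>j\<close> whose set has
    been read already, so that the induction can run over the remaining letters.\<close>
  have acc: "accepts f j xs"
    if "j < length l" "\<forall>k. l ! j \<union> set (take k xs) \<in> F" "distinct xs" "set xs \<inter> l ! j = {}" for j xs
    using that
  proof (induction xs arbitrary: j)
    case (Cons x xs)
    have xF: "insert x (l ! j) \<in> F" using Cons.prems(2)[rule_format, of 1] by simp
    then have fj: "f j x = ind (insert x (l ! j))" using Cons.prems by (auto simp: f_def)
    have "f j x \<noteq> 0" using step[of j x] Cons.prems xF fj by auto
    moreover have "accepts f (f j x) xs"
    proof (rule Cons.IH)
      show "f j x < length l" using fj ind[OF xF] by simp
      show "\<forall>k. l ! f j x \<union> set (take k xs) \<in> F"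
      proof
        fix k
        show "l ! f j x \<union> set (take k xs) \<in> F"
          using Cons.prems(2)[rule_format, of "Suc k"] ind[OF xF] fj by (simp)
      qed
      show "distinct xs" "set xs \<inter> l ! f j x = {}" using Cons.prems ind[OF xF] fj by auto
    qed
    ultimately show ?case by simp
  qed simp
  show ?thesis
  proof (intro exI[of _ f] exI[of _ "\<lambda>j. l ! j"] conjI allI impI)
    show "l ! 0 = {}" by (rule l0)
  next
    fix j e assume "j < C"
    show "f j e < C" using ind len assms(3) by (auto simp: f_def intro: less_le_trans)
  next
    fix j e assume j: "j < C" "f j e \<noteq> 0"
    then have *: "j < length l" "e \<notin> l ! j" "insert e (l ! j) \<in> F"
      by (auto simp: f_def split: if_splits)
    then show "j < f j e" "e \<notin> l ! j" "l ! f j e = insert e (l ! j)"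
      using step[OF *] ind[OF *(3)] by (auto simp: f_def)
  next
    fix xs :: "nat list" assume "distinct xs \<and> (\<forall>k. set (take k xs) \<in> F)"
    then show "accepts f 0 xs" using acc[of 0 xs] pos l0 by simp
  qed
qed

text \<open>The systems of a cover of \<open>{..<M}\<close> become automata over the letters below
  \<open>M\<close>. A word that omits letters is completed to a permutation, and acceptance passes
  to prefixes; this takes care of a last group with fewer than \<open>M\<close> cities.\<close>

lemma coverable_automata:
  assumes "coverable M N C" "0 < N" "0 < C"
  shows "\<exists>f lab. (\<forall>i. lab i 0 = {}) \<and>
    (\<forall>i. \<forall>j<C. \<forall>e. f i j e < C \<and>
       (f i j e \<noteq> 0 \<longrightarrow> j < f i j e \<and> e \<notin> lab i j \<and> lab i (f i j e) = insert e (lab i j))) \<and>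
    (\<forall>xs. distinct xs \<and> set xs \<subseteq> {..<M} \<longrightarrow> (\<exists>i<N. accepts (f i) 0 xs))"
proof -
  obtain \<F> where F: "card \<F> \<le> N" "chain_cover {..<M} \<F> C"
    using assms(1) by (auto simp: coverable_def)
  obtain h where h: "bij_betw h {0..<card \<F>} \<F>"
    using ex_bij_betw_nat_finite[of \<F>] F(2) unfolding chain_cover_def by blast
  \<comment> \<open>Indices beyond the actual number of systems get the empty system. Infinite
    members are dropped because the automaton is built by sorting with \<open>card\<close>, and no
    prefix set is infinite.\<close>
  define S where "S = (\<lambda>i. if i < card \<F> then {X \<in> h i. finite X} else {})"
  have S: "finite (S i) \<and> card (S i) \<le> C \<and> (\<forall>X\<in>S i. finite X)" for i
  proof (cases "i < card \<F>")
    case True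
    then have "h i \<in> \<F>" using h by (auto simp: bij_betw_def)
    then have "finite (h i)" "card (h i) \<le> C" using F(2) by (auto simp: chain_cover_def)
    then show ?thesis
      using True card_mono[of "h i" "{X \<in> h i. finite X}"] by (auto simp: S_def)
  qed (simp add: S_def)
  have "\<forall>i. \<exists>f lab. lab 0 = {} \<and>
    (\<forall>j<C. \<forall>e. f j e < C \<and>
       (f j e \<noteq> 0 \<longrightarrow> j < f j e \<and> e \<notin> lab j \<and> lab (f j e) = insert e (lab j))) \<and>
    (\<forall>xs. distinct xs \<and> (\<forall>k. set (take k xs) \<in> S i) \<longrightarrow> accepts f 0 xs)"
    using automaton_of_set_system S assms(3) by blast
  then obtain f lab where fl: "\<And>i. lab i 0 = {} \<and>
    (\<forall>j<C. \<forall>e. f i j e < C \<and>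
       (f i j e \<noteq> 0 \<longrightarrow> j < f i j e \<and> e \<notin> lab i j \<and> lab i (f i j e) = insert e (lab i j))) \<and>
    (\<forall>xs. distinct xs \<and> (\<forall>k. set (take k xs) \<in> S i) \<longrightarrow> accepts (f i) 0 xs)"
    by metis
  have "\<exists>i<N. accepts (f i) 0 xs" if xs: "distinct xs" "set xs \<subseteq> {..<M}" for xs
  proof -
    obtain ys where ys: "set ys = {..<M} - set xs" "distinct ys"
      using finite_distinct_list[of "{..<M} - set xs"] by auto
    have "distinct (xs @ ys)" "set (xs @ ys) = {..<M}" using xs ys by auto
    then obtain F' where F': "F' \<in> \<F>" "\<And>k. set (take k (xs @ ys)) \<in> F'"
      using F(2) unfolding chain_cover_def by blast
    then obtain i where i: "i < card \<F>" "h i = F'"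
      using h unfolding bij_betw_def by (metis atLeastLessThan_iff imageE)
    have "\<forall>k. set (take k (xs @ ys)) \<in> S i" using F' i by (auto simp: S_def simp del: take_append)
    then have "accepts (f i) 0 (xs @ ys)"
      using fl[of i] \<open>distinct (xs @ ys)\<close> by blast
    then show ?thesis using accepts_append i(1) F(1) by (meson less_le_trans)
  qed
  then show ?thesis using fl by (intro exI[of _ f] exI[of _ lab]) blast
qed

section \<open>Walks, optimal paths and tours\<close>

primrec walk_length :: "('a \<Rightarrow> 'a \<Rightarrow> real) \<Rightarrow> 'a \<Rightarrow> 'a list \<Rightarrow> real" where
  "walk_length d a [] = 0"
| "walk_length d a (x # xs) = d a x + walk_length d x xs"

lemma walk_length_append:
  "walk_length d a (xs @ ys) = walk_length d a xs + walk_length d (last (a # xs)) ys"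
  by (induction xs arbitrary: a) auto

text \<open>\<open>X\<close> consists of the inner vertices. \<open>a = b\<close> is permitted, so
  that a tour is the case \<open>X = {2..n}\<close> with both ends at city 1. Witness and lower
  bound are kept as separate conjuncts, as the program establishes them separately.\<close>

definition optimal_path :: "('a \<Rightarrow> 'a \<Rightarrow> real) \<Rightarrow> 'a set \<Rightarrow> 'a \<Rightarrow> 'a \<Rightarrow> real \<Rightarrow> bool" where
  "optimal_path d X a b v \<longleftrightarrow>
     (\<exists>xs. distinct xs \<and> set xs = X \<and> v = walk_length d a (xs @ [b])) \<and>
     (\<forall>xs. distinct xs \<and> set xs = X \<longrightarrow> v \<le> walk_length d a (xs @ [b]))"

definition cycle_length :: "('a \<Rightarrow> 'a \<Rightarrow> real) \<Rightarrow> 'a list \<Rightarrow> real" where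
  "cycle_length d xs = walk_length d (hd xs) (tl xs @ [hd xs])"

lemma cycle_length_rotate1: "cycle_length d (rotate1 xs) = cycle_length d xs"
proof (cases xs)
  case (Cons x ys)
  then show ?thesis by (cases ys) (auto simp: cycle_length_def walk_length_append)
qed (simp add: cycle_length_def)

lemma cycle_length_rotate: "cycle_length d (rotate k xs) = cycle_length d xs"
  by (induction k) (auto simp: cycle_length_rotate1)

lemma walk_length_map_upt:
  "i \<le> j \<Longrightarrow> walk_length d (f i) (map f [Suc i..<Suc j]) = (\<Sum>k = i..<j. d (f k) (f (Suc k)))"
proof (induction j)
  case (Suc j)
  show ?case
  proof (cases "i = Suc j")
    case False
    then have ij: "i \<le> j" using Suc by simp
    then have "map f [Suc i..<Suc (Suc j)] = map f [Suc i..<Suc j] @ [f (Suc j)]" by simp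
    moreover have "last (f i # map f [Suc i..<Suc j]) = f j"
      using ij by (cases "i = j") (auto simp: last_map)
    ultimately show ?thesis using Suc.IH[OF ij] ij by (simp add: walk_length_append)
  qed simp
qed simp

lemma tour_length_eq_cycle_length:
  assumes "1 \<le> n"
  shows "tour_length n d \<pi> = cycle_length d (map \<pi> [1..<Suc n])"
proof -
  have e: "[1..<Suc n] = 1 # [Suc 1..<Suc n]" using assms by (simp add: upt_conv_Cons)
  have la: "last (\<pi> 1 # map \<pi> [Suc 1..<Suc n]) = \<pi> n"
    using assms by (cases "n = 1") (auto simp: last_map)
  have s: "{1..<n} = {1..n - 1}" using assms by auto
  have "cycle_length d (map \<pi> [1..<Suc n]) = walk_length d (\<pi> 1) (map \<pi> [Suc 1..<Suc n] @ [\<pi> 1])"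
    unfolding cycle_length_def e by simp
  also have "\<dots> = walk_length d (\<pi> 1) (map \<pi> [Suc 1..<Suc n]) + d (\<pi> n) (\<pi> 1)"
    by (simp only: walk_length_append la) simp
  also have "walk_length d (\<pi> 1) (map \<pi> [Suc 1..<Suc n]) = (\<Sum>k = 1..<n. d (\<pi> k) (\<pi> (Suc k)))"
    by (rule walk_length_map_upt[OF assms])
  finally show ?thesis unfolding s tour_length_def by simp
qed

text \<open>A tour has the length of any of its rotations, so it may start at city 1, and what
  follows is an ordering of the other cities. Conversely every such ordering yields a permutation.
  For \<open>n = 1\<close> both sides are \<open>d 1 1\<close>.\<close>

lemma tsp_opt_eq:
  assumes n: "1 \<le> n" and v: "optimal_path d {2..n} 1 1 v"
  shows "tsp_opt n d = v"
  unfolding tsp_opt_def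
proof (rule Min_eqI)
  show "finite (tour_length n d ` {\<pi>. \<pi> permutes {1..n}})"
    by (intro finite_imageI finite_permutations) simp
next
  fix y assume "y \<in> tour_length n d ` {\<pi>. \<pi> permutes {1..n}}"
  then obtain \<pi> where \<pi>: "\<pi> permutes {1..n}" "y = tour_length n d \<pi>" by blast
  define ys where "ys = map \<pi> [1..<Suc n]"
  have set: "set ys = {1..n}"
    using permutes_image[OF \<pi>(1)] unfolding ys_def set_map set_upt atLeastLessThanSuc_atLeastAtMost .
  have dist: "distinct ys"
    using permutes_inj[OF \<pi>(1)] unfolding ys_def by (simp add: distinct_map inj_on_subset)
  obtain k where k: "k < length ys" "ys ! k = 1"
    using set n by (metis atLeastAtMost_iff in_set_conv_nth order_refl)
  then have "ys \<noteq> []" by auto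
  define zs where "zs = rotate k ys"
  have zs: "distinct zs" "set zs = {1..n}" "hd zs = 1" "zs \<noteq> []"
    using dist set k hd_rotate_conv_nth[OF \<open>ys \<noteq> []\<close>, of k] by (auto simp: zs_def)
  have "set (tl zs) = {2..n}"
  proof -
    have "zs = 1 # tl zs" using zs by (metis list.collapse)
    then have "set zs = insert 1 (set (tl zs))" "1 \<notin> set (tl zs)"
      using zs(1) by (metis list.simps(15), metis distinct.simps(2))
    moreover have "{2..n} = {1..n} - {1}" by auto
    ultimately show ?thesis using zs(2) by auto
  qed
  moreover have "distinct (tl zs)" using zs(1) by (rule distinct_tl)
  ultimately have "v \<le> walk_length d 1 (tl zs @ [1])" using v by (auto simp: optimal_path_def)
  also have "\<dots> = cycle_length d zs" using zs(3) by (simp add: cycle_length_def)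
  also have "\<dots> = y"
    unfolding zs_def cycle_length_rotate \<pi>(2) ys_def tour_length_eq_cycle_length[OF n] ..
  finally show "v \<le> y" .
next
  obtain xs where xs: "distinct xs" "set xs = {2..n}" "v = walk_length d 1 (xs @ [1])"
    using v by (auto simp: optimal_path_def)
  define ys where "ys = 1 # xs"
  have ys: "distinct ys" "set ys = {1..n}" "length ys = n"
  proof -
    show "distinct ys" using xs by (auto simp: ys_def)
    show s: "set ys = {1..n}" using xs n by (auto simp: ys_def)
    show "length ys = n" using \<open>distinct ys\<close> s by (metis card_atLeastAtMost diff_Suc_1 distinct_card)
  qed
  \<comment> \<open>\<open>permutes\<close> requires the identity outside \<open>{1..n}\<close>; the
    shift by one is due to lists being indexed from 0.\<close>
  define \<pi> where "\<pi> = (\<lambda>i. if i \<in> {1..n} then ys ! (i - 1) else i)"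
  have m: "map \<pi> [1..<Suc n] = ys"
    using ys(3) by (intro nth_equalityI) (auto simp: \<pi>_def simp del: upt_Suc)
  have "\<pi> permutes {1..n}"
  proof (rule bij_imp_permutes)
    have "\<pi> ` {1..n} = set (map \<pi> [1..<Suc n])" by (auto simp: atLeastLessThanSuc_atLeastAtMost)
    then have "\<pi> ` {1..n} = {1..n}" unfolding m using ys by simp
    then show "bij_betw \<pi> {1..n} {1..n}"
      by (metis bij_betw_def finite_atLeastAtMost finite_surj_inj order_refl)
  qed (auto simp: \<pi>_def)
  moreover have "v = tour_length n d \<pi>"
    unfolding tour_length_eq_cycle_length[OF n] m using xs by (simp add: cycle_length_def ys_def)
  ultimately show "v \<in> tour_length n d ` {\<pi>. \<pi> permutes {1..n}}" by blast
qed

section \<open>Program logic\<close>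

text \<open>A running time bound for loop-free code, valid for either branch of a conditional. The
  value for \<open>While\<close> is a dummy, since \<open>csafe\<close> excludes loops.\<close>

primrec com_time :: "com \<Rightarrow> nat" where
  "com_time Skip = 1"
| "com_time (WStore a e) = 1 + wcost a + wcost e"
| "com_time (VStore a e) = 1 + wcost a + vcost e"
| "com_time (Seq c1 c2) = com_time c1 + com_time c2"
| "com_time (Cond b c1 c2) = 1 + bcost b + max (com_time c1) (com_time c2)"
| "com_time (While b c) = 0"

text \<open>\<open>B\<close> bounds the contents of memory cells, and \<open>Z\<close> the cost of
  any piece of code that is executed symbolically; the second assumption leaves room for all
  intermediate results of such code.\<close>

locale machine =
  fixes n :: nat and d :: "nat \<Rightarrow> nat \<Rightarrow> real" and w s B Z :: nat
  assumes B_ge_2: "2 \<le> B" and B_power_le: "B ^ Z \<le> 2 ^ w" and n_less_B: "n < B"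
begin

text \<open>If all memory cells are below \<open>B\<close>, an expression of cost \<open>k\<close> is below \<open>B ^ k\<close>. Hence the
  word length only has to be large compared with \<open>B\<close>, and legality reduces to addresses being in
  range and to stored values being below \<open>B\<close>.\<close>

definition bounded :: "state \<Rightarrow> bool" where
  "bounded \<sigma> \<longleftrightarrow> (\<forall>x. words \<sigma> x < B \<and> fst (vals \<sigma> x) < B)"

primrec wsafe :: "state \<Rightarrow> wexp \<Rightarrow> bool" where
  "wsafe \<sigma> (Const k) \<longleftrightarrow> k < B"
| "wsafe \<sigma> Cities \<longleftrightarrow> True"
| "wsafe \<sigma> (WLoad a) \<longleftrightarrow> wsafe \<sigma> a \<and> weval n \<sigma> a < s"
| "wsafe \<sigma> (Plus a b) \<longleftrightarrow> wsafe \<sigma> a \<and> wsafe \<sigma> b"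
| "wsafe \<sigma> (Minus a b) \<longleftrightarrow> wsafe \<sigma> a \<and> wsafe \<sigma> b"
| "wsafe \<sigma> (Times a b) \<longleftrightarrow> wsafe \<sigma> a \<and> wsafe \<sigma> b"
| "wsafe \<sigma> (Div a b) \<longleftrightarrow> wsafe \<sigma> a \<and> wsafe \<sigma> b"
| "wsafe \<sigma> (Mod a b) \<longleftrightarrow> wsafe \<sigma> a \<and> wsafe \<sigma> b"

primrec vsafe :: "state \<Rightarrow> vexp \<Rightarrow> bool" where
  "vsafe \<sigma> VZero \<longleftrightarrow> True"
| "vsafe \<sigma> (Dist a b) \<longleftrightarrow>
     wsafe \<sigma> a \<and> wsafe \<sigma> b \<and> weval n \<sigma> a \<in> {1..n} \<and> weval n \<sigma> b \<in> {1..n}"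
| "vsafe \<sigma> (VLoad a) \<longleftrightarrow> wsafe \<sigma> a \<and> weval n \<sigma> a < s"
| "vsafe \<sigma> (VPlus u v) \<longleftrightarrow> vsafe \<sigma> u \<and> vsafe \<sigma> v"

primrec bsafe :: "state \<Rightarrow> bexp \<Rightarrow> bool" where
  "bsafe \<sigma> (WLess a b) \<longleftrightarrow> wsafe \<sigma> a \<and> wsafe \<sigma> b"
| "bsafe \<sigma> (VLess u v) \<longleftrightarrow> vsafe \<sigma> u \<and> vsafe \<sigma> v"
| "bsafe \<sigma> (BNot b) \<longleftrightarrow> bsafe \<sigma> b"
| "bsafe \<sigma> (BAnd b c) \<longleftrightarrow> bsafe \<sigma> b \<and> bsafe \<sigma> c"

lemma B_power_mono: "j \<le> k \<Longrightarrow> B ^ j \<le> B ^ k"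
  using B_ge_2 by (intro power_increasing) auto

lemma B_le_power_Suc: "B \<le> B ^ Suc k"
  using B_ge_2 by simp

lemma B_power_add_le: "x < B ^ j \<Longrightarrow> y < B ^ k \<Longrightarrow> x + y < B ^ Suc (j + k)"
proof -
  assume "x < B ^ j" "y < B ^ k"
  then have "x + y < B ^ (j + k) + B ^ (j + k)"
    using B_power_mono[of j "j + k"] B_power_mono[of k "j + k"] by linarith
  also have "\<dots> \<le> B * B ^ (j + k)" using mult_le_mono1[OF B_ge_2, of "B ^ (j + k)"] by linarith
  finally show ?thesis by simp
qed

lemma B_power_mult_le: "x < B ^ j \<Longrightarrow> y < B ^ k \<Longrightarrow> x * y < B ^ Suc (j + k)"
proof -
  assume *: "x < B ^ j" "y < B ^ k"
  have "x * y \<le> B ^ j * y" using * by (intro mult_le_mono) auto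
  also have "\<dots> < B ^ j * B ^ k" using * B_ge_2 by (intro mult_strict_left_mono) auto
  also have "\<dots> \<le> B ^ Suc (j + k)" using B_power_mono[of "j + k" "Suc (j + k)"] by (simp add: power_add)
  finally show ?thesis .
qed

lemma weval_less: "bounded \<sigma> \<Longrightarrow> wsafe \<sigma> e \<Longrightarrow> weval n \<sigma> e < B ^ wcost e"
proof (induction e)
  case (WLoad e)
  then show ?case using B_le_power_Suc[of "wcost e"]
    by (auto simp: bounded_def intro: less_le_trans simp del: power_Suc)
next
  case (Plus e1 e2)
  then show ?case using B_power_add_le by simp
next
  case (Minus e1 e2)
  then have "weval n \<sigma> e1 - weval n \<sigma> e2 < B ^ wcost e1" by (simp add: less_imp_diff_less)
  then show ?case using B_power_mono[of "wcost e1" "wcost (Minus e1 e2)"] by simp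
next
  case (Times e1 e2)
  then show ?case using B_power_mult_le by simp
next
  case (Div e1 e2)
  then have "weval n \<sigma> e1 div weval n \<sigma> e2 < B ^ wcost e1"
    by (meson div_le_dividend le_less_trans wsafe.simps)
  then show ?case using B_power_mono[of "wcost e1" "wcost (Div e1 e2)"] by simp
next
  case (Mod e1 e2)
  then have "weval n \<sigma> e1 mod weval n \<sigma> e2 < B ^ wcost e1"
    by (meson mod_less_eq_dividend le_less_trans wsafe.simps)
  then show ?case using B_power_mono[of "wcost e1" "wcost (Mod e1 e2)"] by simp
qed (auto simp: n_less_B)

lemma less_B_power: "k \<le> Z \<Longrightarrow> x < B ^ k \<Longrightarrow> x < 2 ^ w"
  using B_power_mono[of k Z] B_power_le by linarith

lemma bounded_less: "bounded \<sigma> \<Longrightarrow> 1 \<le> Z \<Longrightarrow> words \<sigma> x < 2 ^ w"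
  "bounded \<sigma> \<Longrightarrow> 1 \<le> Z \<Longrightarrow> fst (vals \<sigma> x) < 2 ^ w"
  by (rule less_B_power[of 1], auto simp: bounded_def)+

lemma wlegal_if_wsafe: "bounded \<sigma> \<Longrightarrow> wsafe \<sigma> e \<Longrightarrow> wcost e \<le> Z \<Longrightarrow> wlegal n w s \<sigma> e"
proof (induction e)
  case (Const k)
  then show ?case using less_B_power[of 1 k] by simp
next
  case Cities
  then show ?case using less_B_power[of 1 n] n_less_B by simp
next
  case (WLoad e)
  then show ?case using bounded_less by simp
next
  case (Plus e1 e2)
  then show ?case using weval_less[of \<sigma> "Plus e1 e2"] less_B_power[of "wcost (Plus e1 e2)"] by simp
next
  case (Times e1 e2)
  then show ?case using weval_less[of \<sigma> "Times e1 e2"] less_B_power[of "wcost (Times e1 e2)"] by simp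
qed auto

lemma veval_less: "bounded \<sigma> \<Longrightarrow> vsafe \<sigma> e \<Longrightarrow> fst (veval n d \<sigma> e) < B ^ vcost e"
proof (induction e)
  case VZero
  then show ?case using B_ge_2 by simp
next
  case (Dist a b)
  then show ?case using B_ge_2 B_le_power_Suc[of "wcost a + wcost b"] by (simp del: power_Suc)
next
  case (VLoad a)
  then show ?case using B_le_power_Suc[of "wcost a"]
    by (auto simp: bounded_def intro: less_le_trans simp del: power_Suc)
next
  case (VPlus u v)
  then show ?case using B_power_add_le by simp
qed

lemma vlegal_if_vsafe: "bounded \<sigma> \<Longrightarrow> vsafe \<sigma> e \<Longrightarrow> vcost e \<le> Z \<Longrightarrow> vlegal n d w s \<sigma> e"
proof (induction e)
  case (Dist a b)
  then show ?case using less_B_power[of 1 1] B_ge_2 by (auto simp: wlegal_if_wsafe)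
next
  case (VLoad a)
  then show ?case using bounded_less by (auto simp: wlegal_if_wsafe)
next
  case (VPlus u v)
  then show ?case using veval_less[of \<sigma> "VPlus u v"] less_B_power[of "vcost (VPlus u v)"] by simp
qed auto

lemma blegal_if_bsafe: "bounded \<sigma> \<Longrightarrow> bsafe \<sigma> b \<Longrightarrow> bcost b \<le> Z \<Longrightarrow> blegal n d w s \<sigma> b"
  by (induction b) (auto simp: wlegal_if_wsafe vlegal_if_vsafe)

section \<open>Symbolic execution of loop-free code and a program logic with time bounds\<close>

primrec com_eval :: "com \<Rightarrow> state \<Rightarrow> state" where
  "com_eval Skip \<sigma> = \<sigma>"
| "com_eval (WStore a e) \<sigma> = \<sigma>\<lparr>words := (words \<sigma>)(weval n \<sigma> a := weval n \<sigma> e)\<rparr>"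
| "com_eval (VStore a e) \<sigma> = \<sigma>\<lparr>vals := (vals \<sigma>)(weval n \<sigma> a := veval n d \<sigma> e)\<rparr>"
| "com_eval (Seq c1 c2) \<sigma> = com_eval c2 (com_eval c1 \<sigma>)"
| "com_eval (Cond b c1 c2) \<sigma> = (if beval n d \<sigma> b then com_eval c1 \<sigma> else com_eval c2 \<sigma>)"
| "com_eval (While b c) \<sigma> = \<sigma>"

primrec csafe :: "com \<Rightarrow> state \<Rightarrow> bool" where
  "csafe Skip \<sigma> \<longleftrightarrow> True"
| "csafe (WStore a e) \<sigma> \<longleftrightarrow> wsafe \<sigma> a \<and> weval n \<sigma> a < s \<and> wsafe \<sigma> e \<and> weval n \<sigma> e < B"
| "csafe (VStore a e) \<sigma> \<longleftrightarrow> wsafe \<sigma> a \<and> weval n \<sigma> a < s \<and> vsafe \<sigma> e \<and> fst (veval n d \<sigma> e) < B"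
| "csafe (Seq c1 c2) \<sigma> \<longleftrightarrow> csafe c1 \<sigma> \<and> csafe c2 (com_eval c1 \<sigma>)"
| "csafe (Cond b c1 c2) \<sigma> \<longleftrightarrow> bsafe \<sigma> b \<and> (if beval n d \<sigma> b then csafe c1 \<sigma> else csafe c2 \<sigma>)"
| "csafe (While b c) \<sigma> \<longleftrightarrow> False"

text \<open>Replaces the inductive semantics by rewriting: for loop-free code the simplifier
  computes \<open>com_eval\<close> and discharges \<open>csafe\<close>. Boundedness is part of the
  conclusion because it makes the next piece of code legal.\<close>

lemma exec_com_eval:
  "bounded \<sigma> \<Longrightarrow> csafe c \<sigma> \<Longrightarrow> com_time c \<le> Z \<Longrightarrow>
    bounded (com_eval c \<sigma>) \<and> (\<exists>t\<le>com_time c. exec n d w s c \<sigma> t (com_eval c \<sigma>))"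
proof (induction c arbitrary: \<sigma>)
  case Skip
  then show ?case using exec.Skip by auto
next
  case (WStore a e)
  then show ?case using exec.WStore[of n w s \<sigma> a e d]
    by (auto simp: wlegal_if_wsafe bounded_def)
next
  case (VStore a e)
  then show ?case using exec.VStore[of n w s \<sigma> a d e]
    by (auto simp: wlegal_if_wsafe vlegal_if_vsafe bounded_def)
next
  case (Seq c1 c2)
  then have 1: "bounded (com_eval c1 \<sigma>)" "\<exists>t\<le>com_time c1. exec n d w s c1 \<sigma> t (com_eval c1 \<sigma>)"
    by auto
  with Seq have "bounded (com_eval c2 (com_eval c1 \<sigma>))"
    "\<exists>t\<le>com_time c2. exec n d w s c2 (com_eval c1 \<sigma>) t (com_eval c2 (com_eval c1 \<sigma>))"
    by auto
  with 1(2) show ?case using exec.Seq by (simp, meson add_mono)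
next
  case (Cond b c1 c2)
  have b: "blegal n d w s \<sigma> b" using Cond by (auto simp: blegal_if_bsafe)
  show ?case
  proof (cases "beval n d \<sigma> b")
    case True
    then have "bounded (com_eval c1 \<sigma>)" "\<exists>t\<le>com_time c1. exec n d w s c1 \<sigma> t (com_eval c1 \<sigma>)"
      using Cond by auto
    then show ?thesis using True exec.CondTrue[OF b True, of c1 _ _ c2]
      by (simp, meson add_left_mono le_max_iff_disj Suc_le_mono)
  next
    case False
    then have "bounded (com_eval c2 \<sigma>)" "\<exists>t\<le>com_time c2. exec n d w s c2 \<sigma> t (com_eval c2 \<sigma>)"
      using Cond by auto
    then show ?thesis using False exec.CondFalse[OF b False, of c2 _ _ c1]
      by (simp, meson add_left_mono le_max_iff_disj Suc_le_mono)
  qed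
qed auto

text \<open>Total correctness with a time budget: a run that is not stuck exists.
  \<open>bounded\<close> is built in, because the code that follows relies on it.\<close>

definition wp :: "com \<Rightarrow> nat \<Rightarrow> (state \<Rightarrow> bool) \<Rightarrow> state \<Rightarrow> bool" where
  "wp c t Q \<sigma> \<longleftrightarrow> (\<exists>t' \<sigma>'. exec n d w s c \<sigma> t' \<sigma>' \<and> t' \<le> t \<and> bounded \<sigma>' \<and> Q \<sigma>')"

lemma wp_mono:
  "wp c t Q \<sigma> \<Longrightarrow> t \<le> t' \<Longrightarrow> (\<And>\<sigma>. bounded \<sigma> \<Longrightarrow> Q \<sigma> \<Longrightarrow> Q' \<sigma>) \<Longrightarrow> wp c t' Q' \<sigma>"
  unfolding wp_def by (meson order_trans)

lemma wp_straight:
  "bounded \<sigma> \<Longrightarrow> com_time c \<le> Z \<Longrightarrow> com_time c \<le> t \<Longrightarrow> csafe c \<sigma> \<Longrightarrow> Q (com_eval c \<sigma>) \<Longrightarrow> wp c t Q \<sigma>"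
  unfolding wp_def using exec_com_eval by (meson order_trans)

lemma wp_Seq: "wp c1 ta (wp c2 tb Q) \<sigma> \<Longrightarrow> ta + tb \<le> t \<Longrightarrow> wp (Seq c1 c2) t Q \<sigma>"
  unfolding wp_def by (meson add_mono exec.Seq order_trans)

lemma wp_Cond:
  assumes "bounded \<sigma>" "bsafe \<sigma> b" "bcost b \<le> Z"
    "beval n d \<sigma> b \<Longrightarrow> wp c1 tc Q \<sigma>" "\<not> beval n d \<sigma> b \<Longrightarrow> wp c2 tc Q \<sigma>" "1 + bcost b + tc \<le> t"
  shows "wp (Cond b c1 c2) t Q \<sigma>"
proof -
  have b: "blegal n d w s \<sigma> b" using assms by (simp add: blegal_if_bsafe)
  show ?thesis
  proof (cases "beval n d \<sigma> b")
    case True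
    then show ?thesis using assms exec.CondTrue[OF b True] unfolding wp_def
      by (meson add_left_mono order_trans)
  next
    case False
    then show ?thesis using assms exec.CondFalse[OF b False] unfolding wp_def
      by (meson add_left_mono order_trans)
  qed
qed

end

text \<open>Memory holds \<open>K\<close> interleaved arrays: entry \<open>i\<close> of array \<open>x\<close> is cell \<open>K * i + x\<close>. Scalar variables
  are entry \<open>0\<close> of an array.\<close>

definition cell :: "nat \<Rightarrow> nat \<Rightarrow> wexp \<Rightarrow> wexp" where
  "cell K x e = Plus (Times (Const K) e) (Const x)"

abbreviation entry :: "nat \<Rightarrow> nat \<Rightarrow> wexp \<Rightarrow> wexp" where
  "entry K x e \<equiv> WLoad (cell K x e)"

abbreviation var :: "nat \<Rightarrow> nat \<Rightarrow> wexp" where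
  "var K x \<equiv> entry K x (Const 0)"

text \<open>The bound \<open>e\<close> is evaluated anew before each round, and the counter lives in
  memory where the body could overwrite it; both facts reappear as premises of the loop
  rule.\<close>

definition For :: "nat \<Rightarrow> nat \<Rightarrow> wexp \<Rightarrow> com \<Rightarrow> com" where
  "For K x e c = Seq (WStore (cell K x (Const 0)) (Const 0))
     (While (WLess (var K x) e)
       (Seq c (WStore (cell K x (Const 0)) (Plus (var K x) (Const 1)))))"

lemma wcost_cell [simp]: "wcost (cell K x e) = wcost e + 4"
  by (simp add: cell_def)

locale array_machine = machine +
  fixes K D :: nat
  assumes K_less_B: "K < B" and D_pos: "0 < D" and s_eq: "s = K * D"
begin

definition ad :: "nat \<Rightarrow> nat \<Rightarrow> nat" where
  "ad x i = K * i + x"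

text \<open>Decides aliasing: as a rewrite rule it lets the simplifier tell apart cells of different
  arrays and different entries of one array.\<close>

lemma ad_eq [simp]: "x < K \<Longrightarrow> y < K \<Longrightarrow> ad x i = ad y j \<longleftrightarrow> x = y \<and> i = j"
proof
  assume *: "x < K" "y < K" "ad x i = ad y j"
  then have "(K * i + x) mod K = (K * j + y) mod K" "(K * i + x) div K = (K * j + y) div K"
    by (auto simp: ad_def)
  then show "x = y \<and> i = j" using * by simp
qed simp

lemma ad_less [simp]: "x < K \<Longrightarrow> i < D \<Longrightarrow> ad x i < s"
proof -
  assume "x < K" "i < D"
  then have "K * i + x < K * Suc i" by simp
  moreover have "K * Suc i \<le> K * D" using \<open>i < D\<close> by (intro mult_le_mono) auto
  ultimately show ?thesis unfolding ad_def s_eq by linarith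
qed

lemma weval_cell [simp]: "weval n \<sigma> (cell K x e) = ad x (weval n \<sigma> e)"
  by (simp add: cell_def ad_def)

lemma wsafe_cell [simp]: "x < K \<Longrightarrow> wsafe \<sigma> (cell K x e) \<longleftrightarrow> wsafe \<sigma> e"
  using K_less_B by (simp add: cell_def)

lemma zero_one_less [simp]: "0 < D" "0 < B" "Suc 0 < B"
  using D_pos B_ge_2 by auto

text \<open>Induction on the number of remaining rounds. By \<open>stable\<close> the invariant does
  not look at the counter, so it survives resetting and incrementing it; \<open>bound\<close> keeps
  the value of \<open>e\<close> fixed although \<open>e\<close> is evaluated again and
  again.\<close>

lemma wp_For:
  assumes "bounded \<sigma>" "x < K" "k < B"
    and I0: "I 0 \<sigma>"
    and stable: "\<And>i \<sigma> v. I i \<sigma> \<Longrightarrow> I i (\<sigma>\<lparr>words := (words \<sigma>)(ad x 0 := v)\<rparr>)"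
    and bound: "\<And>i \<sigma>. i \<le> k \<Longrightarrow> I i \<sigma> \<Longrightarrow> wsafe \<sigma> e \<and> weval n \<sigma> e = k"
    and body: "\<And>i \<sigma>. i < k \<Longrightarrow> bounded \<sigma> \<Longrightarrow> I i \<sigma> \<Longrightarrow> words \<sigma> (ad x 0) = i \<Longrightarrow>
      wp c tb (\<lambda>\<sigma>'. words \<sigma>' (ad x 0) = i \<and> I (Suc i) \<sigma>') \<sigma>"
    and post: "\<And>\<sigma>. bounded \<sigma> \<Longrightarrow> I k \<sigma> \<Longrightarrow> Q \<sigma>"
    and cost: "wcost e + 20 \<le> Z" and time: "(k + 1) * (tb + wcost e + 30) \<le> t"
  shows "wp (For K x e c) t Q \<sigma>"
proof -
  define inc where "inc = WStore (cell K x (Const 0)) (Plus (var K x) (Const 1))"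
  define lp where "lp = While (WLess (var K x) e) (Seq c inc)"
  \<comment> \<open>Besides the body, a round costs \<open>wcost e + 8\<close> for the test and 14
    for the increment; the final test fits into \<open>wcost e + 10\<close>.\<close>
  have loop: "wp lp ((k - i) * (tb + wcost e + 30) + wcost e + 10) Q \<sigma>"
    if "i \<le> k" "bounded \<sigma>" "I i \<sigma>" "words \<sigma> (ad x 0) = i" for i \<sigma>
    using that
  proof (induction "k - i" arbitrary: i \<sigma>)
    case 0
    then have i: "i = k" by simp
    have "blegal n d w s \<sigma> (WLess (var K x) e)"
      using 0 bound[of i \<sigma>] assms(2) cost by (intro blegal_if_bsafe) auto
    moreover have "\<not> beval n d \<sigma> (WLess (var K x) e)"
      using 0 bound[of i \<sigma>] i by auto
    ultimately have "exec n d w s lp \<sigma> (1 + bcost (WLess (var K x) e)) \<sigma>"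
      unfolding lp_def by (rule exec.WhileFalse)
    then show ?case unfolding wp_def using 0 i post[of \<sigma>]
      by (intro exI[of _ "1 + bcost (WLess (var K x) e)"] exI[of _ \<sigma>]) auto
  next
    case (Suc l)
    then have i: "i < k" by simp
    have b: "blegal n d w s \<sigma> (WLess (var K x) e)"
      using Suc bound[of i \<sigma>] assms(2) cost by (intro blegal_if_bsafe) auto
    have bt: "beval n d \<sigma> (WLess (var K x) e)"
      using Suc bound[of i \<sigma>] i by auto
    obtain t1 \<sigma>1 where 1: "exec n d w s c \<sigma> t1 \<sigma>1" "t1 \<le> tb" "bounded \<sigma>1"
      "words \<sigma>1 (ad x 0) = i" "I (Suc i) \<sigma>1"
      using body[OF i Suc(4,5,6)] unfolding wp_def by blast
    define \<sigma>2 where "\<sigma>2 = \<sigma>1\<lparr>words := (words \<sigma>1)(ad x 0 := Suc i)\<rparr>"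
    have "bounded (com_eval inc \<sigma>1) \<and> (\<exists>t\<le>com_time inc. exec n d w s inc \<sigma>1 t (com_eval inc \<sigma>1))"
      using 1 assms(2,3) cost i unfolding inc_def by (intro exec_com_eval) auto
    moreover have "com_eval inc \<sigma>1 = \<sigma>2" using 1 by (simp add: inc_def \<sigma>2_def)
    ultimately obtain t2 where 2: "exec n d w s inc \<sigma>1 t2 \<sigma>2" "t2 \<le> com_time inc" "bounded \<sigma>2" by auto
    have t2: "t2 \<le> 14" using 2(2) by (simp add: inc_def)
    have "wp lp ((k - Suc i) * (tb + wcost e + 30) + wcost e + 10) Q \<sigma>2"
      using Suc.hyps(2) i 2 1 stable[OF 1(5)] by (intro Suc.hyps(1)) (auto simp: \<sigma>2_def)
    then obtain t3 \<sigma>3 where 3: "exec n d w s lp \<sigma>2 t3 \<sigma>3"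
      "t3 \<le> (k - Suc i) * (tb + wcost e + 30) + wcost e + 10" "bounded \<sigma>3" "Q \<sigma>3"
      unfolding wp_def by blast
    have "exec n d w s lp \<sigma> (1 + bcost (WLess (var K x) e) + (t1 + t2) + t3) \<sigma>3"
      using exec.WhileTrue[OF b bt exec.Seq[OF 1(1) 2(1)]] 3(1) unfolding lp_def by blast
    moreover have "k - i = Suc (k - Suc i)" using i by simp
    then have "1 + bcost (WLess (var K x) e) + (t1 + t2) + t3
      \<le> (k - i) * (tb + wcost e + 30) + wcost e + 10"
      using 1(2) t2 3(2) by simp
    ultimately show ?case using 3(3,4) unfolding wp_def by blast
  qed
  show ?thesis unfolding For_def lp_def[symmetric, unfolded inc_def]
  proof (rule wp_Seq)
    show "wp (WStore (cell K x (Const 0)) (Const 0)) 10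
      (wp lp (k * (tb + wcost e + 30) + wcost e + 10) Q) \<sigma>"
    proof (rule wp_straight)
      let ?\<sigma> = "com_eval (WStore (cell K x (Const 0)) (Const 0)) \<sigma>"
      have "bounded ?\<sigma>" using assms(1) by (auto simp: bounded_def)
      then show "wp lp (k * (tb + wcost e + 30) + wcost e + 10) Q ?\<sigma>"
        using loop[of 0 ?\<sigma>] stable[OF I0] by simp
    qed (use assms(1,2) cost in auto)
    show "10 + (k * (tb + wcost e + 30) + wcost e + 10) \<le> t" using time by simp
  qed
qed

end

section \<open>The dynamic program\<close>

text \<open>The outcome of \<open>coverable_automata\<close> as assumptions. \<open>lab i j\<close>
  is the set of letters read when automaton \<open>i\<close> is in state \<open>j\<close>; it occurs
  in proofs only, whereas \<open>f\<close> becomes part of the program.\<close>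

locale cover_automata =
  fixes M N C :: nat and f :: "nat \<Rightarrow> nat \<Rightarrow> nat \<Rightarrow> nat" and lab :: "nat \<Rightarrow> nat \<Rightarrow> nat set"
  assumes M_pos: "0 < M" and N_pos: "0 < N" and C_ge_2: "2 \<le> C"
    and lab_0: "lab i 0 = {}"
    and f_less: "j < C \<Longrightarrow> f i j e < C"
    and f_step: "j < C \<Longrightarrow> f i j e \<noteq> 0 \<Longrightarrow>
      j < f i j e \<and> e \<notin> lab i j \<and> lab i (f i j e) = insert e (lab i j)"
    and f_cover: "distinct xs \<Longrightarrow> set xs \<subseteq> {..<M} \<Longrightarrow> \<exists>i<N. accepts (f i) 0 xs"
begin

text \<open>The quotient \<open>m / M\<close> rounded up; the last group may be incomplete.\<close>

definition groups :: "nat \<Rightarrow> nat" where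
  "groups m = (m + M - 1) div M"

lemma groups_le: "groups m \<le> m"
proof (cases m)
  case (Suc k)
  have "k div M \<le> k" by simp
  moreover have "m + M - 1 = k + M" using Suc M_pos by simp
  ultimately show ?thesis using Suc M_pos by (simp add: groups_def)
qed (use M_pos in \<open>simp add: groups_def\<close>)

lemma groups_le_div: "groups m \<le> m div M + 1"
proof -
  have "m + M - 1 \<le> m + M" by simp
  then have "groups m \<le> (m + M) div M" unfolding groups_def by (rule div_le_mono)
  then show ?thesis using M_pos by simp
qed

lemma div_less_groups: "p < m \<Longrightarrow> p div M < groups m"
proof -
  assume "p < m"
  then have "(p + M) div M \<le> (m + M - 1) div M" using M_pos by (intro div_le_mono) simp
  then show ?thesis using M_pos by (simp add: groups_def)
qed

end

text \<open>Position \<open>p\<close> of the list \<open>L\<close> is letter \<open>p mod M\<close> of group \<open>p div M\<close>. The number \<open>i\<close> selects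
  an automaton for every group by its digits in base \<open>N\<close>. A node of the dynamic program is
  \<open>j * (n + 1) + u\<close>, where the digits of \<open>j\<close> in base \<open>C\<close> are the states of the automata and \<open>u\<close> is the
  city reached.\<close>

locale path_instance = cover_automata +
  fixes n :: nat and d :: "nat \<Rightarrow> nat \<Rightarrow> real" and L :: "nat list" and a b :: nat
  assumes dist_L: "distinct L" and set_L: "set L \<subseteq> {1..n}" and a_in: "a \<in> {1..n}" and b_in: "b \<in> {1..n}"
begin

abbreviation "m \<equiv> length L"
abbreviation "G \<equiv> groups m"
abbreviation "nodes \<equiv> C ^ G * Suc n"

definition trans :: "nat \<Rightarrow> nat \<Rightarrow> nat \<Rightarrow> nat" where
  "trans i x p = f (digit N i (p div M)) (digit C (x div Suc n) (p div M)) (p mod M)"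

text \<open>Unless the transition is rejected, \<open>f_step\<close> makes the subtraction exact;
  the sum then replaces one digit, and \<open>L ! p\<close> becomes the city reached.\<close>

definition succ :: "nat \<Rightarrow> nat \<Rightarrow> nat \<Rightarrow> nat" where
  "succ i x p = (x div Suc n + (trans i x p - digit C (x div Suc n) (p div M)) * C ^ (p div M)) * Suc n
     + L ! p"

text \<open>Paths in the graph of nodes, annotated with the positions in order of visit, because the
  order decides the length. The start node is the number \<open>a\<close> itself: all automata are
  in state 0.\<close>

inductive reach :: "nat \<Rightarrow> nat \<Rightarrow> nat list \<Rightarrow> bool" for i where
  start: "reach i a []"
| step: "reach i x ps \<Longrightarrow> p < m \<Longrightarrow> trans i x p \<noteq> 0 \<Longrightarrow> reach i (succ i x p) (ps @ [p])"

lemma nth_L: "p < m \<Longrightarrow> L ! p \<in> {1..n}"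
  using set_L nth_mem by blast

lemma C_pos: "0 < C"
  using C_ge_2 by simp

lemma succ_div: "p < m \<Longrightarrow> succ i x p div Suc n =
    x div Suc n + (trans i x p - digit C (x div Suc n) (p div M)) * C ^ (p div M)"
  and succ_mod: "p < m \<Longrightarrow> succ i x p mod Suc n = L ! p"
proof -
  assume "p < m"
  then have "L ! p < Suc n" using nth_L by fastforce
  then show "succ i x p mod Suc n = L ! p" "succ i x p div Suc n =
    x div Suc n + (trans i x p - digit C (x div Suc n) (p div M)) * C ^ (p div M)"
    by (simp_all only: succ_def mod_mult_self3 mod_less div_mult_self3) (simp_all)
qed

lemma trans_step:
  assumes "trans i x p \<noteq> 0"
  shows "digit C (x div Suc n) (p div M) < trans i x p" "trans i x p < C"
    "p mod M \<notin> lab (digit N i (p div M)) (digit C (x div Suc n) (p div M))"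
    "lab (digit N i (p div M)) (trans i x p) =
       insert (p mod M) (lab (digit N i (p div M)) (digit C (x div Suc n) (p div M)))"
  using assms f_step[OF digit_less[OF C_pos]] f_less[OF digit_less[OF C_pos]] unfolding trans_def by blast+

lemma node_less_iff: "x < nodes \<longleftrightarrow> x div Suc n < C ^ G"
  by (simp add: div_less_iff_less_mult del: mult_Suc_right)

lemma succ_digit:
  assumes "x < nodes" "p < m" "trans i x p \<noteq> 0"
  shows "succ i x p < nodes"
    "h < G \<Longrightarrow> digit C (succ i x p div Suc n) h =
      (if h = p div M then trans i x p else digit C (x div Suc n) h)"
  using digit_update[of "x div Suc n" C G "p div M" "trans i x p"] trans_step[OF assms(3)]
    div_less_groups[OF assms(2)] assms(1,2)
  by (auto simp: succ_div node_less_iff simp del: mult_Suc_right)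

text \<open>An accepted transition raises a digit. Hence the numerical order of nodes is a
  topological order, and one increasing sweep computes shortest paths even with negative
  distances.\<close>

lemma less_succ:
  assumes "p < m" "trans i x p \<noteq> 0"
  shows "x < succ i x p"
proof -
  have "x div Suc n < succ i x p div Suc n"
    using trans_step[OF assms(2)] C_pos by (simp add: succ_div[OF assms(1)])
  then show ?thesis by (meson div_le_mono leI not_le)
qed

text \<open>The labels of the states record the visited positions group by group, so the node
  determines their set; this is why one table entry per node is enough. Positions never repeat,
  because a letter that is in the label already is rejected.\<close>

lemma reach_props:
  assumes "reach i x ps"
  shows "distinct ps \<and> set ps \<subseteq> {..<m} \<and> x < nodes \<and> x mod Suc n = last (a # map ((!) L) ps) \<and>
    (\<forall>p<m. p \<in> set ps \<longleftrightarrow>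
       p mod M \<in> lab (digit N i (p div M)) (digit C (x div Suc n) (p div M)))"
  using assms
proof induction
  case start
  have "a < Suc n" using a_in by simp
  then show ?case using C_pos by (simp add: node_less_iff digit_def lab_0 del: mult_Suc_right)
next
  case (step x ps p)
  note tr = trans_step[OF step(3)]
  have pn: "p \<notin> set ps" using step.IH step(2) tr(3) by blast
  have "q \<in> set (ps @ [p]) \<longleftrightarrow>
      q mod M \<in> lab (digit N i (q div M)) (digit C (succ i x p div Suc n) (q div M))"
    if q: "q < m" for q
  proof (cases "q div M = p div M")
    case True
    have "q mod M = p mod M \<longleftrightarrow> q = p" using True by (metis div_mod_decomp)
    then show ?thesis
      using step.IH q True tr(4) succ_digit(2)[OF _ step(2,3), of "q div M"] div_less_groups[OF q] by auto
  next
    case False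
    then have "q \<noteq> p" by auto
    then show ?thesis
      using False step.IH q succ_digit(2)[OF _ step(2,3), of "q div M"] div_less_groups[OF q] by auto
  qed
  then show ?case
    using step.IH step(2) pn succ_digit(1)[OF _ step(2,3)] succ_mod[OF step(2)] by auto
qed

text \<open>Within each group the letters of \<open>ps\<close> form a word without repetition, which
  some automaton accepts; \<open>i\<close> collects these choices as digits. Interleaving is
  harmless, because a step moves only the automaton of its own group.\<close>

lemma reach_exists:
  assumes "distinct ps" "set ps \<subseteq> {..<m}"
  shows "\<exists>i<N ^ G. \<exists>x. reach i x ps"
proof -
  define letters where "letters g qs = map (\<lambda>p. p mod M) (filter (\<lambda>p. p div M = g) qs)" for g qs
  have "\<exists>i<N. accepts (f i) 0 (letters g ps)" for g
  proof (rule f_cover)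
    have "inj_on (\<lambda>p. p mod M) {p. p div M = g}"
      by (rule inj_onI) (metis div_mod_decomp mem_Collect_eq)
    then have "inj_on (\<lambda>p. p mod M) (set (filter (\<lambda>p. p div M = g) ps))"
      by (rule inj_on_subset) auto
    then show "distinct (letters g ps)" using assms by (simp add: letters_def distinct_map)
    show "set (letters g ps) \<subseteq> {..<M}" using M_pos by (auto simp: letters_def)
  qed
  then obtain ig where ig: "\<And>g. ig g < N \<and> accepts (f (ig g)) 0 (letters g ps)" by metis
  then obtain i where i: "i < N ^ G" "\<And>g. g < G \<Longrightarrow> digit N i g = ig g"
    using digits_exist[OF N_pos, of G ig] by auto
  \<comment> \<open>Generalised to any node reached so far: from its state there, the automaton of
    every group accepts the letters still to come in that group.\<close>
  have ext: "\<exists>y. reach i y (us @ vs)" if "reach i x us" "set vs \<subseteq> {..<m}"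
    "\<forall>g<G. accepts (f (digit N i g)) (digit C (x div Suc n) g) (letters g vs)" for us vs x
    using that
  proof (induction vs arbitrary: us x)
    case (Cons p vs)
    have p: "p < m" "p div M < G" using Cons.prems div_less_groups by auto
    have "accepts (f (digit N i (p div M))) (digit C (x div Suc n) (p div M)) (letters (p div M) (p # vs))"
      using Cons.prems p by blast
    then have tr: "trans i x p \<noteq> 0"
      and acc: "accepts (f (digit N i (p div M))) (trans i x p) (letters (p div M) vs)"
      by (auto simp: letters_def trans_def)
    have r: "reach i (succ i x p) (us @ [p])" using Cons.prems p tr by (intro reach.step) auto
    have x: "x < nodes" using reach_props[OF Cons.prems(1)] by blast
    have "\<exists>y. reach i y ((us @ [p]) @ vs)"
    proof (rule Cons.IH[OF r])
      show "\<forall>g<G. accepts (f (digit N i g)) (digit C (succ i x p div Suc n) g) (letters g vs)"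
      proof (intro allI impI)
        fix g assume g: "g < G"
        show "accepts (f (digit N i g)) (digit C (succ i x p div Suc n) g) (letters g vs)"
          using succ_digit(2)[OF x p(1) tr g] acc Cons.prems(3) g by (auto simp: letters_def)
      qed
    qed (use Cons.prems in auto)
    then show ?case by simp
  qed auto
  have "a div Suc n = 0" using a_in by simp
  then have "\<exists>y. reach i y ([] @ ps)"
    using ig i by (intro ext[OF reach.start assms(2)]) (simp add: digit_def)
  then show ?thesis using i(1) by auto
qed

text \<open>Soundness only: a marked entry is the length of some path. Minimality is expressed
  separately by \<open>relaxed\<close>. The number of summands is one less than the mark.\<close>

definition sound_tables :: "nat \<Rightarrow> (nat \<Rightarrow> nat) \<Rightarrow> (nat \<Rightarrow> nat \<times> real) \<Rightarrow> bool" where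
  "sound_tables i fl v \<longleftrightarrow> (\<forall>x<nodes. fl x \<noteq> 0 \<longrightarrow>
     (\<exists>ps. reach i x ps \<and> fl x = Suc (length ps) \<and>
        v x = (length ps, walk_length d a (map ((!) L) ps))))"

definition relaxed :: "nat \<Rightarrow> (nat \<Rightarrow> nat) \<Rightarrow> (nat \<Rightarrow> nat \<times> real) \<Rightarrow> nat \<Rightarrow> nat \<Rightarrow> bool" where
  "relaxed i fl v x p \<longleftrightarrow> (fl x \<noteq> 0 \<and> trans i x p \<noteq> 0 \<longrightarrow>
     fl (succ i x p) \<noteq> 0 \<and> snd (v (succ i x p)) \<le> snd (v x) + d (x mod Suc n) (L ! p))"

text \<open>The potential argument for shortest paths: once every edge is relaxed, induction along a
  path shows that it is not shorter than the entry of its end node.\<close>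

lemma relaxed_complete:
  assumes "fl a \<noteq> 0" "snd (v a) \<le> 0" "\<And>x p. x < nodes \<Longrightarrow> p < m \<Longrightarrow> relaxed i fl v x p"
    and "reach i x ps"
  shows "fl x \<noteq> 0 \<and> snd (v x) \<le> walk_length d a (map ((!) L) ps)"
  using assms(4)
proof induction
  case (step x ps p)
  have x: "x < nodes" "x mod Suc n = last (a # map ((!) L) ps)" using reach_props[OF step(1)] by auto
  then have "fl (succ i x p) \<noteq> 0 \<and> snd (v (succ i x p)) \<le> snd (v x) + d (x mod Suc n) (L ! p)"
    using assms(3)[OF x(1) step(2)] step by (auto simp: relaxed_def)
  moreover have "walk_length d a (map ((!) L) (ps @ [p]))
      = walk_length d a (map ((!) L) ps) + d (x mod Suc n) (L ! p)"
    using x(2) by (simp add: walk_length_append)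
  ultimately show ?case using step.IH by linarith
qed (use assms in auto)

text \<open>As long as \<open>rf = 0\<close> no path has been found and the value \<open>r\<close> is meaningless.\<close>

definition result_ok :: "nat \<Rightarrow> nat \<times> real \<Rightarrow> bool" where
  "result_ok rf r \<longleftrightarrow> (rf \<noteq> 0 \<longrightarrow> (\<exists>xs. distinct xs \<and> set xs = set L \<and>
     r = (Suc m, walk_length d a (xs @ [b]))))"

definition result_le :: "nat \<Rightarrow> nat \<times> real \<Rightarrow> real \<Rightarrow> bool" where
  "result_le rf r v \<longleftrightarrow> rf \<noteq> 0 \<and> snd r \<le> v"

lemma reach_full:
  assumes "reach i x ps" "length ps = m"
  shows "distinct (map ((!) L) ps)" "set (map ((!) L) ps) = set L"
    "walk_length d a (map ((!) L) ps @ [b]) = walk_length d a (map ((!) L) ps) + d (x mod Suc n) b"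
    "set ps = {..<m}"
proof -
  note r = reach_props[OF assms(1)]
  show s: "set ps = {..<m}"
    using r assms(2) by (intro card_subset_eq) (auto simp: distinct_card)
  show "distinct (map ((!) L) ps)"
    using r s dist_L by (auto simp: distinct_map inj_on_def nth_eq_iff_index_eq)
  show "set (map ((!) L) ps) = set L" unfolding set_map s by (auto simp: in_set_conv_nth)
  show "walk_length d a (map ((!) L) ps @ [b]) = walk_length d a (map ((!) L) ps) + d (x mod Suc n) b"
    using r by (simp add: walk_length_append)
qed

text \<open>Every ordering of the cities in \<open>L\<close> is a list of positions and is reached
  under some \<open>i < N ^ G\<close>. So the best value over all choices of automata is the optimum
  over all orderings, although a single choice may see only some of them.\<close>

lemma optimal_pathI:
  assumes "result_ok rf r"
    and le: "\<And>i x ps. i < N ^ G \<Longrightarrow> reach i x ps \<Longrightarrow> length ps = m \<Longrightarrow>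
      result_le rf r (walk_length d a (map ((!) L) ps @ [b]))"
  shows "optimal_path d (set L) a b (snd r)" "fst r = Suc m"
proof -
  have A: "result_le rf r (walk_length d a (xs @ [b]))" if xs: "distinct xs" "set xs = set L" for xs
  proof -
    have "\<forall>x\<in>set xs. \<exists>p<m. L ! p = x" using xs by (metis in_set_conv_nth)
    then obtain h where h: "\<And>x. x \<in> set xs \<Longrightarrow> h x < m \<and> L ! h x = x" by metis
    define ps where "ps = map h xs"
    have m: "map ((!) L) ps = xs" using h by (simp add: ps_def map_idI)
    then have "distinct ps" using xs(1) by (metis distinct_map)
    moreover have "set ps \<subseteq> {..<m}" using h by (auto simp: ps_def)
    ultimately obtain i x where "i < N ^ G" "reach i x ps" using reach_exists by blast
    moreover have "length ps = m" using xs dist_L by (metis distinct_card length_map ps_def)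
    ultimately show ?thesis using le m by metis
  qed
  then have "rf \<noteq> 0" using dist_L by (auto simp: result_le_def)
  then show "optimal_path d (set L) a b (snd r)" "fst r = Suc m"
    using assms(1) A unfolding result_ok_def optimal_path_def result_le_def by auto
qed

end

section \<open>The base program\<close>

abbreviation bor :: "bexp \<Rightarrow> bexp \<Rightarrow> bexp" where
  "bor b c \<equiv> BNot (BAnd (BNot b) (BNot c))"

abbreviation set_var :: "nat \<Rightarrow> nat \<Rightarrow> wexp \<Rightarrow> com" where
  "set_var K x e \<equiv> WStore (cell K x (Const 0)) e"

text \<open>Word arrays: 0 the automata, 1, 2, 3 the powers of \<open>C\<close>, \<open>N\<close> and 2, 4 the table of the dynamic
  program (one more than the number of cities visited, or 0), 5 to 7 auxiliary variables.
  Recursion level \<open>r\<close> has arrays \<open>16 + 8 * r\<close> to \<open>23 + 8 * r\<close>: list of cities, its length, start and end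
  of the path, a flag telling whether a path has been found, and three loop counters.
  Value array 4 belongs to the dynamic program, \<open>16 + 8 * r\<close> holds the result of level \<open>r\<close>, and
  \<open>17 + 8 * r\<close> the length of the first half of a path.\<close>

definition group_exp :: "nat \<Rightarrow> nat \<Rightarrow> wexp" where
  "group_exp K M = Div (var K 23) (Const M)"

definition state_exp :: "nat \<Rightarrow> nat \<Rightarrow> nat \<Rightarrow> wexp" where
  "state_exp K M C = Mod (Div (Div (var K 22) (Plus Cities (Const 1))) (entry K 1 (group_exp K M))) (Const C)"

definition trans_exp :: "nat \<Rightarrow> nat \<Rightarrow> nat \<Rightarrow> nat \<Rightarrow> wexp" where
  "trans_exp K M N C = entry K 0 (Plus (Times (Plus (Times
       (Mod (Div (var K 21) (entry K 2 (group_exp K M))) (Const N)) (Const C)) (state_exp K M C))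
     (Const M)) (Mod (var K 23) (Const M)))"

definition succ_exp :: "nat \<Rightarrow> nat \<Rightarrow> nat \<Rightarrow> wexp" where
  "succ_exp K M C = Plus (Times (Plus (Div (var K 22) (Plus Cities (Const 1)))
       (Times (Minus (var K 5) (state_exp K M C)) (entry K 1 (group_exp K M)))) (Plus Cities (Const 1)))
     (entry K 16 (var K 23))"

definition extend_exp :: "nat \<Rightarrow> wexp \<Rightarrow> vexp" where
  "extend_exp K e = VPlus (VLoad (cell K 4 (var K 22))) (Dist (Mod (var K 22) (Plus Cities (Const 1))) e)"

definition relax_com :: "nat \<Rightarrow> nat \<Rightarrow> nat \<Rightarrow> nat \<Rightarrow> com" where
  "relax_com K M N C = Seq (set_var K 5 (trans_exp K M N C))
     (Cond (WLess (Const 0) (var K 5))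
       (Seq (set_var K 7 (succ_exp K M C))
         (Cond (bor (WLess (entry K 4 (var K 7)) (Const 1))
             (VLess (extend_exp K (entry K 16 (var K 23))) (VLoad (cell K 4 (var K 7)))))
           (Seq (VStore (cell K 4 (var K 7)) (extend_exp K (entry K 16 (var K 23))))
             (WStore (cell K 4 (var K 7)) (Plus (entry K 4 (var K 22)) (Const 1))))
           Skip))
       Skip)"

text \<open>Marks are one more than the number of cities visited, so a mark above the length of the
  list means a complete path; then the edge to the end is added and the minimum updated.\<close>

definition finish_com :: "nat \<Rightarrow> com" where
  "finish_com K = Cond (WLess (var K 17) (entry K 4 (var K 22)))
     (Cond (bor (WLess (var K 20) (Const 1))
         (VLess (extend_exp K (var K 19)) (VLoad (cell K 16 (Const 0)))))
       (Seq (VStore (cell K 16 (Const 0)) (extend_exp K (var K 19))) (set_var K 20 (Const 1)))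
       Skip)
     Skip"

definition node_com :: "nat \<Rightarrow> nat \<Rightarrow> nat \<Rightarrow> nat \<Rightarrow> com" where
  "node_com K M N C = Cond (WLess (Const 0) (entry K 4 (var K 22)))
     (Seq (finish_com K) (For K 23 (var K 17) (relax_com K M N C))) Skip"

definition dp_com :: "nat \<Rightarrow> nat \<Rightarrow> nat \<Rightarrow> nat \<Rightarrow> com" where
  "dp_com K M N C = Seq (For K 22 (var K 6) (WStore (cell K 4 (var K 22)) (Const 0)))
     (Seq (Seq (WStore (cell K 4 (var K 18)) (Const 1)) (VStore (cell K 4 (var K 18)) VZero))
       (For K 22 (var K 6) (node_com K M N C)))"

definition groups_exp :: "nat \<Rightarrow> nat \<Rightarrow> wexp" where
  "groups_exp K M = Div (Plus (var K 17) (Const (M - 1))) (Const M)"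

definition base_com :: "nat \<Rightarrow> nat \<Rightarrow> nat \<Rightarrow> nat \<Rightarrow> com" where
  "base_com K M N C = Seq
     (Seq (set_var K 6 (Times (entry K 1 (groups_exp K M)) (Plus Cities (Const 1)))) (set_var K 20 (Const 0)))
     (For K 21 (entry K 2 (groups_exp K M)) (dp_com K M N C))"

text \<open>\<open>n div 2 ^ R\<close> is the size left after \<open>R\<close> halvings, and the
  exponent with \<open>+ 1\<close> bounds its number of groups. Bounds by \<open>D\<close> concern
  table indices, bounds by \<open>B\<close> stored numbers; powers up to exponent \<open>n\<close>
  appear because whole tables of them are kept.\<close>

locale tsp_machine = array_machine n d w s B Z K D + cover_automata M N C f lab
  for n d w s B Z K D M N C f lab +
  fixes R :: nat
  assumes n_pos: "1 \<le> n" and K_eq: "K = 24 + 8 * R" and Z_ge: "1000 \<le> Z"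
    and n_less_D: "n + 1 < D" and nodes_le_D: "C ^ (n div 2 ^ R div M + 1) * Suc n \<le> D"
    and automata_le_D: "N * C * M \<le> D"
    and powers_less_B: "C ^ n < B" "N ^ n < B" "2 ^ n < B"
    and consts_less_B: "C < B" "N < B" "M < B" "n + 2 < B"
    and nodes_less_B: "C ^ (n div 2 ^ R div M + 1) * Suc n < B"
begin

definition tables :: "state \<Rightarrow> bool" where
  "tables \<sigma> \<longleftrightarrow>
     (\<forall>i<N. \<forall>j<C. \<forall>e<M. words \<sigma> (ad 0 ((i * C + j) * M + e)) = f i j e) \<and>
     (\<forall>g\<le>n. words \<sigma> (ad 1 g) = C ^ g \<and> words \<sigma> (ad 2 g) = N ^ g \<and> words \<sigma> (ad 3 g) = 2 ^ g)"

definition input :: "nat \<Rightarrow> nat list \<Rightarrow> nat \<Rightarrow> nat \<Rightarrow> state \<Rightarrow> bool" where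
  "input r L a b \<sigma> \<longleftrightarrow> (\<forall>p<length L. words \<sigma> (ad (16 + 8 * r) p) = L ! p) \<and>
     words \<sigma> (ad (17 + 8 * r) 0) = length L \<and>
     words \<sigma> (ad (18 + 8 * r) 0) = a \<and> words \<sigma> (ad (19 + 8 * r) 0) = b"

text \<open>The frame condition: \<open>W\<close> and \<open>V\<close> are the arrays of words and
  of values that a piece of code may change. Together with \<open>ad_eq\<close> it transfers all
  facts about other arrays.\<close>

definition same_except :: "nat set \<Rightarrow> nat set \<Rightarrow> state \<Rightarrow> state \<Rightarrow> bool" where
  "same_except W V \<sigma> \<sigma>' \<longleftrightarrow> (\<forall>x<K. \<forall>i.
     (x \<notin> W \<longrightarrow> words \<sigma>' (ad x i) = words \<sigma> (ad x i)) \<and> (x \<notin> V \<longrightarrow> vals \<sigma>' (ad x i) = vals \<sigma> (ad x i)))"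

lemma tag_less [simp]: "x < 24 + 8 * R \<Longrightarrow> x < K"
  by (simp add: K_eq)

lemma same_except_refl: "same_except W V \<sigma> \<sigma>"
  by (simp add: same_except_def)

lemma same_except_trans:
  "same_except W V \<sigma> \<sigma>' \<Longrightarrow> same_except W' V' \<sigma>' \<sigma>'' \<Longrightarrow> W \<union> W' \<subseteq> W'' \<Longrightarrow> V \<union> V' \<subseteq> V'' \<Longrightarrow>
   same_except W'' V'' \<sigma> \<sigma>''"
  unfolding same_except_def by (metis UnCI subsetD)

lemma same_except_words:
  "same_except W V \<sigma> \<sigma>' \<Longrightarrow> x < K \<Longrightarrow> x \<notin> W \<Longrightarrow> words \<sigma>' (ad x i) = words \<sigma> (ad x i)"
  by (simp add: same_except_def)

lemma same_except_upd:
  "same_except W V \<sigma> \<sigma>' \<Longrightarrow> x \<in> W \<Longrightarrow> x < K \<Longrightarrow>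
    same_except W V \<sigma> (\<sigma>'\<lparr>words := (words \<sigma>')(ad x i := v)\<rparr>)"
  "same_except W V \<sigma> \<sigma>' \<Longrightarrow> x \<in> V \<Longrightarrow> x < K \<Longrightarrow>
    same_except W V \<sigma> (\<sigma>'\<lparr>vals := (vals \<sigma>')(ad x i := u)\<rparr>)"
  by (auto simp: same_except_def)

lemma tables_same: "same_except W V \<sigma> \<sigma>' \<Longrightarrow> W \<inter> {0, 1, 2, 3} = {} \<Longrightarrow> tables \<sigma> \<Longrightarrow> tables \<sigma>'"
  unfolding tables_def by (auto simp: same_except_words)

lemma input_same:
  "same_except W V \<sigma> \<sigma>' \<Longrightarrow> r \<le> R \<Longrightarrow> W \<inter> {16 + 8 * r, 17 + 8 * r, 18 + 8 * r, 19 + 8 * r} = {} \<Longrightarrow>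
    input r L a b \<sigma> \<Longrightarrow> input r L a b \<sigma>'"
  unfolding input_def by (auto simp: same_except_words)

lemma const_less [simp]: "C < B" "N < B" "M < B" "M - 1 < B" "M - Suc 0 < B"
  using consts_less_B by auto

end

section \<open>Correctness of the dynamic program\<close>

locale base_machine = tsp_machine n d w s B Z K D M N C f lab R + path_instance M N C f lab n d L a b
  for n d w s B Z K D M N C f lab R L a b +
  assumes m_le: "length L \<le> n div 2 ^ R"
begin

abbreviation "fl \<sigma> x \<equiv> words \<sigma> (ad 4 x)"
abbreviation "dv \<sigma> x \<equiv> vals \<sigma> (ad 4 x)"

lemma m_le_n: "m \<le> n"
  using m_le div_le_dividend le_trans by blast

lemma G_le: "G \<le> n" "G \<le> n div 2 ^ R div M + 1"
proof -
  show "G \<le> n" using groups_le m_le_n le_trans by blast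
  have "m div M \<le> n div 2 ^ R div M" using m_le by (rule div_le_mono)
  then show "G \<le> n div 2 ^ R div M + 1" using groups_le_div[of m] by simp
qed

lemma nodes_le: "nodes \<le> C ^ (n div 2 ^ R div M + 1) * Suc n"
  using G_le C_pos by (intro mult_le_mono power_increasing) auto

lemma node_less_D: "x < nodes \<Longrightarrow> x < D"
  using nodes_le nodes_le_D by linarith

lemma node_less_B: "x \<le> nodes \<Longrightarrow> x < B"
  using nodes_le nodes_less_B by linarith

definition env :: "nat \<Rightarrow> nat \<Rightarrow> state \<Rightarrow> bool" where
  "env i x \<sigma> \<longleftrightarrow> tables \<sigma> \<and> input 0 L a b \<sigma> \<and> words \<sigma> (ad 6 0) = nodes \<and>
     words \<sigma> (ad 21 0) = i \<and> words \<sigma> (ad 22 0) = x"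

lemma env_same:
  "same_except W V \<sigma> \<sigma>' \<Longrightarrow> W \<inter> {0, 1, 2, 3, 6, 16, 17, 18, 19, 21, 22} = {} \<Longrightarrow> env i x \<sigma> \<Longrightarrow> env i x \<sigma>'"
  unfolding env_def by (auto simp: same_except_words intro: tables_same input_same[where r = 0])

lemma index_less_D:
  assumes "i < N" "j < C" "e < M"
  shows "(i * C + j) * M + e < D"
proof -
  have mixed: "x * k + y < l * k" if "x < l" "y < k" for x y k l :: nat
  proof -
    have "x * k + y < Suc x * k" using that by simp
    also have "\<dots> \<le> l * k" using that by (intro mult_le_mono) auto
    finally show ?thesis .
  qed
  have "(i * C + j) * M + e < N * C * M" using assms by (intro mixed)
  then show ?thesis using automata_le_D by simp
qed

lemma var_input:
  assumes "input 0 L a b \<sigma>"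
  shows "words \<sigma> (ad 17 0) = m" "words \<sigma> (ad 18 0) = a" "words \<sigma> (ad 19 0) = b"
    "p < m \<Longrightarrow> words \<sigma> (ad 16 p) = L ! p"
  using assms by (auto simp: input_def)

lemma group_exp:
  assumes "env i x \<sigma>" "words \<sigma> (ad 23 0) = p" "p < m"
  shows "weval n \<sigma> (group_exp K M) = p div M" "wsafe \<sigma> (group_exp K M)" "p div M < D" "p div M \<le> n"
    "words \<sigma> (ad 1 (p div M)) = C ^ (p div M)" "words \<sigma> (ad 2 (p div M)) = N ^ (p div M)" "p < D"
proof -
  have "p div M \<le> p" by simp
  then show *: "p div M \<le> n" "p div M < D" "p < D" using assms m_le_n n_less_D by linarith+
  show "weval n \<sigma> (group_exp K M) = p div M" "wsafe \<sigma> (group_exp K M)"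
    using assms by (auto simp: group_exp_def)
  show "words \<sigma> (ad 1 (p div M)) = C ^ (p div M)" "words \<sigma> (ad 2 (p div M)) = N ^ (p div M)"
    using assms(1) * by (auto simp: env_def tables_def)
qed

lemma state_exp:
  assumes "env i x \<sigma>" "words \<sigma> (ad 23 0) = p" "p < m"
  shows "weval n \<sigma> (state_exp K M C) = digit C (x div Suc n) (p div M)" "wsafe \<sigma> (state_exp K M C)"
  using group_exp[OF assms] assms by (auto simp: state_exp_def digit_def env_def)

lemma trans_exp:
  assumes "env i x \<sigma>" "words \<sigma> (ad 23 0) = p" "p < m"
  shows "weval n \<sigma> (trans_exp K M N C) = trans i x p" "wsafe \<sigma> (trans_exp K M N C)"
proof -
  have lt: "digit N i (p div M) < N" "digit C (x div Suc n) (p div M) < C" "p mod M < M"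
    using digit_less N_pos C_pos M_pos by auto
  have "words \<sigma> (ad 0 ((digit N i (p div M) * C + digit C (x div Suc n) (p div M)) * M + p mod M))
      = trans i x p"
    using assms(1) lt unfolding env_def tables_def trans_def by blast
  moreover have "i div N ^ (p div M) mod N = digit N i (p div M)" by (simp add: digit_def)
  ultimately show "weval n \<sigma> (trans_exp K M N C) = trans i x p" "wsafe \<sigma> (trans_exp K M N C)"
    using group_exp[OF assms] state_exp[OF assms] assms index_less_D[OF lt]
    by (auto simp: trans_exp_def env_def)
qed

lemma succ_exp:
  assumes "env i x \<sigma>" "words \<sigma> (ad 23 0) = p" "p < m" "words \<sigma> (ad 5 0) = trans i x p"
  shows "weval n \<sigma> (succ_exp K M C) = succ i x p" "wsafe \<sigma> (succ_exp K M C)"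
  using group_exp[OF assms(1-3)] state_exp[OF assms(1-3)] assms var_input[of \<sigma>]
  by (auto simp: succ_exp_def succ_def env_def)

lemma extend_exp:
  assumes "env i x \<sigma>" "wsafe \<sigma> e" "weval n \<sigma> e = c" "c \<in> {1..n}"
    and "sound_tables i (fl \<sigma>) (dv \<sigma>)" "fl \<sigma> x \<noteq> 0" "x < nodes"
  shows "veval n d \<sigma> (extend_exp K e) = (fl \<sigma> x, snd (dv \<sigma> x) + d (x mod Suc n) c)"
    "vsafe \<sigma> (extend_exp K e)" "fl \<sigma> x \<le> Suc m" "fl \<sigma> x < B"
proof -
  obtain ps where ps: "reach i x ps" "fl \<sigma> x = Suc (length ps)"
    "dv \<sigma> x = (length ps, walk_length d a (map ((!) L) ps))"
    using assms(5-7) unfolding sound_tables_def by blast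
  note r = reach_props[OF ps(1)]
  have "length ps \<le> m" using r by (metis card_lessThan card_mono distinct_card finite_lessThan)
  then show le: "fl \<sigma> x \<le> Suc m" using ps by simp
  then show "fl \<sigma> x < B" using m_le_n consts_less_B by simp
  have "x mod Suc n \<in> {1..n}"
  proof -
    have "x mod Suc n = last (a # map ((!) L) ps)" using r by blast
    moreover have "last (a # map ((!) L) ps) \<in> set (a # map ((!) L) ps)" by (rule last_in_set) simp
    moreover have "set (a # map ((!) L) ps) \<subseteq> {1..n}" using a_in nth_L r by auto
    ultimately show ?thesis by (metis subsetD)
  qed
  then show "veval n d \<sigma> (extend_exp K e) = (fl \<sigma> x, snd (dv \<sigma> x) + d (x mod Suc n) c)"
    "vsafe \<sigma> (extend_exp K e)"
    using assms ps node_less_D[OF assms(7)] by (auto simp: extend_exp_def env_def)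
qed

text \<open>The effect of a visit to node \<open>x\<close>: as successors have larger numbers,
  entries up to \<open>x\<close> stay fixed, while others can only become marked or, if marked,
  decrease. Edges out of earlier nodes therefore remain relaxed.\<close>

definition evolves :: "nat \<Rightarrow> state \<Rightarrow> state \<Rightarrow> bool" where
  "evolves x \<sigma> \<sigma>' \<longleftrightarrow> (\<forall>y\<le>x. fl \<sigma>' y = fl \<sigma> y \<and> dv \<sigma>' y = dv \<sigma> y) \<and>
     (\<forall>y. fl \<sigma> y \<noteq> 0 \<longrightarrow> fl \<sigma>' y \<noteq> 0 \<and> snd (dv \<sigma>' y) \<le> snd (dv \<sigma> y))"

lemma evolves_refl: "evolves x \<sigma> \<sigma>"
  by (simp add: evolves_def)

lemma evolves_trans:
  assumes "evolves x \<sigma> \<sigma>'" "evolves x \<sigma>' \<sigma>''"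
  shows "evolves x \<sigma> \<sigma>''"
  unfolding evolves_def
proof (intro conjI allI impI)
  fix y assume "y \<le> x"
  then show "fl \<sigma>'' y = fl \<sigma> y" "dv \<sigma>'' y = dv \<sigma> y" using assms by (auto simp: evolves_def)
next
  fix y assume "fl \<sigma> y \<noteq> 0"
  then have 1: "fl \<sigma>' y \<noteq> 0" "snd (dv \<sigma>' y) \<le> snd (dv \<sigma> y)" using assms(1) by (simp_all add: evolves_def)
  then have 2: "fl \<sigma>'' y \<noteq> 0" "snd (dv \<sigma>'' y) \<le> snd (dv \<sigma>' y)" using assms(2) by (simp_all add: evolves_def)
  show "fl \<sigma>'' y \<noteq> 0" by (rule 2)
  show "snd (dv \<sigma>'' y) \<le> snd (dv \<sigma> y)" using 1 2 by linarith
qed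

lemma relaxed_evolves:
  assumes "evolves x \<sigma> \<sigma>'" "y \<le> x" "relaxed i (fl \<sigma>) (dv \<sigma>) y p"
  shows "relaxed i (fl \<sigma>') (dv \<sigma>') y p"
  unfolding relaxed_def
proof (intro impI)
  have y: "fl \<sigma>' y = fl \<sigma> y" "dv \<sigma>' y = dv \<sigma> y" using assms(1,2) by (auto simp: evolves_def)
  assume "fl \<sigma>' y \<noteq> 0 \<and> trans i y p \<noteq> 0"
  then have 1: "fl \<sigma> (succ i y p) \<noteq> 0"
    "snd (dv \<sigma> (succ i y p)) \<le> snd (dv \<sigma> y) + d (y mod Suc n) (L ! p)"
    using assms(3) y by (simp_all add: relaxed_def)
  then have "fl \<sigma>' (succ i y p) \<noteq> 0" "snd (dv \<sigma>' (succ i y p)) \<le> snd (dv \<sigma> (succ i y p))"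
    using assms(1) by (simp_all add: evolves_def)
  with 1 y show "fl \<sigma>' (succ i y p) \<noteq> 0 \<and>
    snd (dv \<sigma>' (succ i y p)) \<le> snd (dv \<sigma>' y) + d (y mod Suc n) (L ! p)" by simp
qed

lemma relax_com:
  assumes bd: "bounded \<sigma>" and env: "env i x \<sigma>" and p: "words \<sigma> (ad 23 0) = p" "p < m"
    and sound: "sound_tables i (fl \<sigma>) (dv \<sigma>)" and x: "fl \<sigma> x \<noteq> 0" "x < nodes"
  shows "wp (relax_com K M N C) 500 (\<lambda>\<sigma>'. same_except {4, 5, 7} {4} \<sigma> \<sigma>' \<and>
    sound_tables i (fl \<sigma>') (dv \<sigma>') \<and> evolves x \<sigma> \<sigma>' \<and> relaxed i (fl \<sigma>') (dv \<sigma>') x p) \<sigma>"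
proof -
  define \<sigma>1 where "\<sigma>1 = \<sigma>\<lparr>words := (words \<sigma>)(ad 5 0 := trans i x p)\<rparr>"
  have trB: "trans i x p < B"
    using f_less[OF digit_less[OF C_pos]] consts_less_B(1) unfolding trans_def by (meson less_trans)
  have same1: "same_except {4, 5, 7} {4} \<sigma> \<sigma>1"
    unfolding \<sigma>1_def by (intro same_except_upd same_except_refl) auto
  have ev1: "evolves x \<sigma> \<sigma>1" "fl \<sigma>1 = fl \<sigma>" "dv \<sigma>1 = dv \<sigma>" by (auto simp: evolves_def \<sigma>1_def)
  have bd1: "bounded \<sigma>1" using bd trB by (simp add: bounded_def \<sigma>1_def)
  have env1: "env i x \<sigma>1" using env by (intro env_same[OF same1]) auto
  have p1: "words \<sigma>1 (ad 23 0) = p" using p by (simp add: \<sigma>1_def)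
  show ?thesis unfolding relax_com_def
  proof (rule wp_Seq[where ta = 200 and tb = 300])
    show "wp (set_var K 5 (trans_exp K M N C)) 200 (wp (Cond (WLess (Const 0) (var K 5))
       (Seq (set_var K 7 (succ_exp K M C))
         (Cond (bor (WLess (entry K 4 (var K 7)) (Const 1))
             (VLess (extend_exp K (entry K 16 (var K 23))) (VLoad (cell K 4 (var K 7)))))
           (Seq (VStore (cell K 4 (var K 7)) (extend_exp K (entry K 16 (var K 23))))
             (WStore (cell K 4 (var K 7)) (Plus (entry K 4 (var K 22)) (Const 1))))
           Skip)) Skip) 300 (\<lambda>\<sigma>'. same_except {4, 5, 7} {4} \<sigma> \<sigma>' \<and>
      sound_tables i (fl \<sigma>') (dv \<sigma>') \<and> evolves x \<sigma> \<sigma>' \<and> relaxed i (fl \<sigma>') (dv \<sigma>') x p)) \<sigma>"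
      (is "wp _ _ (wp ?c _ ?Q) _")
    proof (rule wp_straight)
      have "com_eval (set_var K 5 (trans_exp K M N C)) \<sigma> = \<sigma>1"
        using trans_exp[OF env p] by (simp add: \<sigma>1_def)
      moreover have "wp ?c 300 ?Q \<sigma>1"
      proof (cases "trans i x p = 0")
        case True
        have "com_eval ?c \<sigma>1 = \<sigma>1" "csafe ?c \<sigma>1" using True by (auto simp: \<sigma>1_def)
        moreover have "?Q \<sigma>1" using same1 ev1 sound True by (simp add: relaxed_def)
        ultimately show ?thesis using bd1 Z_ge
          by (intro wp_straight) (simp_all add: succ_exp_def extend_exp_def state_exp_def group_exp_def)
      next
        case False
        define y where "y = succ i x p"
        have y: "y < nodes" "x < y" "y < D" "y < B"
          using succ_digit(1)[OF x(2) p(2) False] less_succ[OF p(2) False] node_less_D node_less_B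
          by (auto simp: y_def simp del: mult_Suc_right)
        define \<sigma>2 where "\<sigma>2 = \<sigma>1\<lparr>words := (words \<sigma>1)(ad 7 0 := y)\<rparr>"
        have same2: "same_except {4, 5, 7} {4} \<sigma> \<sigma>2"
          unfolding \<sigma>2_def using same1 by (intro same_except_upd) auto
        have env2: "env i x \<sigma>2" using env by (intro env_same[OF same2]) auto
        have ev2: "evolves x \<sigma> \<sigma>2" "fl \<sigma>2 = fl \<sigma>" "dv \<sigma>2 = dv \<sigma>" using ev1
          by (auto simp: evolves_def \<sigma>2_def)
        have v2: "words \<sigma>2 (ad 23 0) = p" "words \<sigma>2 (ad 7 0) = y" "words \<sigma>2 (ad 22 0) = x"
          using p env2 by (auto simp: \<sigma>2_def \<sigma>1_def env_def)
        have v2': "words \<sigma>2 (ad 16 p) = L ! p" using env2 p(2) by (simp add: env_def var_input)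
        have pD: "p < D" "x < D" using p m_le_n n_less_D node_less_D[OF x(2)] by auto
        have f2: "words \<sigma>2 (ad 4 z) = fl \<sigma> z" "vals \<sigma>2 (ad 4 z) = dv \<sigma> z" for z
          using fun_cong[OF ev2(2)] fun_cong[OF ev2(3)] by auto
        have s2: "sound_tables i (fl \<sigma>2) (dv \<sigma>2)" unfolding ev2 by (rule sound)
        have fx2: "fl \<sigma>2 x \<noteq> 0" using x f2 by simp
        have ws: "wsafe \<sigma>2 (entry K 16 (var K 23))" "weval n \<sigma>2 (entry K 16 (var K 23)) = L ! p"
          using v2 v2' pD by simp_all
        have e2: "veval n d \<sigma>2 (extend_exp K (entry K 16 (var K 23))) =
              (fl \<sigma> x, snd (dv \<sigma> x) + d (x mod Suc n) (L ! p))"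
            "vsafe \<sigma>2 (extend_exp K (entry K 16 (var K 23)))" "fl \<sigma> x \<le> Suc m" "fl \<sigma> x < B"
          using extend_exp[OF env2 ws nth_L[OF p(2)] s2 fx2 x(2)] by (simp_all add: f2)
        obtain ps where ps: "reach i x ps" "fl \<sigma> x = Suc (length ps)"
          "dv \<sigma> x = (length ps, walk_length d a (map ((!) L) ps))"
          using sound x unfolding sound_tables_def by blast
        have rs: "reach i y (ps @ [p])" unfolding y_def using ps(1) p(2) False by (rule reach.step)
        have wl: "walk_length d a (map ((!) L) (ps @ [p])) = snd (dv \<sigma> x) + d (x mod Suc n) (L ! p)"
          using ps reach_props[OF ps(1)] by (simp add: walk_length_append)
        have flB: "Suc (fl \<sigma> x) < B"
          using e2(3) m_le_n consts_less_B(4) by simp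
        \<comment> \<open>The count stored is the mark \<open>fl \<sigma> x\<close>: it equals
          \<open>length ps + 1\<close>, the number of summands once the new edge is added.\<close>
        define \<sigma>3 where "\<sigma>3 = \<sigma>2\<lparr>vals := (vals \<sigma>2)(ad 4 y := (fl \<sigma> x, snd (dv \<sigma> x) + d (x mod Suc n) (L ! p))),
          words := (words \<sigma>2)(ad 4 y := Suc (fl \<sigma> x))\<rparr>"
        have same3: "same_except {4, 5, 7} {4} \<sigma> \<sigma>3"
          using same2 unfolding \<sigma>3_def by (auto simp: same_except_def)
        have fl3: "fl \<sigma>3 z = (if z = y then Suc (fl \<sigma> x) else fl \<sigma> z)"
          "dv \<sigma>3 z = (if z = y then (fl \<sigma> x, snd (dv \<sigma> x) + d (x mod Suc n) (L ! p)) else dv \<sigma> z)" for z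
          using fun_cong[OF ev2(2)] fun_cong[OF ev2(3)] by (auto simp: \<sigma>3_def)
        define b1 where "b1 \<longleftrightarrow> fl \<sigma> y = 0 \<or> snd (dv \<sigma> x) + d (x mod Suc n) (L ! p) < snd (dv \<sigma> y)"
        define ce where "ce = (if b1 then \<sigma>3 else \<sigma>2)"
        have se: "weval n \<sigma>1 (succ_exp K M C) = y" "wsafe \<sigma>1 (succ_exp K M C)"
          unfolding y_def using succ_exp[OF env1 p1 p(2)] by (auto simp: \<sigma>1_def)
        have t1: "words \<sigma>1 (ad 5 0) = trans i x p" by (simp add: \<sigma>1_def)
        have st1: "\<sigma>1\<lparr>words := (words \<sigma>1)(ad 7 0 := y)\<rparr> = \<sigma>2" by (simp add: \<sigma>2_def)
        have "com_eval ?c \<sigma>1 = ce"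
          using False v2 f2 e2 t1 se
          by (simp add: st1 ce_def b1_def \<sigma>3_def)
        moreover have "csafe ?c \<sigma>1"
          using False v2 f2 e2 t1 se y pD flB by (simp add: st1)
        moreover have "?Q ce"
        proof (cases b1)
          case True
          have "sound_tables i (fl \<sigma>3) (dv \<sigma>3)" unfolding sound_tables_def
          proof (intro allI impI)
            fix z assume z: "z < nodes" "fl \<sigma>3 z \<noteq> 0"
            show "\<exists>ps. reach i z ps \<and> fl \<sigma>3 z = Suc (length ps) \<and>
                dv \<sigma>3 z = (length ps, walk_length d a (map ((!) L) ps))"
            proof (cases "z = y")
              case True
              then show ?thesis using rs ps(2) wl by (intro exI[of _ "ps @ [p]"]) (simp add: fl3)
            next
              case False
              then show ?thesis using sound z unfolding sound_tables_def by (simp add: fl3)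
            qed
          qed
          moreover have "evolves x \<sigma> \<sigma>3" using True y(2) by (auto simp: evolves_def fl3 b1_def)
          moreover have "relaxed i (fl \<sigma>3) (dv \<sigma>3) x p"
            using y(2) by (simp add: relaxed_def fl3 y_def[symmetric])
          ultimately show ?thesis using same3 True by (simp add: ce_def)
        next
          case False
          then have "relaxed i (fl \<sigma>) (dv \<sigma>) x p" by (auto simp: relaxed_def y_def b1_def)
          then show ?thesis using False same2 ev2 sound by (simp add: ce_def)
        qed
        ultimately show ?thesis using bd1 Z_ge
          by (intro wp_straight) (simp_all add: succ_exp_def extend_exp_def state_exp_def group_exp_def)
      qed
      ultimately show "wp ?c 300 ?Q (com_eval (set_var K 5 (trans_exp K M N C)) \<sigma>)" by simp
    qed (use bd Z_ge trans_exp[OF env p] trB in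
        \<open>auto simp: trans_exp_def state_exp_def group_exp_def\<close>)
  qed simp
qed


abbreviation "rf \<sigma> \<equiv> words \<sigma> (ad 20 0)"
abbreviation "rv \<sigma> \<equiv> vals \<sigma> (ad 16 0)"

text \<open>Stated through upper bounds \<open>v\<close>, because the old value must not be compared
  with while the flag is 0 and the value is arbitrary.\<close>

definition improves :: "state \<Rightarrow> state \<Rightarrow> bool" where
  "improves \<sigma> \<sigma>' \<longleftrightarrow> (\<forall>v. result_le (rf \<sigma>) (rv \<sigma>) v \<longrightarrow> result_le (rf \<sigma>') (rv \<sigma>') v)"

lemma improves_refl: "improves \<sigma> \<sigma>"
  by (simp add: improves_def)

lemma improves_trans: "improves \<sigma> \<sigma>' \<Longrightarrow> improves \<sigma>' \<sigma>'' \<Longrightarrow> improves \<sigma> \<sigma>''"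
  by (simp add: improves_def)

lemma finish_com:
  assumes bd: "bounded \<sigma>" and env: "env i x \<sigma>"
    and sound: "sound_tables i (fl \<sigma>) (dv \<sigma>)" and x: "fl \<sigma> x \<noteq> 0" "x < nodes"
    and ok: "result_ok (rf \<sigma>) (rv \<sigma>)"
  shows "wp (finish_com K) 300 (\<lambda>\<sigma>'. same_except {20} {16} \<sigma> \<sigma>' \<and>
    result_ok (rf \<sigma>') (rv \<sigma>') \<and> improves \<sigma> \<sigma>' \<and>
    (fl \<sigma> x = Suc m \<longrightarrow> result_le (rf \<sigma>') (rv \<sigma>') (snd (dv \<sigma> x) + d (x mod Suc n) b))) \<sigma>"
    (is "wp ?c _ ?Q _")
proof -
  define v where "v = snd (dv \<sigma> x) + d (x mod Suc n) b"
  have vars: "words \<sigma> (ad 17 0) = m" "words \<sigma> (ad 19 0) = b" "words \<sigma> (ad 22 0) = x"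
    using env by (auto simp: env_def var_input)
  have xD: "x < D" using node_less_D[OF x(2)] .
  have e: "veval n d \<sigma> (extend_exp K (var K 19)) = (fl \<sigma> x, v)"
      "vsafe \<sigma> (extend_exp K (var K 19))" "fl \<sigma> x \<le> Suc m" "fl \<sigma> x < B"
    using extend_exp[OF env, of "var K 19" b] sound x vars b_in by (auto simp: v_def)
  define \<sigma>1 where "\<sigma>1 = \<sigma>\<lparr>vals := (vals \<sigma>)(ad 16 0 := (fl \<sigma> x, v)), words := (words \<sigma>)(ad 20 0 := 1)\<rparr>"
  define ce where "ce = (if fl \<sigma> x = Suc m \<and> (rf \<sigma> = 0 \<or> v < snd (rv \<sigma>)) then \<sigma>1 else \<sigma>)"
  have m_iff: "m < fl \<sigma> x \<longleftrightarrow> fl \<sigma> x = Suc m" using e(3) by auto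
  have "com_eval ?c \<sigma> = ce"
    using vars e by (simp add: finish_com_def ce_def \<sigma>1_def m_iff)
  moreover have "csafe ?c \<sigma>"
    using vars e xD B_ge_2 by (simp add: finish_com_def m_iff)
  moreover have "?Q ce"
  proof (cases "fl \<sigma> x = Suc m \<and> (rf \<sigma> = 0 \<or> v < snd (rv \<sigma>))")
    case True
    then have full: "fl \<sigma> x = Suc m" by blast
    obtain ps where ps: "reach i x ps" "fl \<sigma> x = Suc (length ps)"
      "dv \<sigma> x = (length ps, walk_length d a (map ((!) L) ps))"
      using sound x unfolding sound_tables_def by blast
    have len: "length ps = m" using ps(2) full by simp
    have "v = walk_length d a (map ((!) L) ps @ [b])"
      using reach_full(3)[OF ps(1) len] ps(3) by (simp add: v_def)
    then have "result_ok (rf \<sigma>1) (rv \<sigma>1)"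
      using reach_full(1,2)[OF ps(1) len] full unfolding result_ok_def \<sigma>1_def by auto
    moreover have "same_except {20} {16} \<sigma> \<sigma>1" by (auto simp: same_except_def \<sigma>1_def)
    moreover have "improves \<sigma> \<sigma>1" using True by (auto simp: improves_def result_le_def \<sigma>1_def)
    moreover have "result_le (rf \<sigma>1) (rv \<sigma>1) v" by (simp add: result_le_def \<sigma>1_def)
    ultimately show ?thesis using True by (simp add: ce_def v_def)
  next
    case False
    then have "fl \<sigma> x = Suc m \<longrightarrow> result_le (rf \<sigma>) (rv \<sigma>) v" by (auto simp: result_le_def)
    moreover have "ce = \<sigma>" unfolding ce_def using False by (rule if_not_P)
    ultimately show ?thesis using ok
      by (simp add: same_except_refl improves_refl v_def)
  qed
  moreover have "com_time (finish_com K) \<le> 300" by (simp add: finish_com_def extend_exp_def)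
  ultimately show ?thesis using bd Z_ge by (intro wp_straight) simp_all
qed

lemma fl_same: "same_except W V \<sigma> \<sigma>' \<Longrightarrow> 4 \<notin> W \<Longrightarrow> fl \<sigma>' = fl \<sigma>"
  and dv_same: "same_except W V \<sigma> \<sigma>' \<Longrightarrow> 4 \<notin> V \<Longrightarrow> dv \<sigma>' = dv \<sigma>"
  by (auto simp: same_except_def)

lemma result_same: "same_except W V \<sigma> \<sigma>' \<Longrightarrow> 20 \<notin> W \<Longrightarrow> rf \<sigma>' = rf \<sigma>"
  "same_except W V \<sigma> \<sigma>' \<Longrightarrow> 16 \<notin> V \<Longrightarrow> rv \<sigma>' = rv \<sigma>"
  by (auto simp: same_except_def)

text \<open>The invariant for nodes behind the sweep; by \<open>evolves\<close> and
  \<open>improves\<close> it persists while later nodes are treated.\<close>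

definition processed :: "nat \<Rightarrow> nat \<Rightarrow> state \<Rightarrow> bool" where
  "processed i x \<sigma> \<longleftrightarrow> (\<forall>p<m. relaxed i (fl \<sigma>) (dv \<sigma>) x p) \<and>
     (fl \<sigma> x = Suc m \<longrightarrow> result_le (rf \<sigma>) (rv \<sigma>) (snd (dv \<sigma> x) + d (x mod Suc n) b))"

lemma processed_mono:
  assumes "evolves x \<sigma> \<sigma>'" "improves \<sigma> \<sigma>'" "y \<le> x" "processed i y \<sigma>"
  shows "processed i y \<sigma>'"
proof -
  have "fl \<sigma>' y = fl \<sigma> y" "dv \<sigma>' y = dv \<sigma> y" using assms by (auto simp: evolves_def)
  then show ?thesis using assms relaxed_evolves[OF assms(1,3)]
    by (auto simp: processed_def improves_def)
qed

lemma relax_loop: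
  assumes bd: "bounded \<sigma>" and env: "env i x \<sigma>"
    and sound: "sound_tables i (fl \<sigma>) (dv \<sigma>)" and x: "fl \<sigma> x \<noteq> 0" "x < nodes"
  shows "wp (For K 23 (var K 17) (relax_com K M N C)) (540 * Suc n) (\<lambda>\<sigma>'.
    same_except {4, 5, 7, 23} {4} \<sigma> \<sigma>' \<and> sound_tables i (fl \<sigma>') (dv \<sigma>') \<and> evolves x \<sigma> \<sigma>' \<and>
    (\<forall>p<m. relaxed i (fl \<sigma>') (dv \<sigma>') x p)) \<sigma>"
proof (rule wp_For[where k = m and tb = 500 and I = "\<lambda>p \<sigma>'. same_except {4, 5, 7, 23} {4} \<sigma> \<sigma>' \<and>
      sound_tables i (fl \<sigma>') (dv \<sigma>') \<and> evolves x \<sigma> \<sigma>' \<and> (\<forall>q<p. relaxed i (fl \<sigma>') (dv \<sigma>') x q)"])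
  show "m < B" using m_le_n n_less_B by simp
  show "same_except {4, 5, 7, 23} {4} \<sigma> \<sigma> \<and> sound_tables i (fl \<sigma>) (dv \<sigma>) \<and> evolves x \<sigma> \<sigma> \<and>
      (\<forall>q<0. relaxed i (fl \<sigma>) (dv \<sigma>) x q)"
    using sound by (simp add: same_except_refl evolves_refl)
next
  fix p \<sigma>' v assume "same_except {4, 5, 7, 23} {4} \<sigma> \<sigma>' \<and>
      sound_tables i (fl \<sigma>') (dv \<sigma>') \<and> evolves x \<sigma> \<sigma>' \<and> (\<forall>q<p. relaxed i (fl \<sigma>') (dv \<sigma>') x q)"
  then show "same_except {4, 5, 7, 23} {4} \<sigma> (\<sigma>'\<lparr>words := (words \<sigma>')(ad 23 0 := v)\<rparr>) \<and>
      sound_tables i (fl (\<sigma>'\<lparr>words := (words \<sigma>')(ad 23 0 := v)\<rparr>)) (dv (\<sigma>'\<lparr>words := (words \<sigma>')(ad 23 0 := v)\<rparr>)) \<and>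
      evolves x \<sigma> (\<sigma>'\<lparr>words := (words \<sigma>')(ad 23 0 := v)\<rparr>) \<and>
      (\<forall>q<p. relaxed i (fl (\<sigma>'\<lparr>words := (words \<sigma>')(ad 23 0 := v)\<rparr>))
         (dv (\<sigma>'\<lparr>words := (words \<sigma>')(ad 23 0 := v)\<rparr>)) x q)"
    by (auto intro: same_except_upd simp: evolves_def)
next
  fix p \<sigma>' assume "same_except {4, 5, 7, 23} {4} \<sigma> \<sigma>' \<and>
      sound_tables i (fl \<sigma>') (dv \<sigma>') \<and> evolves x \<sigma> \<sigma>' \<and> (\<forall>q<p. relaxed i (fl \<sigma>') (dv \<sigma>') x q)"
  then have "env i x \<sigma>'" using env by (auto intro: env_same)
  then show "wsafe \<sigma>' (var K 17) \<and> weval n \<sigma>' (var K 17) = m" by (auto simp: env_def var_input)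
next
  fix p \<sigma>' assume p: "p < m" and bd': "bounded \<sigma>'" and "words \<sigma>' (ad 23 0) = p" and
    I: "same_except {4, 5, 7, 23} {4} \<sigma> \<sigma>' \<and>
      sound_tables i (fl \<sigma>') (dv \<sigma>') \<and> evolves x \<sigma> \<sigma>' \<and> (\<forall>q<p. relaxed i (fl \<sigma>') (dv \<sigma>') x q)"
  then have "env i x \<sigma>'" "fl \<sigma>' x \<noteq> 0" using env x by (auto intro: env_same simp: evolves_def)
  moreover have "words \<sigma>'' (ad 23 0) = words \<sigma>' (ad 23 0)"
    if "same_except {4, 5, 7} {4} \<sigma>' \<sigma>''" for \<sigma>'' using that by (auto simp: same_except_def)
  ultimately show "wp (relax_com K M N C) 500 (\<lambda>\<sigma>''. words \<sigma>'' (ad 23 0) = p \<and>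
      same_except {4, 5, 7, 23} {4} \<sigma> \<sigma>'' \<and> sound_tables i (fl \<sigma>'') (dv \<sigma>'') \<and>
      evolves x \<sigma> \<sigma>'' \<and> (\<forall>q<Suc p. relaxed i (fl \<sigma>'') (dv \<sigma>'') x q)) \<sigma>'"
    using I p bd' x \<open>words \<sigma>' (ad 23 0) = p\<close>
    by (intro wp_mono[OF relax_com[of \<sigma>' i x p]])
      (auto simp: less_Suc_eq intro: same_except_trans evolves_trans relaxed_evolves)
qed (use bd Z_ge m_le_n in auto)

lemma node_com:
  assumes bd: "bounded \<sigma>" and env: "env i x \<sigma>"
    and sound: "sound_tables i (fl \<sigma>) (dv \<sigma>)" and x: "x < nodes"
    and ok: "result_ok (rf \<sigma>) (rv \<sigma>)"
  shows "wp (node_com K M N C) (1000 * Suc n) (\<lambda>\<sigma>'. same_except {4, 5, 7, 20, 23} {4, 16} \<sigma> \<sigma>' \<and>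
    sound_tables i (fl \<sigma>') (dv \<sigma>') \<and> evolves x \<sigma> \<sigma>' \<and> result_ok (rf \<sigma>') (rv \<sigma>') \<and> improves \<sigma> \<sigma>' \<and>
    processed i x \<sigma>') \<sigma>" (is "wp _ _ ?Q _")
  unfolding node_com_def
proof (rule wp_Cond[where tc = "840 * Suc n"])
  have vx: "words \<sigma> (ad 22 0) = x" using env by (simp add: env_def)
  show "bsafe \<sigma> (WLess (Const 0) (entry K 4 (var K 22)))" using vx node_less_D[OF x] by simp
  {
    assume "beval n d \<sigma> (WLess (Const 0) (entry K 4 (var K 22)))"
    then have fx: "fl \<sigma> x \<noteq> 0" using vx by simp
    show "wp (Seq (finish_com K) (For K 23 (var K 17) (relax_com K M N C))) (840 * Suc n) ?Q \<sigma>"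
    proof (rule wp_Seq[where ta = 300 and tb = "540 * Suc n"])
      show "wp (finish_com K) 300 (wp (For K 23 (var K 17) (relax_com K M N C)) (540 * Suc n) ?Q) \<sigma>"
      proof (rule wp_mono[OF finish_com[OF bd env sound fx x ok] order_refl], elim conjE)
        fix \<sigma>1 assume bd1: "bounded \<sigma>1" and same1: "same_except {20} {16} \<sigma> \<sigma>1"
          and ok1: "result_ok (rf \<sigma>1) (rv \<sigma>1)" and imp1: "improves \<sigma> \<sigma>1"
          and le1: "fl \<sigma> x = Suc m \<longrightarrow> result_le (rf \<sigma>1) (rv \<sigma>1) (snd (dv \<sigma> x) + d (x mod Suc n) b)"
        have fl1: "fl \<sigma>1 = fl \<sigma>" "dv \<sigma>1 = dv \<sigma>" using fl_same[OF same1] dv_same[OF same1] by auto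
        have env1: "env i x \<sigma>1" using env by (intro env_same[OF same1]) auto
        have ev1: "evolves x \<sigma> \<sigma>1" using fun_cong[OF fl1(1)] fun_cong[OF fl1(2)] by (simp add: evolves_def)
        have s1: "sound_tables i (fl \<sigma>1) (dv \<sigma>1)" using sound fl1 by simp
        have fx1: "fl \<sigma>1 x \<noteq> 0" using fx fun_cong[OF fl1(1)] by simp
        show "wp (For K 23 (var K 17) (relax_com K M N C)) (540 * Suc n) ?Q \<sigma>1"
        proof (rule wp_mono[OF relax_loop[OF bd1 env1 s1 fx1 x] order_refl], elim conjE)
          fix \<sigma>2 assume same2: "same_except {4, 5, 7, 23} {4} \<sigma>1 \<sigma>2"
            and s2: "sound_tables i (fl \<sigma>2) (dv \<sigma>2)" and ev2: "evolves x \<sigma>1 \<sigma>2"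
            and rel2: "\<forall>p<m. relaxed i (fl \<sigma>2) (dv \<sigma>2) x p"
          have r2: "rf \<sigma>2 = rf \<sigma>1" "rv \<sigma>2 = rv \<sigma>1" using result_same[OF same2] by auto
          have "fl \<sigma>2 x = fl \<sigma> x" "dv \<sigma>2 x = dv \<sigma> x"
            using ev2 fun_cong[OF fl1(1)] fun_cong[OF fl1(2)] by (auto simp: evolves_def)
          then have "processed i x \<sigma>2" using rel2 le1 r2 by (simp add: processed_def)
          then show "?Q \<sigma>2"
            using s2 ok1 imp1 r2 same_except_trans[OF same1 same2] evolves_trans[OF ev1 ev2]
            by (auto simp: improves_def)
        qed
      qed
    qed simp
  }
  {
    assume "\<not> beval n d \<sigma> (WLess (Const 0) (entry K 4 (var K 22)))"
    then have fx: "fl \<sigma> x = 0" using vx by simp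
    then have "processed i x \<sigma>" by (simp add: processed_def relaxed_def)
    then have "?Q \<sigma>" using sound ok by (simp add: same_except_refl evolves_refl improves_refl)
    then show "wp Skip (840 * Suc n) ?Q \<sigma>" using bd Z_ge by (intro wp_straight) auto
  }
qed (use bd Z_ge in auto)

end

context tsp_machine
begin

lemma tag_numeral [simp]: "numeral k < (24 :: nat) \<Longrightarrow> numeral k < K"
  by (rule less_le_trans[where y = 24]) (simp_all add: K_eq)

definition base_time :: nat where
  "base_time = Suc (N ^ (n div 2 ^ R div M + 1)) * (Suc (C ^ (n div 2 ^ R div M + 1) * Suc n) * (1500 * Suc n))"

text \<open>The contract of a recursion level. It may overwrite the auxiliary arrays and those of
  levels up to \<open>r\<close>, but neither the tables in arrays 0 to 3 nor any array of its
  callers. The admissible size roughly doubles with each level and is \<open>n\<close> at level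
  \<open>R\<close>.\<close>

definition solves_level :: "nat \<Rightarrow> com \<Rightarrow> nat \<Rightarrow> bool" where
  "solves_level r c t \<longleftrightarrow> (\<forall>\<sigma> L a b. bounded \<sigma> \<and> tables \<sigma> \<and> input r L a b \<sigma> \<and>
     distinct L \<and> set L \<subseteq> {1..n} \<and> a \<in> {1..n} \<and> b \<in> {1..n} \<and> length L \<le> n div 2 ^ (R - r) \<longrightarrow>
     wp c t (\<lambda>\<sigma>'. same_except {4..<24 + 8 * r} {4..<24 + 8 * r} \<sigma> \<sigma>' \<and>
       fst (vals \<sigma>' (ad (16 + 8 * r) 0)) = Suc (length L) \<and>
       optimal_path d (set L) a b (snd (vals \<sigma>' (ad (16 + 8 * r) 0)))) \<sigma>)"

end

context base_machine
begin

text \<open>The table serves all choices \<open>i\<close> in turn, and marks left over from another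
  choice would belong to other automata.\<close>

lemma clear_loop:
  assumes bd: "bounded \<sigma>" and v: "words \<sigma> (ad 6 0) = nodes"
  shows "wp (For K 22 (var K 6) (WStore (cell K 4 (var K 22)) (Const 0))) (Suc nodes * 50)
    (\<lambda>\<sigma>'. same_except {4, 22} {} \<sigma> \<sigma>' \<and> (\<forall>y<nodes. fl \<sigma>' y = 0)) \<sigma>"
proof (rule wp_For[where k = nodes and tb = 12 and
      I = "\<lambda>x \<sigma>'. same_except {4, 22} {} \<sigma> \<sigma>' \<and> (\<forall>y<x. fl \<sigma>' y = 0)"])
  show "nodes < B" using node_less_B by blast
next
  fix x \<sigma>' v assume "same_except {4, 22} {} \<sigma> \<sigma>' \<and> (\<forall>y<x. fl \<sigma>' y = 0)"
  then show "same_except {4, 22} {} \<sigma> (\<sigma>'\<lparr>words := (words \<sigma>')(ad 22 0 := v)\<rparr>) \<and>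
      (\<forall>y<x. fl (\<sigma>'\<lparr>words := (words \<sigma>')(ad 22 0 := v)\<rparr>) y = 0)"
    by (auto intro: same_except_upd)
next
  fix x \<sigma>' assume "same_except {4, 22} {} \<sigma> \<sigma>' \<and> (\<forall>y<x. fl \<sigma>' y = 0)"
  then have "words \<sigma>' (ad 6 0) = nodes" using v by (simp add: same_except_def)
  then show "wsafe \<sigma>' (var K 6) \<and> weval n \<sigma>' (var K 6) = nodes" by simp
next
  fix x \<sigma>' assume x: "x < nodes" and "bounded \<sigma>'"
    and I: "same_except {4, 22} {} \<sigma> \<sigma>' \<and> (\<forall>y<x. fl \<sigma>' y = 0)" and vx: "words \<sigma>' (ad 22 0) = x"
  then show "wp (WStore (cell K 4 (var K 22)) (Const 0)) 12 (\<lambda>\<sigma>''. words \<sigma>'' (ad 22 0) = x \<and>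
      same_except {4, 22} {} \<sigma> \<sigma>'' \<and> (\<forall>y<Suc x. fl \<sigma>'' y = 0)) \<sigma>'"
    using node_less_D[OF x] Z_ge
    by (intro wp_straight) (auto simp: less_Suc_eq intro!: same_except_upd)
qed (use bd Z_ge in \<open>auto simp: same_except_refl\<close>)

text \<open>A single sweep suffices by \<open>less_succ\<close>: once the sweep has come to a node,
  neither this nor a later visit changes its entry.\<close>

lemma node_loop:
  assumes bd: "bounded \<sigma>" and env: "tables \<sigma>" "input 0 L a b \<sigma>" "words \<sigma> (ad 6 0) = nodes"
      "words \<sigma> (ad 21 0) = i"
    and sound: "sound_tables i (fl \<sigma>) (dv \<sigma>)" and start: "fl \<sigma> a \<noteq> 0" "snd (dv \<sigma> a) \<le> 0"
    and ok: "result_ok (rf \<sigma>) (rv \<sigma>)"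
  shows "wp (For K 22 (var K 6) (node_com K M N C)) (Suc nodes * (1040 * Suc n)) (\<lambda>\<sigma>'.
    same_except {4, 5, 7, 20, 22, 23} {4, 16} \<sigma> \<sigma>' \<and> sound_tables i (fl \<sigma>') (dv \<sigma>') \<and>
    fl \<sigma>' a \<noteq> 0 \<and> snd (dv \<sigma>' a) \<le> 0 \<and> result_ok (rf \<sigma>') (rv \<sigma>') \<and> improves \<sigma> \<sigma>' \<and>
    (\<forall>y<nodes. processed i y \<sigma>')) \<sigma>"
proof -
  let ?I = "\<lambda>x \<sigma>'. same_except {4, 5, 7, 20, 22, 23} {4, 16} \<sigma> \<sigma>' \<and> sound_tables i (fl \<sigma>') (dv \<sigma>') \<and>
    fl \<sigma>' a \<noteq> 0 \<and> snd (dv \<sigma>' a) \<le> 0 \<and> result_ok (rf \<sigma>') (rv \<sigma>') \<and> improves \<sigma> \<sigma>' \<and>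
    (\<forall>y<x. processed i y \<sigma>')"
  have env': "env i x \<sigma>'" if "?I x' \<sigma>'" "words \<sigma>' (ad 22 0) = x" for x x' \<sigma>'
  proof -
    have "same_except {4, 5, 7, 20, 22, 23} {4, 16} \<sigma> \<sigma>'" using that by blast
    then show ?thesis using env that(2) tables_same[of _ _ \<sigma> \<sigma>'] input_same[of _ _ \<sigma> \<sigma>' 0]
      by (auto simp: env_def same_except_words)
  qed
  show ?thesis
  proof (rule wp_For[where k = nodes and tb = "1000 * Suc n" and I = ?I])
    show "nodes < B" using node_less_B by blast
    show "?I 0 \<sigma>" using sound start ok by (simp add: same_except_refl improves_refl)
  next
    fix x \<sigma>' v assume "?I x \<sigma>'"
    then show "?I x (\<sigma>'\<lparr>words := (words \<sigma>')(ad 22 0 := v)\<rparr>)"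
      by (auto intro: same_except_upd simp: improves_def processed_def)
  next
    fix x \<sigma>' assume "?I x \<sigma>'"
    then have "words \<sigma>' (ad 6 0) = nodes" using env(3) by (simp add: same_except_def)
    then show "wsafe \<sigma>' (var K 6) \<and> weval n \<sigma>' (var K 6) = nodes" by simp
  next
    fix x \<sigma>' assume x: "x < nodes" and bd': "bounded \<sigma>'" and I: "?I x \<sigma>'" and vx: "words \<sigma>' (ad 22 0) = x"
    have "wp (node_com K M N C) (1000 * Suc n) (\<lambda>\<sigma>''. same_except {4, 5, 7, 20, 23} {4, 16} \<sigma>' \<sigma>'' \<and>
      sound_tables i (fl \<sigma>'') (dv \<sigma>'') \<and> evolves x \<sigma>' \<sigma>'' \<and> result_ok (rf \<sigma>'') (rv \<sigma>'') \<and>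
      improves \<sigma>' \<sigma>'' \<and> processed i x \<sigma>'') \<sigma>'"
      using I by (intro node_com[OF bd' env'[OF I vx] _ x]) auto
    then show "wp (node_com K M N C) (1000 * Suc n) (\<lambda>\<sigma>''. words \<sigma>'' (ad 22 0) = x \<and> ?I (Suc x) \<sigma>'') \<sigma>'"
    proof (rule wp_mono[OF _ order_refl], elim conjE)
      fix \<sigma>'' assume same: "same_except {4, 5, 7, 20, 23} {4, 16} \<sigma>' \<sigma>''" and
        s: "sound_tables i (fl \<sigma>'') (dv \<sigma>'')" and ev: "evolves x \<sigma>' \<sigma>''" and
        ok: "result_ok (rf \<sigma>'') (rv \<sigma>'')" and imp: "improves \<sigma>' \<sigma>''" and pr: "processed i x \<sigma>''"
      have "words \<sigma>'' (ad 22 0) = x" using same vx by (simp add: same_except_def)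
      moreover have "same_except {4, 5, 7, 20, 22, 23} {4, 16} \<sigma> \<sigma>''"
        using I same by (auto intro: same_except_trans)
      moreover have "fl \<sigma>'' a \<noteq> 0" "snd (dv \<sigma>'' a) \<le> snd (dv \<sigma>' a)"
        using ev I by (simp_all add: evolves_def)
      moreover have "processed i y \<sigma>''" if "y < Suc x" for y
        using that pr I processed_mono[OF ev imp, of y i] by (auto simp: less_Suc_eq)
      ultimately show "words \<sigma>'' (ad 22 0) = x \<and> ?I (Suc x) \<sigma>''"
        using s ok imp I improves_trans[of \<sigma> \<sigma>' \<sigma>''] by (intro conjI allI impI) (simp, simp, simp, simp, linarith, simp, simp, simp)
    qed
  next
    show "(nodes + 1) * (1000 * Suc n + wcost (var K 6) + 30) \<le> Suc nodes * (1040 * Suc n)"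
      by (intro mult_le_mono) auto
  qed (use bd Z_ge in auto)
qed

lemma dp_com:
  assumes bd: "bounded \<sigma>" and env: "tables \<sigma>" "input 0 L a b \<sigma>" "words \<sigma> (ad 6 0) = nodes"
      "words \<sigma> (ad 21 0) = i"
    and ok: "result_ok (rf \<sigma>) (rv \<sigma>)"
  shows "wp (dp_com K M N C) (Suc nodes * (1200 * Suc n)) (\<lambda>\<sigma>'.
    same_except {4, 5, 7, 20, 22, 23} {4, 16} \<sigma> \<sigma>' \<and> result_ok (rf \<sigma>') (rv \<sigma>') \<and> improves \<sigma> \<sigma>' \<and>
    (\<forall>x ps. reach i x ps \<and> length ps = m \<longrightarrow>
       result_le (rf \<sigma>') (rv \<sigma>') (walk_length d a (map ((!) L) ps @ [b])))) \<sigma>" (is "wp _ _ ?Q _")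
  unfolding dp_com_def
proof (rule wp_Seq[where ta = "Suc nodes * 50" and tb = "50 + Suc nodes * (1040 * Suc n)"])
  let ?c2 = "Seq (WStore (cell K 4 (var K 18)) (Const 1)) (VStore (cell K 4 (var K 18)) VZero)"
  let ?c3 = "For K 22 (var K 6) (node_com K M N C)"
  show "wp (For K 22 (var K 6) (WStore (cell K 4 (var K 22)) (Const 0))) (Suc nodes * 50)
    (wp (Seq ?c2 ?c3) (50 + Suc nodes * (1040 * Suc n)) ?Q) \<sigma>"
  proof (rule wp_mono[OF clear_loop[OF bd env(3)] order_refl], elim conjE)
    fix \<sigma>1 assume bd1: "bounded \<sigma>1" and same1: "same_except {4, 22} {} \<sigma> \<sigma>1" and cl: "\<forall>y<nodes. fl \<sigma>1 y = 0"
    show "wp (Seq ?c2 ?c3) (50 + Suc nodes * (1040 * Suc n)) ?Q \<sigma>1"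
    proof (rule wp_Seq[where ta = 50 and tb = "Suc nodes * (1040 * Suc n)"])
      define \<sigma>2 where "\<sigma>2 = \<sigma>1\<lparr>words := (words \<sigma>1)(ad 4 a := 1), vals := (vals \<sigma>1)(ad 4 a := (0, 0))\<rparr>"
      have va: "words \<sigma>1 (ad 18 0) = a" using same1 env(2) by (simp add: var_input same_except_def)
      have an: "a < nodes" using reach_props[OF reach.start] by blast
      have same2: "same_except {4, 22} {4} \<sigma> \<sigma>2" using same1 by (auto simp: \<sigma>2_def same_except_def)
      have fl2: "fl \<sigma>2 y = (if y = a then 1 else fl \<sigma>1 y)" "dv \<sigma>2 y = (if y = a then (0, 0) else dv \<sigma>1 y)" for y
        by (auto simp: \<sigma>2_def)
      have s2: "sound_tables i (fl \<sigma>2) (dv \<sigma>2)"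
        unfolding sound_tables_def using cl reach.start by (auto simp: fl2 intro!: exI[of _ "[]"])
      have r2: "rf \<sigma>2 = rf \<sigma>" "rv \<sigma>2 = rv \<sigma>" using same2 by (auto simp: same_except_def)
      have bd2: "bounded \<sigma>2" using bd1 B_ge_2 by (simp add: bounded_def \<sigma>2_def)
      have env2: "tables \<sigma>2" "input 0 L a b \<sigma>2" "words \<sigma>2 (ad 6 0) = nodes" "words \<sigma>2 (ad 21 0) = i"
        using env tables_same[OF same2] input_same[OF same2, of 0] same2 by (auto simp: same_except_def)
      have "wp ?c3 (Suc nodes * (1040 * Suc n)) ?Q \<sigma>2"
      proof (rule wp_mono[OF node_loop[OF bd2 env2 s2] order_refl], goal_cases)
        case (4 \<sigma>3)
        then have same3: "same_except {4, 5, 7, 20, 22, 23} {4, 16} \<sigma>2 \<sigma>3"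
          and s3: "sound_tables i (fl \<sigma>3) (dv \<sigma>3)" and st: "fl \<sigma>3 a \<noteq> 0" "snd (dv \<sigma>3 a) \<le> 0"
          and ok3: "result_ok (rf \<sigma>3) (rv \<sigma>3)" and imp: "improves \<sigma>2 \<sigma>3"
          and pr: "\<And>y. y < nodes \<Longrightarrow> processed i y \<sigma>3" by blast+
        have "result_le (rf \<sigma>3) (rv \<sigma>3) (walk_length d a (map ((!) L) ps @ [b]))"
          if ps: "reach i x ps" "length ps = m" for x ps
        proof -
          note rp = reach_props[OF ps(1)]
          have x: "x < nodes" using rp by blast
          have c: "fl \<sigma>3 x \<noteq> 0" "snd (dv \<sigma>3 x) \<le> walk_length d a (map ((!) L) ps)"
            using relaxed_complete[where fl = "fl \<sigma>3" and v = "dv \<sigma>3", OF st _ ps(1)] pr by (auto simp: processed_def)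
          \<comment> \<open>The entry may stem from another path \<open>qs\<close>. It ends in the
            same node, hence visits the same set as \<open>ps\<close> and is complete, so the result
            has been updated from this entry.\<close>
          then obtain qs where qs: "reach i x qs" "fl \<sigma>3 x = Suc (length qs)"
            using s3 x unfolding sound_tables_def by blast
          note rq = reach_props[OF qs(1)]
          have "set qs = set ps" using rp rq by (auto simp: subset_eq)
          then have "length qs = length ps" using rp rq by (metis distinct_card)
          then have "result_le (rf \<sigma>3) (rv \<sigma>3) (snd (dv \<sigma>3 x) + d (x mod Suc n) b)"
            using pr[OF x] qs(2) ps(2) by (simp add: processed_def)
          then show ?thesis using c(2) unfolding reach_full(3)[OF ps] by (simp add: result_le_def)
        qed
        then show ?case
          using ok3 imp r2 same_except_trans[OF same2 same3] by (auto simp: improves_def)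
      qed (use fl2 ok r2 in auto)
      moreover have "com_eval ?c2 \<sigma>1 = \<sigma>2" using va by (simp add: \<sigma>2_def)
      moreover have "csafe ?c2 \<sigma>1" using va node_less_D[OF an] by simp
      ultimately show "wp ?c2 50 (wp ?c3 (Suc nodes * (1040 * Suc n)) ?Q) \<sigma>1"
        using bd1 Z_ge by - (rule wp_straight, simp_all)
    qed simp
  qed
  show "Suc nodes * 50 + (50 + Suc nodes * (1040 * Suc n)) \<le> Suc nodes * (1200 * Suc n)"
  proof -
    have "Suc nodes * 50 + (50 + Suc nodes * (1040 * Suc n)) \<le> Suc nodes * (100 + 1040 * Suc n)"
      by (simp add: algebra_simps)
    also have "\<dots> \<le> Suc nodes * (1200 * Suc n)" by (intro mult_le_mono) auto
    finally show ?thesis .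
  qed
qed

lemma groups_exp:
  assumes "tables \<sigma>" "input 0 L a b \<sigma>"
  shows "weval n \<sigma> (groups_exp K M) = G" "wsafe \<sigma> (groups_exp K M)" "G < D"
    "words \<sigma> (ad 1 G) = C ^ G" "words \<sigma> (ad 2 G) = N ^ G"
  using assms G_le(1) n_less_D M_pos
  by (auto simp: groups_exp_def groups_def var_input tables_def)

lemma base_com:
  assumes bd: "bounded \<sigma>" and env: "tables \<sigma>" "input 0 L a b \<sigma>"
  shows "wp (base_com K M N C) base_time (\<lambda>\<sigma>'. same_except {4..<24} {4..<24} \<sigma> \<sigma>' \<and>
    fst (vals \<sigma>' (ad 16 0)) = Suc m \<and> optimal_path d (set L) a b (snd (vals \<sigma>' (ad 16 0)))) \<sigma>"
    (is "wp _ _ ?Q _")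
  unfolding base_com_def
proof (rule wp_Seq[where ta = 100 and tb = "Suc (N ^ G) * (Suc nodes * (1300 * Suc n))"])
  let ?c1 = "Seq (set_var K 6 (Times (entry K 1 (groups_exp K M)) (Plus Cities (Const 1)))) (set_var K 20 (Const 0))"
  let ?c2 = "For K 21 (entry K 2 (groups_exp K M)) (dp_com K M N C)"
  let ?t = "Suc (N ^ G) * (Suc nodes * (1300 * Suc n))"
  define \<sigma>1 where "\<sigma>1 = \<sigma>\<lparr>words := (words \<sigma>)(ad 6 0 := nodes, ad 20 0 := 0)\<rparr>"
  have same1: "same_except {6, 20} {} \<sigma> \<sigma>1" by (auto simp: \<sigma>1_def same_except_def)
  have nB: "nodes < B" using node_less_B by blast
  have bd1: "bounded \<sigma>1" using bd nB by (simp add: bounded_def \<sigma>1_def)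
  have env1: "tables \<sigma>1" "input 0 L a b \<sigma>1" "words \<sigma>1 (ad 6 0) = nodes"
    using env tables_same[OF same1] input_same[OF same1, of 0] by (auto simp: \<sigma>1_def)
  have ok1: "result_ok (rf \<sigma>1) (rv \<sigma>1)" by (simp add: result_ok_def \<sigma>1_def)
  let ?I = "\<lambda>i \<sigma>'. same_except {4, 5, 7, 20, 21, 22, 23} {4, 16} \<sigma>1 \<sigma>' \<and> result_ok (rf \<sigma>') (rv \<sigma>') \<and>
    (\<forall>j<i. \<forall>x ps. reach j x ps \<and> length ps = m \<longrightarrow>
       result_le (rf \<sigma>') (rv \<sigma>') (walk_length d a (map ((!) L) ps @ [b])))"
  have env': "tables \<sigma>'" "input 0 L a b \<sigma>'" "words \<sigma>' (ad 6 0) = nodes" if "?I i \<sigma>'" for i \<sigma>'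
  proof -
    have "same_except {4, 5, 7, 20, 21, 22, 23} {4, 16} \<sigma>1 \<sigma>'" using that by blast
    then show "tables \<sigma>'" "input 0 L a b \<sigma>'" "words \<sigma>' (ad 6 0) = nodes"
      using env1 tables_same[of _ _ \<sigma>1 \<sigma>'] input_same[of _ _ \<sigma>1 \<sigma>' 0] by (auto simp: same_except_words)
  qed
  have "wp ?c2 ?t ?Q \<sigma>1"
  proof (rule wp_For[where k = "N ^ G" and tb = "Suc nodes * (1200 * Suc n)" and I = ?I])
    have "N ^ G \<le> N ^ n" using G_le(1) N_pos by (intro power_increasing) auto
    then show "N ^ G < B" using powers_less_B(2) by simp
    show "?I 0 \<sigma>1" using ok1 by (simp add: same_except_refl)
  next
    fix i \<sigma>' v assume "?I i \<sigma>'"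
    then show "?I i (\<sigma>'\<lparr>words := (words \<sigma>')(ad 21 0 := v)\<rparr>)" by (auto intro: same_except_upd)
  next
    fix i \<sigma>' assume I: "?I i \<sigma>'"
    then show "wsafe \<sigma>' (entry K 2 (groups_exp K M)) \<and> weval n \<sigma>' (entry K 2 (groups_exp K M)) = N ^ G"
      using groups_exp[OF env'(1,2)[OF I]] by simp
  next
    fix i \<sigma>' assume bd': "bounded \<sigma>'" and I: "?I i \<sigma>'" and vi: "words \<sigma>' (ad 21 0) = i"
    show "wp (dp_com K M N C) (Suc nodes * (1200 * Suc n)) (\<lambda>\<sigma>''. words \<sigma>'' (ad 21 0) = i \<and> ?I (Suc i) \<sigma>'') \<sigma>'"
    proof (rule wp_mono[OF dp_com[OF bd' env'[OF I] vi] order_refl], goal_cases)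
      case (2 \<sigma>'')
      then have same: "same_except {4, 5, 7, 20, 22, 23} {4, 16} \<sigma>' \<sigma>''" by blast
      have "words \<sigma>'' (ad 21 0) = i" using same vi by (simp add: same_except_def)
      moreover have "same_except {4, 5, 7, 20, 21, 22, 23} {4, 16} \<sigma>1 \<sigma>''"
        using I same by (auto intro: same_except_trans)
      ultimately show ?case using 2 I by (auto simp: less_Suc_eq improves_def)
    qed (use I in blast)
  next
    fix \<sigma>' assume I: "?I (N ^ G) \<sigma>'"
    then have "optimal_path d (set L) a b (snd (rv \<sigma>'))" "fst (rv \<sigma>') = Suc m"
      using optimal_pathI[of "rf \<sigma>'" "rv \<sigma>'"] by blast+
    moreover have "same_except {4..<24} {4..<24} \<sigma> \<sigma>'"
      using I by (intro same_except_trans[OF same1]) auto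
    ultimately show "?Q \<sigma>'" by simp
  next
    have "Suc nodes * (1200 * Suc n) + 100 \<le> Suc nodes * (1300 * Suc n)"
      by (simp add: algebra_simps)
    then have "Suc nodes * (1200 * Suc n) + wcost (entry K 2 (groups_exp K M)) + 30 \<le> Suc nodes * (1300 * Suc n)"
      by (simp add: groups_exp_def)
    then show "(N ^ G + 1) * (Suc nodes * (1200 * Suc n) + wcost (entry K 2 (groups_exp K M)) + 30) \<le> ?t"
      by (metis Suc_eq_plus1 mult_le_mono2)
  qed (use bd1 Z_ge in \<open>auto simp: groups_exp_def\<close>)
  moreover have "com_eval ?c1 \<sigma> = \<sigma>1"
    using groups_exp[OF env] by (simp add: \<sigma>1_def)
  moreover have "csafe ?c1 \<sigma>" using groups_exp[OF env] nB by simp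
  moreover have "com_time ?c1 \<le> 100" by (simp add: groups_exp_def)
  ultimately show "wp ?c1 100 (wp ?c2 ?t ?Q) \<sigma>"
    using bd Z_ge by - (rule wp_straight, simp_all del: com_eval.simps csafe.simps com_time.simps)
  have NG: "N ^ G \<le> N ^ (n div 2 ^ R div M + 1)" using G_le(2) N_pos by (intro power_increasing) auto
  have "100 + ?t \<le> Suc (N ^ G) * (Suc nodes * (1400 * Suc n))"
    by (simp add: algebra_simps)
  also have "\<dots> \<le> base_time" unfolding base_time_def
    using NG nodes_le by (intro mult_le_mono) auto
  finally show "100 + ?t \<le> base_time" .
qed

end

lemma (in tsp_machine) solves_level_base: "solves_level 0 (base_com K M N C) base_time"
  unfolding solves_level_def
proof (intro allI impI, elim conjE)
  fix \<sigma> L a b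
  assume *: "bounded \<sigma>" "tables \<sigma>" "input 0 L a b \<sigma>" and "distinct L" "set L \<subseteq> {1..n}"
    "a \<in> {1..n}" "b \<in> {1..n}" "length L \<le> n div 2 ^ (R - 0)"
  then interpret base_machine n d w s B Z K D M N C f lab R L a b
    by unfold_locales auto
  show "wp (base_com K M N C) base_time (\<lambda>\<sigma>'. same_except {4..<24 + 8 * 0} {4..<24 + 8 * 0} \<sigma> \<sigma>' \<and>
       fst (vals \<sigma>' (ad (16 + 8 * 0) 0)) = Suc (length L) \<and>
       optimal_path d (set L) a b (snd (vals \<sigma>' (ad (16 + 8 * 0) 0)))) \<sigma>"
    using base_com[OF *] by simp
qed

section \<open>Divide and conquer\<close>

text \<open>The bit of the subset number in \<open>29 + 8 * r\<close> at the position in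
  \<open>31 + 8 * r\<close>. In this section the arrays from \<open>24 + 8 * r\<close> on belong to
  the caller, level \<open>r + 1\<close>, and those from \<open>16 + 8 * r\<close> to level
  \<open>r\<close>, which receives the subproblem.\<close>

definition bit_exp :: "nat \<Rightarrow> nat \<Rightarrow> wexp" where
  "bit_exp K r = Mod (Div (var K (29 + 8 * r)) (entry K 3 (var K (31 + 8 * r)))) (Const 2)"

definition select_com :: "nat \<Rightarrow> nat \<Rightarrow> bexp \<Rightarrow> com" where
  "select_com K r t = Seq (set_var K (17 + 8 * r) (Const 0))
     (For K (31 + 8 * r) (var K (25 + 8 * r))
       (Cond (BAnd t (bor (WLess (var K (31 + 8 * r)) (var K (30 + 8 * r)))
             (WLess (var K (30 + 8 * r)) (var K (31 + 8 * r)))))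
         (Seq (WStore (cell K (16 + 8 * r) (var K (17 + 8 * r))) (entry K (24 + 8 * r) (var K (31 + 8 * r))))
           (set_var K (17 + 8 * r) (Plus (var K (17 + 8 * r)) (Const 1))))
         Skip))"

definition combine_com :: "nat \<Rightarrow> nat \<Rightarrow> com" where
  "combine_com K r = Cond (bor (WLess (var K (28 + 8 * r)) (Const 1))
       (VLess (VPlus (VLoad (cell K (25 + 8 * r) (Const 0))) (VLoad (cell K (16 + 8 * r) (Const 0))))
         (VLoad (cell K (24 + 8 * r) (Const 0)))))
     (Seq (VStore (cell K (24 + 8 * r) (Const 0))
         (VPlus (VLoad (cell K (25 + 8 * r) (Const 0))) (VLoad (cell K (16 + 8 * r) (Const 0)))))
       (set_var K (28 + 8 * r) (Const 1)))
     Skip"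

text \<open>The cities other than the middle one are split. Both parts must have at most half the
  size to meet the contract of \<open>c\<close>; otherwise this guess is skipped. The first result
  is saved in value array \<open>25 + 8 * r\<close>, because the second run of \<open>c\<close>
  overwrites \<open>16 + 8 * r\<close>.\<close>

definition split_com :: "nat \<Rightarrow> nat \<Rightarrow> com \<Rightarrow> com" where
  "split_com K r c = Seq (select_com K r (WLess (Const 0) (bit_exp K r)))
     (Cond (BAnd (BNot (WLess (Div (var K (25 + 8 * r)) (Const 2)) (var K (17 + 8 * r))))
         (BNot (WLess (Div (var K (25 + 8 * r)) (Const 2))
           (Minus (Minus (var K (25 + 8 * r)) (Const 1)) (var K (17 + 8 * r))))))
       (Seq (Seq (set_var K (18 + 8 * r) (var K (26 + 8 * r)))
           (set_var K (19 + 8 * r) (entry K (24 + 8 * r) (var K (30 + 8 * r)))))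
       (Seq c
       (Seq (VStore (cell K (25 + 8 * r) (Const 0)) (VLoad (cell K (16 + 8 * r) (Const 0))))
       (Seq (select_com K r (WLess (bit_exp K r) (Const 1)))
       (Seq (Seq (set_var K (18 + 8 * r) (entry K (24 + 8 * r) (var K (30 + 8 * r))))
           (set_var K (19 + 8 * r) (var K (27 + 8 * r))))
       (Seq c (combine_com K r)))))))
       Skip)"

text \<open>An empty list has no middle city and is answered directly. Otherwise all
  \<open>2 ^ m\<close> bit vectors are tried: an unbalanced one costs polynomial time only, and the
  balanced ones already number \<open>2 ^ m\<close> up to a polynomial factor.\<close>

definition divide_com :: "nat \<Rightarrow> nat \<Rightarrow> com \<Rightarrow> com" where
  "divide_com K r c = Cond (WLess (var K (25 + 8 * r)) (Const 1))
     (VStore (cell K (24 + 8 * r) (Const 0)) (Dist (var K (26 + 8 * r)) (var K (27 + 8 * r))))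
     (Seq (set_var K (28 + 8 * r) (Const 0))
       (For K (29 + 8 * r) (entry K 3 (var K (25 + 8 * r)))
         (For K (30 + 8 * r) (var K (25 + 8 * r)) (split_com K r c))))"

section \<open>Correctness of divide and conquer\<close>

locale divide_machine = tsp_machine n d w s B Z K D M N C f lab R + path_instance M N C f lab n d L a b
  for n d w s B Z K D M N C f lab R L a b +
  fixes r :: nat and c :: com and t :: nat
  assumes r_less: "r < R" and c_solves: "solves_level r c t"
    and m_le: "length L \<le> n div 2 ^ (R - Suc r)"
begin

lemma m_le_n: "m \<le> n"
  using m_le div_le_dividend le_trans by blast

text \<open>Halving with rounding down agrees with iterated division, so no slack builds up in the
  sizes over the levels.\<close>

lemma half_le: "m div 2 \<le> n div 2 ^ (R - r)"
proof -
  have "R - r = Suc (R - Suc r)" using r_less by simp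
  then have "n div 2 ^ (R - r) = n div 2 ^ (R - Suc r) div 2"
    by (simp add: div_mult2_eq[symmetric] mult.commute)
  then show ?thesis using m_le by (simp add: div_le_mono)
qed

lemma level_tag [simp]: "x < 32 \<Longrightarrow> x + 8 * r < K"
  using r_less by (simp add: K_eq)

lemma two_less_B [simp]: "2 < B"
  using n_pos consts_less_B(4) by simp

definition chosen :: "nat \<Rightarrow> nat \<Rightarrow> nat \<Rightarrow> nat list" where
  "chosen z y p = map ((!) L) (filter (\<lambda>q. digit 2 y q = z \<and> q \<noteq> p) [0..<m])"

lemma distinct_chosen: "distinct (chosen z y p)"
  using dist_L by (auto simp: chosen_def distinct_map inj_on_def nth_eq_iff_index_eq)

lemma set_chosen: "set (chosen z y p) = {L ! q |q. q < m \<and> digit 2 y q = z \<and> q \<noteq> p}"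
  by (auto simp: chosen_def)

lemma set_chosen_subset: "set (chosen z y p) \<subseteq> {1..n}"
  using nth_L by (auto simp: set_chosen)

lemma digit_2: "digit 2 y q = 0 \<or> digit 2 y q = 1"
  using digit_less[of 2 y q] by auto

lemma length_chosen:
  assumes "p < m"
  shows "length (chosen 1 y p) + length (chosen 0 y p) = m - 1"
proof -
  let ?A = "\<lambda>z. {q. q < m \<and> digit 2 y q = z \<and> q \<noteq> p}"
  have len: "length (chosen z y p) = card (?A z)" for z
  proof -
    have "length (chosen z y p) = card (set (filter (\<lambda>q. digit 2 y q = z \<and> q \<noteq> p) [0..<m]))"
      unfolding chosen_def length_map by (rule distinct_card[symmetric]) simp
    also have "set (filter (\<lambda>q. digit 2 y q = z \<and> q \<noteq> p) [0..<m]) = ?A z" by auto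
    finally show ?thesis .
  qed
  have "card (?A 1) + card (?A 0) = card (?A 1 \<union> ?A 0)"
    by (rule card_Un_disjoint[symmetric]) auto
  also have "?A 1 \<union> ?A 0 = {..<m} - {p}" by auto (metis One_nat_def digit_2 less_irrefl)
  also have "card ({..<m} - {p}) = m - 1" using assms by simp
  finally show ?thesis by (simp add: len)
qed

lemma partition:
  assumes "p < m"
  shows "set L = set (chosen 1 y p) \<union> {L ! p} \<union> set (chosen 0 y p)"
    "L ! p \<notin> set (chosen z y p)" "set (chosen 1 y p) \<inter> set (chosen 0 y p) = {}"
proof -
  show "L ! p \<notin> set (chosen z y p)" "set (chosen 1 y p) \<inter> set (chosen 0 y p) = {}"
    using assms dist_L by (auto simp: set_chosen nth_eq_iff_index_eq)
  show "set L = set (chosen 1 y p) \<union> {L ! p} \<union> set (chosen 0 y p)"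
  proof
    show "set L \<subseteq> set (chosen 1 y p) \<union> {L ! p} \<union> set (chosen 0 y p)"
    proof
      fix v assume "v \<in> set L"
      then obtain q where q: "q < m" "v = L ! q" by (metis in_set_conv_nth)
      show "v \<in> set (chosen 1 y p) \<union> {L ! p} \<union> set (chosen 0 y p)"
        using digit_2[of y q] q by (cases "q = p") (auto simp: set_chosen)
    qed
  qed (use assms in \<open>auto simp: set_chosen\<close>)
qed

definition balanced :: "nat \<Rightarrow> nat \<Rightarrow> bool" where
  "balanced y p \<longleftrightarrow> length (chosen 1 y p) \<le> m div 2 \<and> length (chosen 0 y p) \<le> m div 2"

text \<open>Cut \<open>xs\<close> at index \<open>m div 2\<close>: the city there is the middle one,
  and \<open>y\<close> is the characteristic vector of the positions of the cities before it. The
  parts have \<open>m div 2\<close> and \<open>m - 1 - m div 2\<close> cities, so both are small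
  enough.\<close>

lemma split_exists:
  assumes xs: "distinct xs" "set xs = set L" and "0 < m"
  shows "\<exists>y<2 ^ m. \<exists>p<m. balanced y p \<and> (\<exists>us vs. xs = us @ L ! p # vs \<and>
    distinct us \<and> set us = set (chosen 1 y p) \<and> distinct vs \<and> set vs = set (chosen 0 y p))"
proof -
  define k where "k = m div 2"
  have len: "length xs = m" using xs dist_L by (metis distinct_card)
  have k: "k < m" using assms(3) by (simp add: k_def)
  define us where "us = take k xs"
  define vs where "vs = drop (Suc k) xs"
  have split: "xs = us @ xs ! k # vs" using k len by (simp add: us_def vs_def id_take_nth_drop)
  have "xs ! k \<in> set L" using k len xs(2) nth_mem by metis
  then obtain p where p: "p < m" "L ! p = xs ! k" by (metis in_set_conv_nth)
  have "\<exists>y<2 ^ m. \<forall>q<m. digit 2 y q = (if L ! q \<in> set us then 1 else 0)"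
    by (rule digits_exist) auto
  then obtain y where y: "y < 2 ^ m" "\<forall>q<m. digit 2 y q = (if L ! q \<in> set us then 1 else 0)" by blast
  have dis: "distinct us" "distinct vs" "L ! p \<notin> set us" "L ! p \<notin> set vs" "set us \<inter> set vs = {}"
    using xs(1) split p(2) by (metis distinct.simps(2) distinct_append disjoint_insert(2) list.simps(15) inf.commute)+
  have u: "set us = set (chosen 1 y p)"
  proof
    show "set us \<subseteq> set (chosen 1 y p)"
    proof
      fix v assume v: "v \<in> set us"
      then have "v \<in> set L" using xs(2) split by (metis Un_iff set_append)
      then obtain q where "q < m" "v = L ! q" by (metis in_set_conv_nth)
      then show "v \<in> set (chosen 1 y p)" using v y(2) dis(3) by (auto simp: set_chosen)
    qed
    show "set (chosen 1 y p) \<subseteq> set us" using y(2) by (auto simp: set_chosen split: if_splits)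
  qed
  have "set L = set us \<union> {L ! p} \<union> set vs"
    using xs(2) split p(2) by (metis list.simps(15) set_append Un_insert_right sup_assoc insert_is_Un)
  then have v: "set vs = set (chosen 0 y p)"
    using partition[OF p(1), of y] partition(2)[OF p(1), of 0 y] dis u by blast
  have "length (chosen 1 y p) = length us" using u dis distinct_chosen by (metis distinct_card)
  moreover have "length us = k" using len k by (simp add: us_def)
  ultimately have "balanced y p" using length_chosen[OF p(1), of y] by (simp add: balanced_def k_def)
  then show ?thesis using y(1) p split u v dis by metis
qed

definition params :: "nat \<Rightarrow> nat \<Rightarrow> state \<Rightarrow> bool" where
  "params y p \<sigma> \<longleftrightarrow> tables \<sigma> \<and> input (Suc r) L a b \<sigma> \<and>
     words \<sigma> (ad (29 + 8 * r) 0) = y \<and> words \<sigma> (ad (30 + 8 * r) 0) = p"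

lemma params_same:
  assumes "same_except W V \<sigma> \<sigma>'" "params y p \<sigma>"
    "W \<inter> {0, 1, 2, 3, 24 + 8 * r, 25 + 8 * r, 26 + 8 * r, 27 + 8 * r, 29 + 8 * r, 30 + 8 * r} = {}"
  shows "params y p \<sigma>'"
proof -
  have "tables \<sigma>'" using tables_same[OF assms(1)] assms(2,3) by (auto simp: params_def)
  moreover have "input (Suc r) L a b \<sigma>'"
    using input_same[OF assms(1), of "Suc r"] assms(2,3) r_less by (auto simp: params_def)
  ultimately show ?thesis
    using assms by (simp add: params_def same_except_words[OF assms(1)])
qed

lemma params_vars:
  assumes "params y p \<sigma>"
  shows "words \<sigma> (ad (25 + 8 * r) 0) = m" "words \<sigma> (ad (26 + 8 * r) 0) = a"
    "words \<sigma> (ad (27 + 8 * r) 0) = b" "q < m \<Longrightarrow> words \<sigma> (ad (24 + 8 * r) q) = L ! q"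
    "words \<sigma> (ad (29 + 8 * r) 0) = y" "words \<sigma> (ad (30 + 8 * r) 0) = p"
    "q \<le> n \<Longrightarrow> words \<sigma> (ad 3 q) = 2 ^ q"
  using assms by (auto simp: params_def input_def tables_def add.commute)

lemma select_com:
  assumes bd: "bounded \<sigma>" and par: "params y p \<sigma>" and z: "z = 0 \<or> z = 1"
    and te: "te = (if z = 1 then WLess (Const 0) (bit_exp K r) else WLess (bit_exp K r) (Const 1))"
  shows "wp (select_com K r te) (300 * Suc n) (\<lambda>\<sigma>'.
    same_except {16 + 8 * r, 17 + 8 * r, 31 + 8 * r} {} \<sigma> \<sigma>' \<and>
    words \<sigma>' (ad (17 + 8 * r) 0) = length (chosen z y p) \<and>
    (\<forall>q<length (chosen z y p). words \<sigma>' (ad (16 + 8 * r) q) = chosen z y p ! q)) \<sigma>"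
  unfolding select_com_def
proof (rule wp_Seq[where ta = 20 and tb = "260 * Suc n"])
  let ?body = "Cond (BAnd te (bor (WLess (var K (31 + 8 * r)) (var K (30 + 8 * r)))
             (WLess (var K (30 + 8 * r)) (var K (31 + 8 * r)))))
         (Seq (WStore (cell K (16 + 8 * r) (var K (17 + 8 * r))) (entry K (24 + 8 * r) (var K (31 + 8 * r))))
           (set_var K (17 + 8 * r) (Plus (var K (17 + 8 * r)) (Const 1))))
         Skip"
  let ?W = "{16 + 8 * r, 17 + 8 * r, 31 + 8 * r}"
  let ?loop = "For K (31 + 8 * r) (var K (25 + 8 * r)) ?body"
  \<comment> \<open>The part of \<open>chosen\<close> that comes from positions below
    \<open>q\<close>: what the loop has written before round \<open>q\<close>.\<close>
  define pre where "pre q = map ((!) L) (filter (\<lambda>q. digit 2 y q = z \<and> q \<noteq> p) [0..<q])" for q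
  let ?I = "\<lambda>q \<sigma>'. same_except ?W {} \<sigma> \<sigma>' \<and> words \<sigma>' (ad (17 + 8 * r) 0) = length (pre q) \<and>
    (\<forall>k<length (pre q). words \<sigma>' (ad (16 + 8 * r) k) = pre q ! k)"
  let ?Q = "\<lambda>\<sigma>'. same_except ?W {} \<sigma> \<sigma>' \<and>
    words \<sigma>' (ad (17 + 8 * r) 0) = length (chosen z y p) \<and>
    (\<forall>q<length (chosen z y p). words \<sigma>' (ad (16 + 8 * r) q) = chosen z y p ! q)"
  have pre_m: "pre m = chosen z y p" by (simp add: pre_def chosen_def)
  have len_pre: "length (pre q) \<le> q" for q unfolding pre_def length_map
    by (metis diff_zero length_filter_le length_upt)
  have par': "params y p \<sigma>'" if "same_except ?W {} \<sigma> \<sigma>'" for \<sigma>'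
    by (rule params_same[OF that par]) auto
  have loop: "wp ?loop (260 * Suc n) ?Q \<sigma>1"
    if bd1: "bounded \<sigma>1" and I0: "?I 0 \<sigma>1" for \<sigma>1
  proof (rule wp_For[where k = m and tb = 220 and I = ?I])
    show "m < B" using m_le_n n_less_B by simp
    show "?I 0 \<sigma>1" by (rule I0)
  next
    fix q \<sigma>' v assume "?I q \<sigma>'"
    then show "?I q (\<sigma>'\<lparr>words := (words \<sigma>')(ad (31 + 8 * r) 0 := v)\<rparr>)"
      by (auto intro: same_except_upd)
  next
    fix q \<sigma>' assume "?I q \<sigma>'"
    then have "params y p \<sigma>'" using par' by blast
    then show "wsafe \<sigma>' (var K (25 + 8 * r)) \<and> weval n \<sigma>' (var K (25 + 8 * r)) = m"
      by (simp add: params_vars)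
  next
    fix q \<sigma>' assume q: "q < m" and bd': "bounded \<sigma>'" and I: "?I q \<sigma>'"
      and vq: "words \<sigma>' (ad (31 + 8 * r) 0) = q"
    note pv = params_vars[OF par'[OF conjunct1[OF I]]]
    have qD: "q < D" "length (pre q) < D" "length (pre q) < B" "Suc (length (pre q)) < B" "q \<le> n"
      using q m_le_n n_less_D len_pre[of q] consts_less_B(4) by linarith+
    have LB: "L ! q < B" using nth_L[OF q] n_less_B by auto
    have bit: "weval n \<sigma>' (bit_exp K r) = digit 2 y q" "wsafe \<sigma>' (bit_exp K r)"
      using pv vq qD by (simp_all add: bit_exp_def digit_def)
    have tev: "beval n d \<sigma>' te \<longleftrightarrow> digit 2 y q = z" "bsafe \<sigma>' te" "bcost te \<le> 60"
      using z bit digit_2[of y q] by (auto simp: te bit_exp_def)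
    define \<sigma>2 where "\<sigma>2 = \<sigma>'\<lparr>words := (words \<sigma>')(ad (16 + 8 * r) (length (pre q)) := L ! q,
      ad (17 + 8 * r) 0 := Suc (length (pre q)))\<rparr>"
    have ne: "(q < p \<or> p < q) \<longleftrightarrow> q \<noteq> p" by auto
    have ce: "com_eval ?body \<sigma>' = (if digit 2 y q = z \<and> q \<noteq> p then \<sigma>2 else \<sigma>')"
      using tev pv vq q I ne by (auto simp: \<sigma>2_def)
    have cs: "csafe ?body \<sigma>'"
      using tev pv vq q I qD LB by auto
    have "?I (Suc q) (com_eval ?body \<sigma>') \<and> words (com_eval ?body \<sigma>') (ad (31 + 8 * r) 0) = q"
    proof (cases "digit 2 y q = z \<and> q \<noteq> p")
      case True
      have pre': "pre (Suc q) = pre q @ [L ! q]" using True by (simp add: pre_def)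
      have "same_except ?W {} \<sigma> \<sigma>2" using I by (auto simp: same_except_def \<sigma>2_def)
      then show ?thesis unfolding ce using True I vq
        by (auto simp: \<sigma>2_def pre' nth_append less_Suc_eq)
    next
      case False
      then have "pre (Suc q) = pre q" by (auto simp: pre_def)
      then show ?thesis using I vq unfolding ce if_not_P[OF False] by simp
    qed
    moreover have "com_time ?body \<le> 220" using tev(3) by simp
    ultimately show "wp ?body 220 (\<lambda>\<sigma>'. words \<sigma>' (ad (31 + 8 * r) 0) = q \<and> ?I (Suc q) \<sigma>') \<sigma>'"
      using bd' Z_ge cs by - (rule wp_straight, simp_all del: com_eval.simps csafe.simps com_time.simps)
  next
    fix \<sigma>' assume "?I m \<sigma>'"
    then show "?Q \<sigma>'" unfolding pre_m .
  next
    show "(m + 1) * (220 + wcost (var K (25 + 8 * r)) + 30) \<le> 260 * Suc n" using m_le_n by simp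
  qed (use bd1 Z_ge in auto)
  define \<sigma>1 where "\<sigma>1 = \<sigma>\<lparr>words := (words \<sigma>)(ad (17 + 8 * r) 0 := 0)\<rparr>"
  have "bounded \<sigma>1" using bd by (simp add: bounded_def \<sigma>1_def)
  moreover have "?I 0 \<sigma>1" by (auto simp: \<sigma>1_def pre_def intro: same_except_upd same_except_refl)
  ultimately have "wp ?loop (260 * Suc n) ?Q \<sigma>1" by (rule loop)
  then show "wp (set_var K (17 + 8 * r) (Const 0)) 20 (wp ?loop (260 * Suc n) ?Q) \<sigma>"
    using bd Z_ge by - (rule wp_straight, simp_all add: \<sigma>1_def)
qed simp


abbreviation "rf \<sigma> \<equiv> words \<sigma> (ad (28 + 8 * r) 0)"
abbreviation "rv \<sigma> \<equiv> vals \<sigma> (ad (24 + 8 * r) 0)"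

definition improves :: "state \<Rightarrow> state \<Rightarrow> bool" where
  "improves \<sigma> \<sigma>' \<longleftrightarrow> (\<forall>v. result_le (rf \<sigma>) (rv \<sigma>) v \<longrightarrow> result_le (rf \<sigma>') (rv \<sigma>') v)"

lemma combine_com:
  assumes bd: "bounded \<sigma>" and p: "p < m"
    and x: "vals \<sigma> (ad (25 + 8 * r) 0) = (Suc (length (chosen 1 y p)), u)"
      "optimal_path d (set (chosen 1 y p)) a (L ! p) u"
      "vals \<sigma> (ad (16 + 8 * r) 0) = (Suc (length (chosen 0 y p)), v)"
      "optimal_path d (set (chosen 0 y p)) (L ! p) b v"
    and ok: "result_ok (rf \<sigma>) (rv \<sigma>)"
  shows "wp (combine_com K r) 200 (\<lambda>\<sigma>'. same_except {28 + 8 * r} {24 + 8 * r} \<sigma> \<sigma>' \<and>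
    result_ok (rf \<sigma>') (rv \<sigma>') \<and> improves \<sigma> \<sigma>' \<and> result_le (rf \<sigma>') (rv \<sigma>') (u + v)) \<sigma>"
    (is "wp _ _ ?Q _")
proof -
  \<comment> \<open>The middle city is an end of both halves, so the two edge counts add up to that
    of the whole path.\<close>
  have len: "Suc (length (chosen 1 y p)) + Suc (length (chosen 0 y p)) = Suc m"
    using length_chosen[OF p, of y] p by simp
  define \<sigma>1 where "\<sigma>1 = \<sigma>\<lparr>vals := (vals \<sigma>)(ad (24 + 8 * r) 0 := (Suc m, u + v)),
    words := (words \<sigma>)(ad (28 + 8 * r) 0 := 1)\<rparr>"
  define ce where "ce = (if rf \<sigma> = 0 \<or> u + v < snd (rv \<sigma>) then \<sigma>1 else \<sigma>)"
  have "com_eval (combine_com K r) \<sigma> = ce"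
    using x(1,3) len by (simp add: combine_com_def ce_def \<sigma>1_def)
  moreover have "csafe (combine_com K r) \<sigma>"
    using x(1,3) len m_le_n consts_less_B(4) by (simp add: combine_com_def)
  moreover have "com_time (combine_com K r) \<le> 200" by (simp add: combine_com_def)
  moreover have "?Q ce"
  proof (cases "rf \<sigma> = 0 \<or> u + v < snd (rv \<sigma>)")
    case True
    obtain us where us: "distinct us" "set us = set (chosen 1 y p)" "u = walk_length d a (us @ [L ! p])"
      using x(2) by (auto simp: optimal_path_def)
    obtain vs where vs: "distinct vs" "set vs = set (chosen 0 y p)" "v = walk_length d (L ! p) (vs @ [b])"
      using x(4) by (auto simp: optimal_path_def)
    have "u + v = walk_length d a ((us @ L ! p # vs) @ [b])"
      using us(3) vs(3) by (simp add: walk_length_append)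
    moreover have "distinct (us @ L ! p # vs)" "set (us @ L ! p # vs) = set L"
      using us vs partition[OF p, of y] partition(2)[OF p, of 1 y] partition(2)[OF p, of 0 y] by auto
    ultimately have "result_ok (rf \<sigma>1) (rv \<sigma>1)" unfolding result_ok_def
      by (intro impI exI[of _ "us @ L ! p # vs"]) (simp add: \<sigma>1_def)
    moreover have "same_except {28 + 8 * r} {24 + 8 * r} \<sigma> \<sigma>1" by (auto simp: same_except_def \<sigma>1_def)
    moreover have "improves \<sigma> \<sigma>1" using True by (auto simp: improves_def result_le_def \<sigma>1_def)
    moreover have "result_le (rf \<sigma>1) (rv \<sigma>1) (u + v)" by (simp add: result_le_def \<sigma>1_def)
    moreover have "ce = \<sigma>1" unfolding ce_def using True by (rule if_P)
    ultimately show ?thesis by simp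
  next
    case False
    moreover have "ce = \<sigma>" unfolding ce_def using False by (rule if_not_P)
    ultimately show ?thesis using ok by (auto simp: same_except_refl improves_def result_le_def)
  qed
  ultimately show ?thesis using bd Z_ge by - (rule wp_straight, simp_all)
qed

lemma sub_run:
  assumes "bounded \<sigma>" "tables \<sigma>" "input r (chosen z y p) u v \<sigma>" "u \<in> {1..n}" "v \<in> {1..n}"
    "length (chosen z y p) \<le> m div 2"
  shows "wp c t (\<lambda>\<sigma>'. same_except {4..<24 + 8 * r} {4..<24 + 8 * r} \<sigma> \<sigma>' \<and>
    fst (vals \<sigma>' (ad (16 + 8 * r) 0)) = Suc (length (chosen z y p)) \<and>
    optimal_path d (set (chosen z y p)) u v (snd (vals \<sigma>' (ad (16 + 8 * r) 0)))) \<sigma>"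
  using c_solves[unfolded solves_level_def, rule_format, of \<sigma> "chosen z y p" u v]
    assms distinct_chosen set_chosen_subset half_le by (meson le_trans)

lemma split_com:
  assumes bd: "bounded \<sigma>" and par: "params y p \<sigma>" and p: "p < m" and ok: "result_ok (rf \<sigma>) (rv \<sigma>)"
  shows "wp (split_com K r c) (2 * t + 1500 * Suc n) (\<lambda>\<sigma>'.
    same_except ({4..<24 + 8 * r} \<union> {28 + 8 * r, 31 + 8 * r}) ({4..<24 + 8 * r} \<union> {24 + 8 * r, 25 + 8 * r}) \<sigma> \<sigma>' \<and>
    result_ok (rf \<sigma>') (rv \<sigma>') \<and> improves \<sigma> \<sigma>' \<and>
    (balanced y p \<longrightarrow> (\<forall>us vs. distinct us \<and> set us = set (chosen 1 y p) \<and>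
      distinct vs \<and> set vs = set (chosen 0 y p) \<longrightarrow>
      result_le (rf \<sigma>') (rv \<sigma>') (walk_length d a ((us @ L ! p # vs) @ [b]))))) \<sigma>"
    (is "wp _ _ ?Q _")
proof -
  let ?W = "{4..<24 + 8 * r} \<union> {28 + 8 * r, 31 + 8 * r}"
  let ?V = "{4..<24 + 8 * r} \<union> {24 + 8 * r, 25 + 8 * r}"
  let ?S = "{16 + 8 * r, 17 + 8 * r, 31 + 8 * r}"
  let ?c6 = "Seq c (combine_com K r)"
  let ?s5 = "Seq (set_var K (18 + 8 * r) (entry K (24 + 8 * r) (var K (30 + 8 * r))))
           (set_var K (19 + 8 * r) (var K (27 + 8 * r)))"
  let ?c5 = "Seq ?s5 ?c6"
  let ?c4 = "Seq (select_com K r (WLess (bit_exp K r) (Const 1))) ?c5"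
  let ?s3 = "VStore (cell K (25 + 8 * r) (Const 0)) (VLoad (cell K (16 + 8 * r) (Const 0)))"
  let ?c3 = "Seq ?s3 ?c4"
  let ?c2 = "Seq c ?c3"
  let ?s1 = "Seq (set_var K (18 + 8 * r) (var K (26 + 8 * r)))
           (set_var K (19 + 8 * r) (entry K (24 + 8 * r) (var K (30 + 8 * r))))"
  let ?c1 = "Seq ?s1 ?c2"
  have par': "params y p \<sigma>'" if "same_except ?W ?V \<sigma> \<sigma>'" for \<sigma>'
    by (rule params_same[OF that par]) auto
  have ok': "rf \<sigma>' = rf \<sigma>" "rv \<sigma>' = rv \<sigma>"
    if "same_except ({4..<24 + 8 * r} \<union> ?S) ({4..<24 + 8 * r} \<union> {25 + 8 * r}) \<sigma> \<sigma>'" for \<sigma>'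
    using that by (simp_all add: same_except_def)
  have lp: "L ! p \<in> {1..n}" "L ! p < B" "a < B" "b < B" "p < D"
    using nth_L[OF p] a_in b_in n_less_B n_less_D m_le_n p by auto
  have tabs: "tables \<sigma>'" if "params y p \<sigma>'" for \<sigma>' using that by (simp add: params_def)
  \<comment> \<open>The nested sequence is verified from back to front; \<open>q6\<close> is the
    part after the second subproblem has been set up.\<close>
  have q6: "wp ?c6 (t + 200) ?Q \<sigma>6"
    if bd6: "bounded \<sigma>6" and same6: "same_except ({4..<24 + 8 * r} \<union> ?S) ({4..<24 + 8 * r} \<union> {25 + 8 * r}) \<sigma> \<sigma>6"
      and inp: "input r (chosen 0 y p) (L ! p) b \<sigma>6" and bal: "balanced y p"
      and u: "vals \<sigma>6 (ad (25 + 8 * r) 0) = (Suc (length (chosen 1 y p)), u)"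
        "optimal_path d (set (chosen 1 y p)) a (L ! p) u" for \<sigma>6 u
  proof (rule wp_Seq)
    have sameW: "same_except ?W ?V \<sigma> \<sigma>6" using same6 by (auto simp: same_except_def)
    show "wp c t (wp (combine_com K r) 200 ?Q) \<sigma>6"
    proof (rule wp_mono[OF sub_run[OF bd6 tabs[OF par'[OF sameW]] inp lp(1) b_in] order_refl], goal_cases)
      case 1
      then show ?case using bal by (simp add: balanced_def)
    next
      case (2 \<sigma>7)
      then have same7: "same_except {4..<24 + 8 * r} {4..<24 + 8 * r} \<sigma>6 \<sigma>7" by blast
      define v where "v = snd (vals \<sigma>7 (ad (16 + 8 * r) 0))"
      have v: "vals \<sigma>7 (ad (16 + 8 * r) 0) = (Suc (length (chosen 0 y p)), v)"
        "optimal_path d (set (chosen 0 y p)) (L ! p) b v"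
        using 2 by (auto simp: v_def prod_eq_iff)
      have u7: "vals \<sigma>7 (ad (25 + 8 * r) 0) = (Suc (length (chosen 1 y p)), u)"
        using u(1) same7 by (simp add: same_except_def)
      have same7': "same_except ({4..<24 + 8 * r} \<union> ?S) ({4..<24 + 8 * r} \<union> {25 + 8 * r}) \<sigma> \<sigma>7"
        by (rule same_except_trans[OF same6 same7]) auto
      have ok7: "result_ok (rf \<sigma>7) (rv \<sigma>7)" unfolding ok'[OF same7'] by (rule ok)
      show ?case
      proof (rule wp_mono[OF combine_com[OF \<open>bounded \<sigma>7\<close> p u7 u(2) v ok7] order_refl], elim conjE)
        fix \<sigma>8 assume same8: "same_except {28 + 8 * r} {24 + 8 * r} \<sigma>7 \<sigma>8"
          and ok8: "result_ok (rf \<sigma>8) (rv \<sigma>8)" and imp: "improves \<sigma>7 \<sigma>8"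
          and le: "result_le (rf \<sigma>8) (rv \<sigma>8) (u + v)"
        have "same_except ?W ?V \<sigma> \<sigma>8" by (rule same_except_trans[OF same7' same8]) auto
        moreover have "improves \<sigma> \<sigma>8" using imp unfolding improves_def ok'[OF same7'] .
        moreover have "result_le (rf \<sigma>8) (rv \<sigma>8) (walk_length d a ((us @ L ! p # vs) @ [b]))"
          if uv: "distinct us \<and> set us = set (chosen 1 y p) \<and> distinct vs \<and> set vs = set (chosen 0 y p)"
          for us vs
        proof -
          have "u \<le> walk_length d a (us @ [L ! p])" "v \<le> walk_length d (L ! p) (vs @ [b])"
            using u(2) v(2) uv by (auto simp: optimal_path_def)
          moreover have "walk_length d a ((us @ L ! p # vs) @ [b])
              = walk_length d a (us @ [L ! p]) + walk_length d (L ! p) (vs @ [b])"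
            by (simp add: walk_length_append)
          ultimately show ?thesis using le by (simp add: result_le_def)
        qed
        ultimately show "?Q \<sigma>8" using ok8 by blast
      qed
    qed
  qed simp
  have q1: "wp ?c1 (2 * t + 300 * Suc n + 500) ?Q \<sigma>1"
    if bd1: "bounded \<sigma>1" and same1: "same_except ?S {} \<sigma> \<sigma>1" and bal: "balanced y p"
      and sel: "words \<sigma>1 (ad (17 + 8 * r) 0) = length (chosen 1 y p)"
      "\<forall>q<length (chosen 1 y p). words \<sigma>1 (ad (16 + 8 * r) q) = chosen 1 y p ! q" for \<sigma>1
  proof (rule wp_Seq[where ta = 50 and tb = "2 * t + 300 * Suc n + 400"])
    have par1: "params y p \<sigma>1" by (rule params_same[OF same1 par]) auto
    note pv1 = params_vars[OF par1]
    define \<sigma>2 where "\<sigma>2 = \<sigma>1\<lparr>words := (words \<sigma>1)(ad (18 + 8 * r) 0 := a, ad (19 + 8 * r) 0 := L ! p)\<rparr>"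
    have bd2: "bounded \<sigma>2" using bd1 lp by (simp add: bounded_def \<sigma>2_def)
    have same2: "same_except ({4..<24 + 8 * r} \<union> ?S) ({4..<24 + 8 * r} \<union> {25 + 8 * r}) \<sigma> \<sigma>2"
      using same1 by (auto simp: \<sigma>2_def same_except_def)
    have par2: "params y p \<sigma>2" by (rule params_same[OF same2 par]) auto
    have inp2: "input r (chosen 1 y p) a (L ! p) \<sigma>2" using sel by (simp add: input_def \<sigma>2_def)
    have "wp ?c2 (2 * t + 300 * Suc n + 400) ?Q \<sigma>2"
    proof (rule wp_Seq[where ta = t and tb = "t + 300 * Suc n + 400"])
      show "wp c t (wp ?c3 (t + 300 * Suc n + 400) ?Q) \<sigma>2"
      proof (rule wp_mono[OF sub_run[OF bd2 tabs[OF par2] inp2 a_in lp(1)] order_refl], goal_cases)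
        case 1
        then show ?case using bal by (simp add: balanced_def)
      next
        case (2 \<sigma>3)
        then have bd3: "bounded \<sigma>3" and
          same3: "same_except {4..<24 + 8 * r} {4..<24 + 8 * r} \<sigma>2 \<sigma>3" by blast+
        define u where "u = snd (vals \<sigma>3 (ad (16 + 8 * r) 0))"
        have u: "vals \<sigma>3 (ad (16 + 8 * r) 0) = (Suc (length (chosen 1 y p)), u)"
          "optimal_path d (set (chosen 1 y p)) a (L ! p) u"
          using 2 by (auto simp: u_def prod_eq_iff)
        define \<sigma>4 where "\<sigma>4 = \<sigma>3\<lparr>vals := (vals \<sigma>3)(ad (25 + 8 * r) 0 := (Suc (length (chosen 1 y p)), u))\<rparr>"
        have lB: "Suc (length (chosen 1 y p)) < B"
          using length_chosen[OF p, of y] m_le_n consts_less_B(4) by simp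
        have bd4: "bounded \<sigma>4" using bd3 lB by (simp add: bounded_def \<sigma>4_def)
        have same4: "same_except ({4..<24 + 8 * r} \<union> ?S) ({4..<24 + 8 * r} \<union> {25 + 8 * r}) \<sigma> \<sigma>4"
          using same_except_trans[OF same2 same3 subset_refl subset_refl] by (auto simp: \<sigma>4_def same_except_def)
        have par4: "params y p \<sigma>4" by (rule params_same[OF same4 par]) auto
        have "wp ?c4 (t + 300 * Suc n + 300) ?Q \<sigma>4"
        proof (rule wp_Seq[where ta = "300 * Suc n" and tb = "t + 300"])
          show "wp (select_com K r (WLess (bit_exp K r) (Const 1))) (300 * Suc n) (wp ?c5 (t + 300) ?Q) \<sigma>4"
          proof (rule wp_mono[OF select_com[OF bd4 par4, of 0] order_refl], goal_cases)
            case (3 \<sigma>5)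
            then have bd5: "bounded \<sigma>5" and same5: "same_except ?S {} \<sigma>4 \<sigma>5"
              and sel5: "words \<sigma>5 (ad (17 + 8 * r) 0) = length (chosen 0 y p)"
              "\<forall>q<length (chosen 0 y p). words \<sigma>5 (ad (16 + 8 * r) q) = chosen 0 y p ! q" by blast+
            have par5: "params y p \<sigma>5" by (rule params_same[OF same5 par4]) auto
            note pv5 = params_vars[OF par5]
            define \<sigma>6 where "\<sigma>6 = \<sigma>5\<lparr>words := (words \<sigma>5)(ad (18 + 8 * r) 0 := L ! p, ad (19 + 8 * r) 0 := b)\<rparr>"
            have bd6: "bounded \<sigma>6" using bd5 lp by (simp add: bounded_def \<sigma>6_def)
            have same6: "same_except ({4..<24 + 8 * r} \<union> ?S) ({4..<24 + 8 * r} \<union> {25 + 8 * r}) \<sigma> \<sigma>6"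
              using same_except_trans[OF same4 same5 order_refl order_refl] by (auto simp: \<sigma>6_def same_except_def)
            have inp6: "input r (chosen 0 y p) (L ! p) b \<sigma>6" using sel5 by (simp add: input_def \<sigma>6_def)
            have u6: "vals \<sigma>6 (ad (25 + 8 * r) 0) = (Suc (length (chosen 1 y p)), u)"
              using same5 by (simp add: \<sigma>6_def \<sigma>4_def same_except_def)
            have w6: "wp ?c6 (t + 200) ?Q \<sigma>6" by (rule q6[OF bd6 same6 inp6 bal u6 u(2)])
            have "com_eval ?s5 \<sigma>5 = \<sigma>6" using pv5 p by (simp add: \<sigma>6_def)
            moreover have "csafe ?s5 \<sigma>5" using pv5 p lp by simp
            moreover have "com_time ?s5 \<le> 50" by simp
            ultimately have "wp ?s5 50 (wp ?c6 (t + 200) ?Q) \<sigma>5"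
              using w6 bd5 Z_ge by - (rule wp_straight, simp_all del: com_eval.simps csafe.simps com_time.simps)
            then show ?case by (rule wp_Seq) simp
          qed auto
        qed simp
        moreover have "com_eval ?s3 \<sigma>3 = \<sigma>4" using u by (simp add: \<sigma>4_def)
        moreover have "csafe ?s3 \<sigma>3" using u lB by simp
        moreover have "com_time ?s3 \<le> 50" by simp
        ultimately have "wp ?s3 50 (wp ?c4 (t + 300 * Suc n + 300) ?Q) \<sigma>3"
          using bd3 Z_ge by - (rule wp_straight, simp_all del: com_eval.simps csafe.simps com_time.simps)
        then show ?case by (rule wp_Seq) simp
      qed
    qed simp
    moreover have "com_eval ?s1 \<sigma>1 = \<sigma>2" using pv1 p by (simp add: \<sigma>2_def)
    moreover have "csafe ?s1 \<sigma>1" using pv1 p lp by simp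
    moreover have "com_time ?s1 \<le> 50" by simp
    ultimately show "wp ?s1 50 (wp ?c2 (2 * t + 300 * Suc n + 400) ?Q) \<sigma>1"
      using bd1 Z_ge by - (rule wp_straight, simp_all del: com_eval.simps csafe.simps com_time.simps)
  qed simp
  show ?thesis unfolding split_com_def
  proof (rule wp_Seq[where ta = "300 * Suc n" and tb = "2 * t + 300 * Suc n + 700"])
    let ?b = "BAnd (BNot (WLess (Div (var K (25 + 8 * r)) (Const 2)) (var K (17 + 8 * r))))
         (BNot (WLess (Div (var K (25 + 8 * r)) (Const 2))
           (Minus (Minus (var K (25 + 8 * r)) (Const 1)) (var K (17 + 8 * r)))))"
    show "wp (select_com K r (WLess (Const 0) (bit_exp K r))) (300 * Suc n)
      (wp (Cond ?b ?c1 Skip) (2 * t + 300 * Suc n + 700) ?Q) \<sigma>"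
    proof (rule wp_mono[OF select_com[OF bd par, of 1] order_refl], goal_cases)
      case (3 \<sigma>1)
      then have bd1: "bounded \<sigma>1" and same1: "same_except ?S {} \<sigma> \<sigma>1"
        and sel: "words \<sigma>1 (ad (17 + 8 * r) 0) = length (chosen 1 y p)"
          "\<forall>q<length (chosen 1 y p). words \<sigma>1 (ad (16 + 8 * r) q) = chosen 1 y p ! q" by blast+
      have par1: "params y p \<sigma>1" by (rule params_same[OF same1 par]) auto
      note pv1 = params_vars[OF par1]
      \<comment> \<open>When the test is run, only the first part has been listed; the size of the
        second is computed as \<open>m - 1\<close> minus that of the first.\<close>
      have bal: "beval n d \<sigma>1 ?b \<longleftrightarrow> balanced y p"
        using length_chosen[OF p, of y] pv1 sel(1) by (auto simp: balanced_def not_less)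
      show ?case
      proof (rule wp_Cond[where tc = "2 * t + 300 * Suc n + 500"])
        show "wp ?c1 (2 * t + 300 * Suc n + 500) ?Q \<sigma>1" if "beval n d \<sigma>1 ?b"
          using q1[OF bd1 same1 _ sel] that bal by blast
        show "wp Skip (2 * t + 300 * Suc n + 500) ?Q \<sigma>1" if "\<not> beval n d \<sigma>1 ?b"
        proof -
          have "\<not> balanced y p" using that bal by blast
          moreover have "same_except ?W ?V \<sigma> \<sigma>1" using same1 by (auto simp: same_except_def)
          moreover have "rf \<sigma>1 = rf \<sigma>" "rv \<sigma>1 = rv \<sigma>" using same1 by (simp_all add: same_except_def)
          ultimately have "?Q \<sigma>1" using ok by (simp add: improves_def)
          then show ?thesis using bd1 Z_ge by - (rule wp_straight, simp_all)
        qed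
      qed (use bd1 Z_ge pv1 in simp_all)
    qed auto
  qed simp
qed

lemma divide_com:
  assumes bd: "bounded \<sigma>" and tab: "tables \<sigma>" and inp: "input (Suc r) L a b \<sigma>"
  shows "wp (divide_com K r c) (2 ^ (n div 2 ^ (R - Suc r)) * (Suc n * (4 * t + 4000 * Suc n)))
    (\<lambda>\<sigma>'. same_except {4..<32 + 8 * r} {4..<32 + 8 * r} \<sigma> \<sigma>' \<and>
      fst (rv \<sigma>') = Suc m \<and> optimal_path d (set L) a b (snd (rv \<sigma>'))) \<sigma>" (is "wp _ ?T ?Q _")
proof -
  have iv: "words \<sigma>' (ad (25 + 8 * r) 0) = m" "words \<sigma>' (ad (26 + 8 * r) 0) = a" "words \<sigma>' (ad (27 + 8 * r) 0) = b"
    if "input (Suc r) L a b \<sigma>'" for \<sigma>'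
    using that by (auto simp: input_def)
  let ?b = "WLess (var K (25 + 8 * r)) (Const 1)"
  let ?inner = "For K (30 + 8 * r) (var K (25 + 8 * r)) (split_com K r c)"
  let ?ti = "Suc n * (2 * t + 1550 * Suc n)"
  let ?to = "Suc (2 ^ m) * (Suc n * (2 * t + 1650 * Suc n))"
  let ?outer = "For K (29 + 8 * r) (entry K 3 (var K (25 + 8 * r))) ?inner"
  let ?W = "{4..<24 + 8 * r} \<union> {28 + 8 * r, 31 + 8 * r}"
  let ?V = "{4..<24 + 8 * r} \<union> {24 + 8 * r, 25 + 8 * r}"
  \<comment> \<open>What the guess \<open>(y, p)\<close> contributes: the result is at most the
    length of any path compatible with it. This is monotone under \<open>improves\<close>, so it
    accumulates over both loops.\<close>
  define covered where "covered \<sigma>' y p \<longleftrightarrow> (balanced y p \<longrightarrow> (\<forall>us vs. distinct us \<and> set us = set (chosen 1 y p) \<and>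
      distinct vs \<and> set vs = set (chosen 0 y p) \<longrightarrow>
      result_le (rf \<sigma>') (rv \<sigma>') (walk_length d a ((us @ L ! p # vs) @ [b]))))" for \<sigma>' :: state and y p
  have covered_mono: "covered \<sigma>' y p" if "improves \<sigma>1 \<sigma>'" "covered \<sigma>1 y p" for \<sigma>1 \<sigma>' y p
    using that by (simp add: covered_def improves_def)
  have inner: "wp ?inner ?ti (\<lambda>\<sigma>'. same_except (insert (30 + 8 * r) ?W) ?V \<sigma>1 \<sigma>' \<and>
      result_ok (rf \<sigma>') (rv \<sigma>') \<and> improves \<sigma>1 \<sigma>' \<and> (\<forall>p<m. covered \<sigma>' y p)) \<sigma>1"
    if bd1: "bounded \<sigma>1" and tab1: "tables \<sigma>1" and inp1: "input (Suc r) L a b \<sigma>1"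
      and y: "words \<sigma>1 (ad (29 + 8 * r) 0) = y" and ok: "result_ok (rf \<sigma>1) (rv \<sigma>1)" for \<sigma>1 y
  proof -
    let ?I = "\<lambda>p \<sigma>'. same_except (insert (30 + 8 * r) ?W) ?V \<sigma>1 \<sigma>' \<and>
      result_ok (rf \<sigma>') (rv \<sigma>') \<and> improves \<sigma>1 \<sigma>' \<and> (\<forall>q<p. covered \<sigma>' y q)"
    have par: "params y p' \<sigma>'" if "?I p \<sigma>'" "words \<sigma>' (ad (30 + 8 * r) 0) = p'" for p p' \<sigma>'
    proof -
      have same: "same_except (insert (30 + 8 * r) ?W) ?V \<sigma>1 \<sigma>'" using that by blast
      have "tables \<sigma>'" by (rule tables_same[OF same _ tab1]) auto
      moreover have "input (Suc r) L a b \<sigma>'" by (rule input_same[OF same _ _ inp1]) (use r_less in auto)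
      moreover have "words \<sigma>' (ad (29 + 8 * r) 0) = y" using same y by (simp add: same_except_def)
      ultimately show ?thesis using that(2) by (simp add: params_def)
    qed
    show ?thesis
    proof (rule wp_For[where k = m and tb = "2 * t + 1500 * Suc n" and I = ?I])
      show "m < B" using m_le_n n_less_B by simp
      show "?I 0 \<sigma>1" using ok by (simp add: same_except_refl improves_def)
    next
      fix p \<sigma>' v assume "?I p \<sigma>'"
      then show "?I p (\<sigma>'\<lparr>words := (words \<sigma>')(ad (30 + 8 * r) 0 := v)\<rparr>)"
        by (auto intro: same_except_upd simp: improves_def covered_def)
    next
      fix p \<sigma>' assume "?I p \<sigma>'"
      then show "wsafe \<sigma>' (var K (25 + 8 * r)) \<and> weval n \<sigma>' (var K (25 + 8 * r)) = m"
        using params_vars[OF par[OF _ refl]] by simp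
    next
      fix p \<sigma>' assume p: "p < m" and bd': "bounded \<sigma>'" and I: "?I p \<sigma>'"
        and vp: "words \<sigma>' (ad (30 + 8 * r) 0) = p"
      have ok': "result_ok (rf \<sigma>') (rv \<sigma>')" using I by blast
      show "wp (split_com K r c) (2 * t + 1500 * Suc n)
        (\<lambda>\<sigma>''. words \<sigma>'' (ad (30 + 8 * r) 0) = p \<and> ?I (Suc p) \<sigma>'') \<sigma>'"
      proof (rule wp_mono[OF split_com[OF bd' par[OF I vp] p ok'] order_refl], elim conjE)
        fix \<sigma>'' assume same: "same_except ?W ?V \<sigma>' \<sigma>''" and ok'': "result_ok (rf \<sigma>'') (rv \<sigma>'')"
          and imp: "improves \<sigma>' \<sigma>''" and "balanced y p \<longrightarrow> (\<forall>us vs. distinct us \<and> set us = set (chosen 1 y p) \<and>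
      distinct vs \<and> set vs = set (chosen 0 y p) \<longrightarrow>
      result_le (rf \<sigma>'') (rv \<sigma>'') (walk_length d a ((us @ L ! p # vs) @ [b])))"
        then have dn: "covered \<sigma>'' y p" by (simp only: covered_def)
        have "words \<sigma>'' (ad (30 + 8 * r) 0) = p" using same vp by (simp add: same_except_def)
        moreover have "same_except (insert (30 + 8 * r) ?W) ?V \<sigma>1 \<sigma>''"
          by (rule same_except_trans[OF conjunct1[OF I] same]) auto
        moreover have "improves \<sigma>1 \<sigma>''" using imp I by (simp add: improves_def)
        moreover have "\<forall>q<Suc p. covered \<sigma>'' y q" using I dn covered_mono[OF imp] by (simp add: less_Suc_eq)
        ultimately show "words \<sigma>'' (ad (30 + 8 * r) 0) = p \<and> ?I (Suc p) \<sigma>''" using ok'' by blast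
      qed
    next
      show "(m + 1) * (2 * t + 1500 * Suc n + wcost (var K (25 + 8 * r)) + 30) \<le> ?ti"
        using m_le_n by (intro mult_le_mono) auto
    qed (use bd1 Z_ge in auto)
  qed
  have outer: "wp ?outer ?to ?Q \<sigma>1"
    if bd1: "bounded \<sigma>1" and same1: "same_except {28 + 8 * r} {} \<sigma> \<sigma>1" and rf1: "rf \<sigma>1 = 0" and m0: "0 < m" for \<sigma>1
  proof -
    let ?W2 = "{4..<24 + 8 * r} \<union> {28 + 8 * r, 29 + 8 * r, 30 + 8 * r, 31 + 8 * r}"
    let ?I = "\<lambda>y \<sigma>'. same_except ?W2 ?V \<sigma> \<sigma>' \<and> result_ok (rf \<sigma>') (rv \<sigma>') \<and> (\<forall>z<y. \<forall>p<m. covered \<sigma>' z p)"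
    have ti: "tables \<sigma>'" "input (Suc r) L a b \<sigma>'" if "?I y \<sigma>'" for y \<sigma>'
    proof -
      have same: "same_except ?W2 ?V \<sigma> \<sigma>'" using that by blast
      show "tables \<sigma>'" by (rule tables_same[OF same _ tab]) auto
      show "input (Suc r) L a b \<sigma>'" by (rule input_same[OF same _ _ inp]) (use r_less in auto)
    qed
    show ?thesis
    proof (rule wp_For[where k = "2 ^ m" and tb = ?ti and I = ?I])
      have "(2::nat) ^ m \<le> 2 ^ n" using m_le_n by (intro power_increasing) auto
      then show "2 ^ m < B" using powers_less_B(3) by (rule le_less_trans)
      show "?I 0 \<sigma>1" using same1 rf1 by (auto simp: same_except_def result_ok_def)
    next
      fix y \<sigma>' v assume "?I y \<sigma>'"
      then show "?I y (\<sigma>'\<lparr>words := (words \<sigma>')(ad (29 + 8 * r) 0 := v)\<rparr>)"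
        by (auto intro: same_except_upd simp: covered_def)
    next
      fix y \<sigma>' assume I: "?I y \<sigma>'"
      have "words \<sigma>' (ad 3 m) = 2 ^ m" using ti(1)[OF I] m_le_n by (simp add: tables_def)
      then show "wsafe \<sigma>' (entry K 3 (var K (25 + 8 * r))) \<and> weval n \<sigma>' (entry K 3 (var K (25 + 8 * r))) = 2 ^ m"
        using iv[OF ti(2)[OF I]] m_le_n n_less_D by simp
    next
      fix y \<sigma>' assume bd': "bounded \<sigma>'" and I: "?I y \<sigma>'" and vy: "words \<sigma>' (ad (29 + 8 * r) 0) = y"
      have ok': "result_ok (rf \<sigma>') (rv \<sigma>')" using I by blast
      show "wp ?inner ?ti (\<lambda>\<sigma>''. words \<sigma>'' (ad (29 + 8 * r) 0) = y \<and> ?I (Suc y) \<sigma>'') \<sigma>'"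
      proof (rule wp_mono[OF inner[OF bd' ti[OF I] vy ok'] order_refl], elim conjE)
        fix \<sigma>'' assume same: "same_except (insert (30 + 8 * r) ?W) ?V \<sigma>' \<sigma>''"
          and ok'': "result_ok (rf \<sigma>'') (rv \<sigma>'')" and imp: "improves \<sigma>' \<sigma>''" and dn: "\<forall>p<m. covered \<sigma>'' y p"
        have "words \<sigma>'' (ad (29 + 8 * r) 0) = y" using same vy by (simp add: same_except_def)
        moreover have "same_except ?W2 ?V \<sigma> \<sigma>''"
          by (rule same_except_trans[OF conjunct1[OF I] same]) auto
        moreover have "\<forall>z<Suc y. \<forall>p<m. covered \<sigma>'' z p" using I dn covered_mono[OF imp] by (simp add: less_Suc_eq)
        ultimately show "words \<sigma>'' (ad (29 + 8 * r) 0) = y \<and> ?I (Suc y) \<sigma>''" using ok'' by blast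
      qed
    next
      fix \<sigma>' assume I: "?I (2 ^ m) \<sigma>'"
      have le: "result_le (rf \<sigma>') (rv \<sigma>') (walk_length d a (xs @ [b]))"
        if "distinct xs" "set xs = set L" for xs
        using split_exists[OF that m0] I by (auto simp: covered_def)
      then have "rf \<sigma>' \<noteq> 0" using dist_L by (auto simp: result_le_def)
      then obtain xs where "distinct xs" "set xs = set L" "rv \<sigma>' = (Suc m, walk_length d a (xs @ [b]))"
        using I unfolding result_ok_def by blast
      then have "fst (rv \<sigma>') = Suc m" "optimal_path d (set L) a b (snd (rv \<sigma>'))"
        using le unfolding optimal_path_def result_le_def by auto
      moreover have "same_except {4..<32 + 8 * r} {4..<32 + 8 * r} \<sigma> \<sigma>'"
        by (rule same_except_trans[OF conjunct1[OF I] same_except_refl[of "{}" "{}"]]) auto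
      ultimately show "?Q \<sigma>'" by blast
    next
      have "?ti + wcost (entry K 3 (var K (25 + 8 * r))) + 30 \<le> ?ti + 100 * Suc n" by simp
      also have "\<dots> \<le> Suc n * (2 * t + 1650 * Suc n)" by (simp add: algebra_simps)
      finally show "(2 ^ m + 1) * (?ti + wcost (entry K 3 (var K (25 + 8 * r))) + 30) \<le> ?to"
        by (metis Suc_eq_plus1 mult_le_mono2)
    qed (use bd1 Z_ge in auto)
  qed
  have T: "100 + ?to \<le> ?T"
  proof -
    have "100 + ?to \<le> Suc (2 ^ m) * (Suc n * (2 * t + 1750 * Suc n))" by (simp add: algebra_simps)
    also have "\<dots> \<le> 2 * 2 ^ m * (Suc n * (2 * t + 2000 * Suc n))" by (intro mult_le_mono) auto
    also have "\<dots> = 2 ^ m * (Suc n * (4 * t + 4000 * Suc n))" by simp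
    also have "\<dots> \<le> ?T" using m_le by (intro mult_le_mono power_increasing) auto
    finally show ?thesis .
  qed
  show ?thesis unfolding divide_com_def
  proof (rule wp_Cond[where tc = "50 + ?to"])
    show "bsafe \<sigma> ?b" by simp
    show "wp (VStore (cell K (24 + 8 * r) (Const 0)) (Dist (var K (26 + 8 * r)) (var K (27 + 8 * r)))) (50 + ?to) ?Q \<sigma>"
      if "beval n d \<sigma> ?b"
    proof (rule wp_straight)
      have "L = []" using that iv[OF inp] by simp
      then show "?Q (com_eval (VStore (cell K (24 + 8 * r) (Const 0)) (Dist (var K (26 + 8 * r)) (var K (27 + 8 * r)))) \<sigma>)"
        using iv[OF inp] by (auto simp: optimal_path_def same_except_def)
    qed (use bd Z_ge iv[OF inp] a_in b_in in auto)
    show "wp (Seq (set_var K (28 + 8 * r) (Const 0)) ?outer) (50 + ?to) ?Q \<sigma>" if "\<not> beval n d \<sigma> ?b"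
    proof (rule wp_Seq)
      let ?\<sigma> = "com_eval (set_var K (28 + 8 * r) (Const 0)) \<sigma>"
      have "0 < m" using that iv[OF inp] by simp
      then have "wp ?outer ?to ?Q ?\<sigma>"
        using bd by (intro outer) (auto simp: bounded_def same_except_def)
      then show "wp (set_var K (28 + 8 * r) (Const 0)) 50 (wp ?outer ?to ?Q) \<sigma>"
        using bd Z_ge by - (rule wp_straight, simp_all)
    qed simp
  qed (use bd Z_ge T in simp_all)
qed

end

context tsp_machine
begin

lemma solves_level_divide:
  assumes "r < R" "solves_level r c t"
  shows "solves_level (Suc r) (divide_com K r c) (2 ^ (n div 2 ^ (R - Suc r)) * (Suc n * (4 * t + 4000 * Suc n)))"
  unfolding solves_level_def
proof (intro allI impI, elim conjE)
  fix \<sigma> L a b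
  assume *: "bounded \<sigma>" "tables \<sigma>" "input (Suc r) L a b \<sigma>" and "distinct L" "set L \<subseteq> {1..n}"
    "a \<in> {1..n}" "b \<in> {1..n}" "length L \<le> n div 2 ^ (R - Suc r)"
  then interpret divide_machine n d w s B Z K D M N C f lab R L a b r c t
    using assms by unfold_locales auto
  show "wp (divide_com K r c) (2 ^ (n div 2 ^ (R - Suc r)) * (Suc n * (4 * t + 4000 * Suc n)))
    (\<lambda>\<sigma>'. same_except {4..<24 + 8 * Suc r} {4..<24 + 8 * Suc r} \<sigma> \<sigma>' \<and>
       fst (vals \<sigma>' (ad (16 + 8 * Suc r) 0)) = Suc (length L) \<and>
       optimal_path d (set L) a b (snd (vals \<sigma>' (ad (16 + 8 * Suc r) 0)))) \<sigma>"
    using divide_com[OF *] by simp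
qed

end

section \<open>The complete program\<close>

text \<open>The language has no procedures, so the recursion is unrolled. Each level contains two
  copies of the one below, and the program does not grow with \<open>n\<close>.\<close>

primrec level_com :: "nat \<Rightarrow> nat \<Rightarrow> nat \<Rightarrow> nat \<Rightarrow> nat \<Rightarrow> com" where
  "level_com K M N C 0 = base_com K M N C"
| "level_com K M N C (Suc r) = divide_com K r (level_com K M N C r)"

text \<open>Hard-wires a finite table of constants, here the automata, at a cost independent of
  \<open>n\<close>.\<close>

definition store_com :: "nat \<Rightarrow> (nat \<Rightarrow> nat) \<Rightarrow> nat list \<Rightarrow> com" where
  "store_com K g ks = foldr (\<lambda>k. Seq (WStore (cell K 0 (Const k)) (Const (g k)))) ks Skip"

definition powers_com :: "nat \<Rightarrow> nat \<Rightarrow> nat \<Rightarrow> com" where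
  "powers_com K N C = Seq
     (Seq (set_var K 1 (Const 1)) (Seq (set_var K 2 (Const 1)) (set_var K 3 (Const 1))))
     (For K 22 Cities
       (Seq (WStore (cell K 1 (Plus (var K 22) (Const 1))) (Times (entry K 1 (var K 22)) (Const C)))
       (Seq (WStore (cell K 2 (Plus (var K 22) (Const 1))) (Times (entry K 2 (var K 22)) (Const N)))
         (WStore (cell K 3 (Plus (var K 22) (Const 1))) (Times (entry K 3 (var K 22)) (Const 2))))))"

definition input_com :: "nat \<Rightarrow> nat \<Rightarrow> com" where
  "input_com K R = Seq
     (For K 5 (Minus Cities (Const 1)) (WStore (cell K (16 + 8 * R) (var K 5)) (Plus (var K 5) (Const 2))))
     (Seq (set_var K (17 + 8 * R) (Minus Cities (Const 1)))
       (Seq (set_var K (18 + 8 * R) (Const 1)) (set_var K (19 + 8 * R) (Const 1))))"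

text \<open>The divisions recover \<open>i\<close>, \<open>j\<close> and \<open>e\<close> from the
  index \<open>(i * C + j) * M + e\<close> of array 0. The main call asks for a path from city 1 to
  city 1 through all others.\<close>

definition tsp_com :: "nat \<Rightarrow> nat \<Rightarrow> nat \<Rightarrow> nat \<Rightarrow> (nat \<Rightarrow> nat \<Rightarrow> nat \<Rightarrow> nat) \<Rightarrow> nat \<Rightarrow> com" where
  "tsp_com K M N C f R = Seq
     (store_com K (\<lambda>k. f (k div M div C) (k div M mod C) (k mod M)) [0..<N * C * M])
     (Seq (powers_com K N C) (Seq (input_com K R) (Seq (level_com K M N C R)
       (VStore (cell K 0 (Const 0)) (VLoad (cell K (16 + 8 * R) (Const 0)))))))"

section \<open>Correctness and running time of the complete program\<close>

context tsp_machine
begin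

primrec level_time :: "nat \<Rightarrow> nat" where
  "level_time 0 = base_time"
| "level_time (Suc r) = 2 ^ (n div 2 ^ (R - Suc r)) * (Suc n * (4 * level_time r + 4000 * Suc n))"

lemma solves_level_com: "r \<le> R \<Longrightarrow> solves_level r (level_com K M N C r) (level_time r)"
proof (induction r)
  case 0
  then show ?case by (simp add: solves_level_base)
next
  case (Suc r)
  then show ?case unfolding level_com.simps level_time.simps by (intro solves_level_divide) simp_all
qed

lemma store_com:
  assumes "\<forall>k\<in>set ks. k < D \<and> k < B \<and> g k < B" "bounded \<sigma>"
  shows "wp (store_com K g ks) (10 * length ks + 1) (\<lambda>\<sigma>'. same_except {0} {} \<sigma> \<sigma>' \<and>
    (\<forall>k\<in>set ks. words \<sigma>' (ad 0 k) = g k)) \<sigma>"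
proof -
  have "wp (store_com K g ks) (10 * length ks + 1) (\<lambda>\<sigma>'. same_except {0} {} \<sigma> \<sigma>' \<and>
    (\<forall>k. words \<sigma>' (ad 0 k) = (if k \<in> set ks then g k else words \<sigma> (ad 0 k)))) \<sigma>"
    using assms
  proof (induction ks arbitrary: \<sigma>)
    case Nil
    then show ?case using Z_ge unfolding store_com_def
      by - (rule wp_straight, simp_all add: same_except_refl)
  next
    case (Cons k ks)
    define \<sigma>1 where "\<sigma>1 = \<sigma>\<lparr>words := (words \<sigma>)(ad 0 k := g k)\<rparr>"
    have "bounded \<sigma>1" using Cons.prems by (auto simp: bounded_def \<sigma>1_def)
    then have IH: "wp (store_com K g ks) (10 * length ks + 1) (\<lambda>\<sigma>'. same_except {0} {} \<sigma>1 \<sigma>' \<and>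
      (\<forall>k. words \<sigma>' (ad 0 k) = (if k \<in> set ks then g k else words \<sigma>1 (ad 0 k)))) \<sigma>1"
      using Cons.prems by (intro Cons.IH) auto
    let ?Q = "\<lambda>\<sigma>'. same_except {0} {} \<sigma> \<sigma>' \<and>
        (\<forall>j. words \<sigma>' (ad 0 j) = (if j \<in> set (k # ks) then g j else words \<sigma> (ad 0 j)))"
    have 1: "wp (store_com K g ks) (10 * length ks + 1) ?Q \<sigma>1"
      by (rule wp_mono[OF IH order_refl]) (auto simp: same_except_def \<sigma>1_def)
    have "wp (WStore (cell K 0 (Const k)) (Const (g k))) 10 (wp (store_com K g ks) (10 * length ks + 1) ?Q) \<sigma>"
      using Cons.prems Z_ge 1 by - (rule wp_straight, simp_all add: \<sigma>1_def)
    then show ?case unfolding store_com_def by (simp add: wp_Seq)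
  qed
  then show ?thesis by (rule wp_mono) auto
qed

lemma powers_com:
  assumes bd: "bounded \<sigma>"
  shows "wp (powers_com K N C) (300 * Suc n) (\<lambda>\<sigma>'. same_except {1, 2, 3, 22} {} \<sigma> \<sigma>' \<and>
    (\<forall>g\<le>n. words \<sigma>' (ad 1 g) = C ^ g \<and> words \<sigma>' (ad 2 g) = N ^ g \<and> words \<sigma>' (ad 3 g) = 2 ^ g)) \<sigma>"
    (is "wp _ _ ?Q _")
  unfolding powers_com_def
proof (rule wp_Seq[where ta = 50 and tb = "250 * Suc n"])
  let ?s = "Seq (set_var K 1 (Const 1)) (Seq (set_var K 2 (Const 1)) (set_var K 3 (Const 1)))"
  let ?body = "Seq (WStore (cell K 1 (Plus (var K 22) (Const 1))) (Times (entry K 1 (var K 22)) (Const C)))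
       (Seq (WStore (cell K 2 (Plus (var K 22) (Const 1))) (Times (entry K 2 (var K 22)) (Const N)))
         (WStore (cell K 3 (Plus (var K 22) (Const 1))) (Times (entry K 3 (var K 22)) (Const 2))))"
  let ?I = "\<lambda>x \<sigma>'. same_except {1, 2, 3, 22} {} \<sigma> \<sigma>' \<and>
    (\<forall>g\<le>x. words \<sigma>' (ad 1 g) = C ^ g \<and> words \<sigma>' (ad 2 g) = N ^ g \<and> words \<sigma>' (ad 3 g) = 2 ^ g)"
  have two: "2 < B" using n_pos consts_less_B(4) by simp
  define \<sigma>1 where "\<sigma>1 = com_eval ?s \<sigma>"
  have I1: "?I 0 \<sigma>1" by (auto simp: \<sigma>1_def same_except_def)
  have bd1: "bounded \<sigma>1" using bd by (auto simp: \<sigma>1_def bounded_def)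
  have "wp (For K 22 Cities ?body) (250 * Suc n) ?Q \<sigma>1"
  proof (rule wp_For[where k = n and tb = 200 and I = ?I])
    show "n < B" by (rule n_less_B)
    show "?I 0 \<sigma>1" by (rule I1)
  next
    fix x \<sigma>' v assume "?I x \<sigma>'"
    then show "?I x (\<sigma>'\<lparr>words := (words \<sigma>')(ad 22 0 := v)\<rparr>)" by (auto intro: same_except_upd)
  next
    fix x \<sigma>' assume x: "x < n" and bd': "bounded \<sigma>'" and I: "?I x \<sigma>'" and vx: "words \<sigma>' (ad 22 0) = x"
    have lt: "C ^ Suc x < B" "N ^ Suc x < B" "2 ^ Suc x < B"
    proof -
      have "C ^ Suc x \<le> C ^ n" "N ^ Suc x \<le> N ^ n" "(2::nat) ^ Suc x \<le> 2 ^ n"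
        using x N_pos C_ge_2 by (intro power_increasing; simp)+
      then show "C ^ Suc x < B" "N ^ Suc x < B" "2 ^ Suc x < B" using powers_less_B by linarith+
    qed
    have lD: "x < D" "Suc x < D" using x n_less_D by auto
    have pw: "words \<sigma>' (ad 1 x) = C ^ x" "words \<sigma>' (ad 2 x) = N ^ x" "words \<sigma>' (ad 3 x) = 2 ^ x"
      using I by auto
    show "wp ?body 200 (\<lambda>\<sigma>''. words \<sigma>'' (ad 22 0) = x \<and> ?I (Suc x) \<sigma>'') \<sigma>'"
    proof (rule wp_straight)
      show "csafe ?body \<sigma>'" using vx pw lt lD two by (simp add: mult.commute)
      have "?I (Suc x) (com_eval ?body \<sigma>')"
        using I vx pw by (auto simp: le_Suc_eq same_except_def)
      then show "words (com_eval ?body \<sigma>') (ad 22 0) = x \<and> ?I (Suc x) (com_eval ?body \<sigma>')"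
        using vx by simp
    qed (use bd' Z_ge in simp_all)
  qed (use bd1 Z_ge in auto)
  moreover have "csafe ?s \<sigma>" by simp
  moreover have "com_time ?s \<le> 50" by simp
  ultimately show "wp ?s 50 (wp (For K 22 Cities ?body) (250 * Suc n) ?Q) \<sigma>"
    using bd Z_ge by - (rule wp_straight, simp_all add: \<sigma>1_def del: com_eval.simps csafe.simps com_time.simps)
qed simp

lemma input_com:
  assumes bd: "bounded \<sigma>"
  shows "wp (input_com K R) (200 * Suc n) (\<lambda>\<sigma>'.
    same_except {5, 16 + 8 * R, 17 + 8 * R, 18 + 8 * R, 19 + 8 * R} {} \<sigma> \<sigma>' \<and> input R [2..<Suc n] 1 1 \<sigma>') \<sigma>"
    (is "wp _ _ ?Q _")
  unfolding input_com_def
proof (rule wp_Seq[where ta = "100 * Suc n" and tb = 50])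
  let ?s = "Seq (set_var K (17 + 8 * R) (Minus Cities (Const 1)))
       (Seq (set_var K (18 + 8 * R) (Const 1)) (set_var K (19 + 8 * R) (Const 1)))"
  let ?body = "WStore (cell K (16 + 8 * R) (var K 5)) (Plus (var K 5) (Const 2))"
  let ?I = "\<lambda>x \<sigma>'. same_except {5, 16 + 8 * R} {} \<sigma> \<sigma>' \<and> (\<forall>y<x. words \<sigma>' (ad (16 + 8 * R) y) = y + 2)"
  have two: "2 < B" using n_pos consts_less_B(4) by simp
  show "wp (For K 5 (Minus Cities (Const 1)) ?body) (100 * Suc n) (wp ?s 50 ?Q) \<sigma>"
  proof (rule wp_For[where k = "n - 1" and tb = 50 and I = ?I])
    show "n - 1 < B" using n_less_B by simp
    show "?I 0 \<sigma>" by (simp add: same_except_refl)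
  next
    fix x \<sigma>' v assume "?I x \<sigma>'"
    then show "?I x (\<sigma>'\<lparr>words := (words \<sigma>')(ad 5 0 := v)\<rparr>)" by (auto intro: same_except_upd)
  next
    fix x \<sigma>' assume x: "x < n - 1" and bd': "bounded \<sigma>'" and I: "?I x \<sigma>'" and vx: "words \<sigma>' (ad 5 0) = x"
    show "wp ?body 50 (\<lambda>\<sigma>''. words \<sigma>'' (ad 5 0) = x \<and> ?I (Suc x) \<sigma>'') \<sigma>'"
    proof (rule wp_straight)
      show "csafe ?body \<sigma>'" using vx x n_less_D consts_less_B(4) two by simp
      show "words (com_eval ?body \<sigma>') (ad 5 0) = x \<and> ?I (Suc x) (com_eval ?body \<sigma>')"
        using I vx by (auto simp: less_Suc_eq same_except_def)
    qed (use bd' Z_ge in simp_all)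
  next
    fix \<sigma>' assume bd': "bounded \<sigma>'" and I: "?I (n - 1) \<sigma>'"
    show "wp ?s 50 ?Q \<sigma>'"
    proof (rule wp_straight)
      show "csafe ?s \<sigma>'" using n_less_B by simp
      show "?Q (com_eval ?s \<sigma>')"
        using I n_pos by (auto simp: same_except_def input_def simp del: upt_Suc)
    qed (use bd' Z_ge in simp_all)
  qed (use bd Z_ge in auto)
qed simp

lemma tsp_com:
  assumes "N * C * M \<le> B"
  shows "wp (tsp_com K M N C f R) (10 * (N * C * M) + 600 * Suc n + level_time R)
    (\<lambda>\<sigma>. snd (vals \<sigma> 0) = tsp_opt n d) init_state" (is "wp _ _ ?Q _")
proof -
  let ?g = "\<lambda>k. f (k div M div C) (k div M mod C) (k mod M)"
  let ?out = "VStore (cell K 0 (Const 0)) (VLoad (cell K (16 + 8 * R) (Const 0)))"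
  let ?c4 = "Seq (level_com K M N C R) ?out"
  let ?c3 = "Seq (input_com K R) ?c4"
  let ?c2 = "Seq (powers_com K N C) ?c3"
  have C0: "0 < C" using C_ge_2 by simp
  have bd: "bounded init_state" by (simp add: bounded_def init_state_def)
  have gs: "\<forall>k\<in>set [0..<N * C * M]. k < D \<and> k < B \<and> ?g k < B"
  proof
    fix k assume "k \<in> set [0..<N * C * M]"
    moreover have "?g k < B" using f_less[of "k div M mod C"] C0 consts_less_B(1) by (metis less_trans mod_less_divisor)
    ultimately show "k < D \<and> k < B \<and> ?g k < B" using assms automata_le_D by simp
  qed
  show ?thesis unfolding tsp_com_def
  proof (rule wp_Seq[OF wp_mono[OF store_com[OF gs bd] order_refl]], elim conjE)
    fix \<sigma>1 assume bd1: "bounded \<sigma>1" and g1: "\<forall>k\<in>set [0..<N * C * M]. words \<sigma>1 (ad 0 k) = ?g k"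
    show "wp ?c2 (550 * Suc n + level_time R) ?Q \<sigma>1"
    proof (rule wp_Seq[OF wp_mono[OF powers_com[OF bd1] order_refl]], elim conjE)
      fix \<sigma>2 assume bd2: "bounded \<sigma>2" and same2: "same_except {1, 2, 3, 22} {} \<sigma>1 \<sigma>2"
        and pw: "\<forall>g\<le>n. words \<sigma>2 (ad 1 g) = C ^ g \<and> words \<sigma>2 (ad 2 g) = N ^ g \<and> words \<sigma>2 (ad 3 g) = 2 ^ g"
      have "words \<sigma>2 (ad 0 ((i * C + j) * M + e)) = f i j e" if "i < N" "j < C" "e < M" for i j e
      proof -
        let ?k = "(i * C + j) * M + e"
        have "i * C + j < Suc i * C" using that by simp
        also have "\<dots> \<le> N * C" using that by (intro mult_le_mono) auto
        finally have ij: "Suc (i * C + j) \<le> N * C" by simp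
        have "?k < Suc (i * C + j) * M" using that by simp
        also have "\<dots> \<le> N * C * M" using ij by (intro mult_le_mono) auto
        finally have "?k < N * C * M" .
        then have "words \<sigma>1 (ad 0 ?k) = ?g ?k" using g1 by (metis atLeastLessThan_iff set_upt zero_le)
        moreover have "words \<sigma>2 (ad 0 ?k) = words \<sigma>1 (ad 0 ?k)" using same2 by (simp add: same_except_def)
        ultimately show ?thesis using that by simp
      qed
      then have tab2: "tables \<sigma>2" using pw by (simp add: tables_def)
      show "wp ?c3 (250 * Suc n + level_time R) ?Q \<sigma>2"
      proof (rule wp_Seq[OF wp_mono[OF input_com[OF bd2] order_refl]], elim conjE)
        fix \<sigma>3 assume bd3: "bounded \<sigma>3" and inp: "input R [2..<Suc n] 1 1 \<sigma>3"
          and same3: "same_except {5, 16 + 8 * R, 17 + 8 * R, 18 + 8 * R, 19 + 8 * R} {} \<sigma>2 \<sigma>3"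
        have tab3: "tables \<sigma>3" by (rule tables_same[OF same3 _ tab2]) auto
        have sub: "set [2..<Suc n] \<subseteq> {1..n}" by auto
        have "wp (level_com K M N C R) (level_time R)
          (\<lambda>\<sigma>'. same_except {4..<24 + 8 * R} {4..<24 + 8 * R} \<sigma>3 \<sigma>' \<and>
            fst (vals \<sigma>' (ad (16 + 8 * R) 0)) = Suc (length [2..<Suc n]) \<and>
            optimal_path d (set [2..<Suc n]) 1 1 (snd (vals \<sigma>' (ad (16 + 8 * R) 0)))) \<sigma>3"
          using solves_level_com[OF order_refl, unfolded solves_level_def, rule_format, of \<sigma>3 "[2..<Suc n]" 1 1]
            bd3 tab3 inp n_pos sub by (simp del: upt_Suc)
        then show "wp ?c4 (50 + level_time R) ?Q \<sigma>3"
        proof (rule wp_Seq[OF wp_mono[OF _ order_refl]], elim conjE)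
          fix \<sigma>4 assume bd4: "bounded \<sigma>4" and fst4: "fst (vals \<sigma>4 (ad (16 + 8 * R) 0)) = Suc (length [2..<Suc n])"
            and opt: "optimal_path d (set [2..<Suc n]) 1 1 (snd (vals \<sigma>4 (ad (16 + 8 * R) 0)))"
          have "set [2..<Suc n] = {2..n}" by auto
          then have "tsp_opt n d = snd (vals \<sigma>4 (ad (16 + 8 * R) 0))"
            using opt n_pos by (intro tsp_opt_eq) (simp_all del: upt_Suc)
          moreover have "ad 0 0 = 0" by (simp add: ad_def)
          moreover have "csafe ?out \<sigma>4" using bd4 by (simp add: bounded_def)
          ultimately show "wp ?out 50 ?Q \<sigma>4"
            using bd4 Z_ge by - (rule wp_straight, simp_all)
        qed simp
      qed simp
    qed simp
  qed simp
qed

lemma level_time_pos: "1 \<le> level_time r"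
  by (cases r) (simp_all add: base_time_def)

text \<open>At the bottom the exponential factor is \<open>T0^(n / 2^R)\<close>, which is
  \<open>4^(n / 2^R) * (T / 4)^n\<close> by the choice of \<open>T0\<close>. One level up, with
  \<open>m = n / 2^(R - r - 1)\<close>, the at most \<open>2^m\<close> guesses times
  \<open>4^(m / 2) = 2^m\<close> give \<open>4^m\<close>, while \<open>(T / 4)^n\<close> stays. At
  \<open>r = R\<close> the factor is \<open>T^n\<close>. Each level adds only a factor 8000 and two
  powers of \<open>n + 1\<close>.\<close>

lemma level_time_le:
  fixes T :: real
  assumes T: "1 \<le> T" "T \<le> 4" "1 \<le> T0" "T0 = 4 * (T / 4) ^ 2 ^ R" "real (N * C) \<le> T0 ^ M" and "r \<le> R"
  shows "real (level_time r) \<le> 6000 * real (N * C) * 8000 ^ r * real (Suc n) ^ (2 * r + 3) *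
    (4 powr (real n / 2 ^ (R - r)) * (T / 4) ^ n)"
  using assms(6)
proof (induction r)
  case 0
  define q :: nat where "q = 2 ^ R"
  define k where "k = n div q div M"
  have q: "0 < q" by (simp add: q_def)
    have "base_time \<le> (2 * N ^ (k + 1)) * ((2 * (C ^ (k + 1) * Suc n)) * (1500 * Suc n))"
  proof -
    have "0 < C ^ (k + 1) * Suc n" "0 < N ^ (k + 1)" using N_pos C_ge_2 by simp_all
    then have "Suc (C ^ (k + 1) * Suc n) \<le> 2 * (C ^ (k + 1) * Suc n)" "Suc (N ^ (k + 1)) \<le> 2 * N ^ (k + 1)"
      by linarith+
    then show ?thesis unfolding base_time_def k_def q_def by (intro mult_le_mono order_refl)
  qed
  also have "\<dots> = 6000 * (N * C) ^ (k + 1) * Suc n ^ 2" by (simp add: power_mult_distrib power2_eq_square algebra_simps)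
  also have "\<dots> \<le> 6000 * (N * C) ^ (k + 1) * Suc n ^ 3" by (intro mult_le_mono order_refl power_increasing) auto
  finally have "real base_time \<le> real (6000 * (N * C) ^ (k + 1) * Suc n ^ 3)" by (simp only: of_nat_le_iff)
  also have "\<dots> = 6000 * real (N * C) * real (Suc n) ^ 3 * real (N * C) ^ k" by simp
  also have "real (N * C) ^ k \<le> 4 powr (real n / 2 ^ R) * (T / 4) ^ n"
  proof -
    \<comment> \<open>The factor for a possibly incomplete group has been split off as the constant
      \<open>N * C\<close>, so only \<open>k\<close> groups count here.\<close>
    have "real (N * C) ^ k \<le> (T0 ^ M) ^ k" using T(5) by (intro power_mono) auto
    also have "\<dots> = T0 ^ (M * k)" by (simp add: power_mult)
    also have "\<dots> = T0 powr real (M * k)" using T(3) powr_realpow[of T0 "M * k"] by linarith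
    also have "\<dots> \<le> T0 powr (real n / real q)"
    proof (rule powr_mono)
      have "M * k \<le> n div q" unfolding k_def by simp
      then have "real (M * k) \<le> real (n div q)" by (simp only: of_nat_le_iff)
      also have "\<dots> \<le> real n / real q" by (rule of_nat_div_le_of_nat)
      finally show "real (M * k) \<le> real n / real q" .
    qed (rule T(3))
    also have "\<dots> = 4 powr (real n / real q) * ((T / 4) ^ q) powr (real n / real q)"
      unfolding T(4) q_def using T(1) by (subst powr_mult) auto
    also have "((T / 4) ^ q) powr (real n / real q) = (T / 4) ^ n"
      using T(1) q by (simp add: powr_realpow[symmetric] powr_powr)
    finally show ?thesis by (simp add: q_def)
  qed
  finally show ?case by (simp add: mult_left_mono)
next
  case (Suc r)
  define L where "L = real (level_time r)"
  define \<nu> where "\<nu> = real n / 2 ^ (R - Suc r)"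
  have e: "R - r = Suc (R - Suc r)" using Suc.prems by simp
  have \<nu>: "real n / 2 ^ (R - r) = \<nu> / 2" unfolding e \<nu>_def by simp
  have L1: "1 \<le> L" using level_time_pos[of r] by (simp add: L_def)
  have "(2::real) ^ (n div 2 ^ (R - Suc r)) = 2 powr real (n div 2 ^ (R - Suc r))"
    by (simp add: powr_realpow)
  also have "\<dots> \<le> 2 powr \<nu>"
    using of_nat_div_le_of_nat[of n "2 ^ (R - Suc r)", where ?'a = real] by (intro powr_mono) (auto simp: \<nu>_def)
  finally have two: "(2::real) ^ (n div 2 ^ (R - Suc r)) \<le> 2 powr \<nu>" .
  have p: "2 powr \<nu> * 4 powr (\<nu> / 2) = (4::real) powr \<nu>"
  proof -
    have "(4::real) powr (\<nu> / 2) = (2 powr 2) powr (\<nu> / 2)" by simp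
    also have "\<dots> = 2 powr \<nu>" by (simp only: powr_powr) simp
    finally have h: "(4::real) powr (\<nu> / 2) = 2 powr \<nu>" .
    have "2 powr \<nu> * 4 powr (\<nu> / 2) = (4::real) powr (\<nu> / 2) * 4 powr (\<nu> / 2)" by (simp only: h)
    also have "\<dots> = 4 powr (\<nu> / 2 + \<nu> / 2)" by (rule powr_add[symmetric])
    finally show ?thesis by simp
  qed
  have "real (level_time (Suc r)) = 2 ^ (n div 2 ^ (R - Suc r)) * (real (Suc n) * (4 * L + 4000 * real (Suc n)))"
    by (simp add: L_def algebra_simps)
  also have "\<dots> \<le> 2 powr \<nu> * (real (Suc n) * (8000 * L * real (Suc n)))"
  proof (intro mult_mono two order_refl)
    have "1 * 1 \<le> L * real (Suc n)" using L1 by (intro mult_mono) auto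
    moreover have "L * 1 \<le> L * real (Suc n)" using L1 by (intro mult_left_mono) auto
    moreover have "1 * real (Suc n) \<le> L * real (Suc n)" using L1 by (intro mult_right_mono) auto
    ultimately show "4 * L + 4000 * real (Suc n) \<le> 8000 * L * real (Suc n)" by linarith
  qed (use L1 in auto)
  also have "\<dots> = 8000 * real (Suc n) ^ 2 * 2 powr \<nu> * L" by (simp add: power2_eq_square)
  also have "\<dots> \<le> 8000 * real (Suc n) ^ 2 * 2 powr \<nu> *
     (6000 * real (N * C) * 8000 ^ r * real (Suc n) ^ (2 * r + 3) * (4 powr (\<nu> / 2) * (T / 4) ^ n))"
    using Suc unfolding L_def \<nu> by (intro mult_left_mono) auto
  also have "\<dots> = 6000 * real (N * C) * 8000 ^ Suc r * (real (Suc n) ^ 2 * real (Suc n) ^ (2 * r + 3)) *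
     ((2 powr \<nu> * 4 powr (\<nu> / 2)) * (T / 4) ^ n)" by (simp add: algebra_simps)
  also have "\<dots> = 6000 * real (N * C) * 8000 ^ Suc r * real (Suc n) ^ (2 * Suc r + 3) *
     (4 powr \<nu> * (T / 4) ^ n)" unfolding p by (simp add: power_add[symmetric])
  finally show ?case unfolding \<nu>_def .
qed

end

section \<open>Asymptotics and the choice of parameters\<close>

lemma less_power_two: "x < (2::nat) ^ k" if "x \<le> k" for x k :: nat
  using that less_exp[of k] by linarith

text \<open>\<open>Q\<close> exceeds all constants, so \<open>B = 2^(Q * (n + 1))\<close> dominates
  the stored powers by \<open>x^n \<le> 2^(x * n)\<close>. The word length makes
  \<open>2 ^ w\<close> equal to \<open>B ^ 1000\<close>, where 1000 is the bound \<open>Z\<close> on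
  the cost of loop-free code. \<open>T\<close> occurs only in the analysis of the run.\<close>

lemma tsp_com_solves:
  fixes M N C R n :: nat
  assumes "cover_automata M N C f lab" "1 \<le> n"
  defines "K \<equiv> 24 + 8 * R"
  defines "D \<equiv> N * C * M + n + 2 + C ^ (n div 2 ^ R div M + 1) * Suc n"
  defines "Q \<equiv> K + N + C + M + N * C * M + 4"
  shows "\<exists>t. solves_tsp (tsp_com K M N C f R) n d (1000 * Q * Suc n) (K * D) t \<and>
    (\<forall>T T0. 1 \<le> T \<and> T \<le> 4 \<and> 1 \<le> T0 \<and> T0 = 4 * (T / 4) ^ 2 ^ R \<and> real (N * C) \<le> T0 ^ M \<longrightarrow>
      real t \<le> (10 * real (N * C * M) + 600 + 6000 * real (N * C) * 8000 ^ R) * real (Suc n) ^ (2 * R + 3) * T ^ n)"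
proof -
  interpret cover_automata M N C f lab by fact
  define B :: nat where "B = 2 ^ (Q * Suc n)"
  have pw: "x ^ k \<le> 2 ^ (x * k)" for x k :: nat
    by (simp add: power_mult power_mono less_imp_le)
  have small: "x < B" if "x \<le> Q * Suc n" for x using less_power_two[OF that] by (simp add: B_def)
  have pB: "x ^ n < B" if "x < Q" for x
  proof -
    have "x * n \<le> x * Suc n" by simp
    also have "\<dots> < Q * Suc n" using that by (intro mult_strict_right_mono) auto
    finally have "x * n < Q * Suc n" .
    then have "(2::nat) ^ (x * n) < B" unfolding B_def by (intro power_strict_increasing) auto
    then show ?thesis using pw[of x n] by linarith
  qed
  have Q: "Q \<le> Q * Suc n" by simp
  have nodes: "C ^ (n div 2 ^ R div M + 1) * Suc n < B"
  proof -
    have "n div 2 ^ R div M \<le> n" by (meson div_le_dividend le_trans)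
    then have "C ^ (n div 2 ^ R div M + 1) \<le> C ^ Suc n" using C_ge_2 by (intro power_increasing) auto
    then have "C ^ (n div 2 ^ R div M + 1) * Suc n \<le> 2 ^ (C * Suc n) * 2 ^ Suc n"
      using pw[of C "Suc n"] less_exp[of "Suc n"] by (intro mult_le_mono) linarith+
    also have "\<dots> = 2 ^ ((C + 1) * Suc n)" by (simp add: power_add algebra_simps)
    also have "\<dots> < B" unfolding B_def
      by (intro power_strict_increasing mult_strict_right_mono) (auto simp: Q_def)
    finally show ?thesis .
  qed
  have s2: "K < B" "C < B" "N < B" "M < B" "N * C * M \<le> B"
    using Q by (auto intro!: small less_imp_le[OF small] simp: Q_def)
  have nB: "n + 2 < B"
  proof (rule small)
    have "2 * Suc n \<le> Q * Suc n" by (intro mult_le_mono) (auto simp: Q_def)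
    then show "n + 2 \<le> Q * Suc n" using assms(2) by simp
  qed
  interpret tsp_machine n d "1000 * Q * Suc n" "K * D" B 1000 K D M N C f lab R
  proof unfold_locales
    show "B ^ 1000 \<le> 2 ^ (1000 * Q * Suc n)" by (simp add: B_def power_mult[symmetric] algebra_simps)
    show "C ^ n < B" "N ^ n < B" "2 ^ n < B" by (auto intro!: pB simp: Q_def)
    show "C ^ (n div 2 ^ R div M + 1) * Suc n < B" by (rule nodes)
  qed (use assms(2) s2 nB in \<open>auto simp: D_def K_def\<close>)
  obtain t \<sigma> where t: "exec n d (1000 * Q * Suc n) (K * D) (tsp_com K M N C f R) init_state t \<sigma>"
    "t \<le> 10 * (N * C * M) + 600 * Suc n + level_time R" "snd (vals \<sigma> 0) = tsp_opt n d"
    using tsp_com[OF s2(5)] unfolding wp_def by blast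
  have "real t \<le> (10 * real (N * C * M) + 600 + 6000 * real (N * C) * 8000 ^ R) * real (Suc n) ^ (2 * R + 3) * T ^ n"
    if T: "1 \<le> T" "T \<le> 4" "1 \<le> T0" "T0 = 4 * (T / 4) ^ 2 ^ R" "real (N * C) \<le> T0 ^ M" for T T0
  proof -
    define P where "P = real (Suc n) ^ (2 * R + 3) * T ^ n"
    have Tn: "1 \<le> T ^ n" using T(1) by simp
    have n1: "real (Suc n) \<le> real (Suc n) ^ (2 * R + 3)" using self_le_power[of "real (Suc n)" "2 * R + 3"] by simp
    have P: "real (Suc n) \<le> P" "1 \<le> P"
    proof -
      have "real (Suc n) * 1 \<le> P" unfolding P_def using n1 Tn by (intro mult_mono) auto
      then show "real (Suc n) \<le> P" "1 \<le> P" by auto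
    qed
    have "real (level_time R) \<le> 6000 * real (N * C) * 8000 ^ R * real (Suc n) ^ (2 * R + 3) *
      (4 powr (real n / 2 ^ (R - R)) * (T / 4) ^ n)"
      by (rule level_time_le[OF T order_refl])
    also have "4 powr (real n / 2 ^ (R - R)) * (T / 4) ^ n = T ^ n"
      by (simp add: powr_realpow power_divide)
    finally have l: "real (level_time R) \<le> 6000 * real (N * C) * 8000 ^ R * P" by (simp add: P_def mult.assoc)
    have "real t \<le> real (10 * (N * C * M) + 600 * Suc n + level_time R)" using t(2) by (simp only: of_nat_le_iff)
    also have "\<dots> = 10 * real (N * C * M) * 1 + 600 * real (Suc n) + real (level_time R)" by simp
    also have "\<dots> \<le> 10 * real (N * C * M) * P + 600 * P + 6000 * real (N * C) * 8000 ^ R * P"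
      using P l by (intro add_mono mult_left_mono) auto
    also have "\<dots> = (10 * real (N * C * M) + 600 + 6000 * real (N * C) * 8000 ^ R) * P"
      by (simp only: distrib_right)
    finally show ?thesis by (simp only: P_def mult.assoc)
  qed
  then show ?thesis using t(1,3) unfolding solves_tsp_def by blast
qed

lemma ln_poly_smallo: "(\<lambda>n. (a + c * ln (real (Suc n))) / b) \<in> o(\<lambda>n. real n)"
proof -
  have scale: "(\<lambda>n. k * g n) \<in> o(\<lambda>n. real n)" if "g \<in> o(\<lambda>n. real n)" for k :: real and g
    using that by (cases "k = 0") auto
  have "(\<lambda>n. ln (real (Suc n))) \<in> o(\<lambda>n. real n)" "(\<lambda>n. 1 :: real) \<in> o(\<lambda>n. real n)" by real_asymp+
  then have "(\<lambda>n. (a / b) * 1 + (c / b) * ln (real (Suc n))) \<in> o(\<lambda>n. real n)"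
    by (intro sum_in_smallo scale)
  then show ?thesis by (simp add: add_divide_distrib)
qed

text \<open>Constant and polynomial factors move into the exponent: \<open>A * (n + 1)^k\<close> is
  a power of \<open>X\<close> whose exponent is logarithmic in \<open>n\<close>.\<close>

lemma le_powr_add_ln:
  fixes X A :: real
  assumes "1 < X" "0 < A" "x \<le> A * real (Suc n) ^ k * X ^ n"
  shows "x \<le> X powr (real n + (ln A + real k * ln (real (Suc n))) / ln X)"
proof -
  have "A * real (Suc n) ^ k = exp (ln A + real k * ln (real (Suc n)))"
    using assms(2) by (simp add: exp_add exp_of_nat_mult)
  also have "\<dots> = X powr ((ln A + real k * ln (real (Suc n))) / ln X)"
    using assms(1) by (simp add: powr_def)
  finally show ?thesis using assms by (simp add: powr_add powr_realpow mult.commute)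
qed

text \<open>Repeated squaring drives \<open>T / 4\<close> below \<open>1 / sqrt 2\<close>. At the
  first value not above this threshold the preceding one was above it, so its square is still above
  \<open>1 / 2\<close>; if no squaring takes place, \<open>2 < T\<close> gives the same.\<close>

lemma recursion_depth_exists:
  fixes T :: real
  assumes "2 < T" "T < 4"
  obtains R :: nat where "2 < 4 * (T / 4) ^ 2 ^ R" "4 * (T / 4) ^ 2 ^ R \<le> 2 * sqrt 2"
proof -
  define x where "x = T / 4"
  have x: "1 / 2 < x" "x < 1" using assms by (auto simp: x_def)
  have sq: "4 * (1 / sqrt 2) = 2 * sqrt 2" "0 < 1 / sqrt 2" "(1 / sqrt 2)\<^sup>2 = 1 / 2"
    by (auto simp: field_simps power_divide)
  obtain k where k: "x ^ k < 1 / sqrt 2" using real_arch_pow_inv[OF sq(2) x(2)] by blast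
  have "x ^ 2 ^ k \<le> x ^ k" using x less_exp[of k] by (intro power_decreasing) auto
  then have ex: "\<exists>R. x ^ 2 ^ R \<le> 1 / sqrt 2" using k by (intro exI[of _ k]) linarith
  define R where "R = (LEAST R. x ^ 2 ^ R \<le> 1 / sqrt 2)"
  have R: "x ^ 2 ^ R \<le> 1 / sqrt 2" unfolding R_def by (rule LeastI_ex[OF ex])
  have "1 / 2 < x ^ 2 ^ R"
  proof (cases R)
    case 0
    then show ?thesis using x by simp
  next
    case (Suc r)
    then have "1 / sqrt 2 < x ^ 2 ^ r" using not_less_Least[of r "\<lambda>R. x ^ 2 ^ R \<le> 1 / sqrt 2"]
      by (simp add: R_def not_le)
    then have "(1 / sqrt 2)\<^sup>2 < (x ^ 2 ^ r)\<^sup>2" using sq(2) by (intro power_strict_mono) auto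
    also have "(x ^ 2 ^ r)\<^sup>2 = x ^ 2 ^ R" by (simp add: Suc power_mult[symmetric] mult.commute)
    finally show ?thesis using sq(3) by simp
  qed
  then show thesis using R sq(1) by (intro that[of R]) (auto simp: x_def)
qed

theorem theorem1p1:
  fixes T :: real
  assumes "2 < T" and "T < 4"
  shows "\<exists>S::real. S * T < 4 \<and> feasible_tradeoff S T"
proof -
  obtain R where R: "2 < 4 * (T / 4) ^ 2 ^ R" "4 * (T / 4) ^ 2 ^ R \<le> 2 * sqrt 2"
    using recursion_depth_exists[OF assms] .
  define T0 where "T0 = 4 * (T / 4) ^ 2 ^ R"
  define q :: nat where "q = 2 ^ R"
  obtain M N C where cov: "coverable M N C" and pos: "0 < M" "0 < N" "2 \<le> C"
    and NC: "real (N * C) \<le> T0 ^ M" and CT: "real C * T0 ^ M < 4 ^ M"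
    using coverable_tradeoff[of T0] R unfolding T0_def by blast
  obtain f lab where "(\<forall>i. lab i 0 = {}) \<and>
    (\<forall>i. \<forall>j<C. \<forall>e. f i j e < C \<and>
       (f i j e \<noteq> 0 \<longrightarrow> j < f i j e \<and> e \<notin> lab i j \<and> lab i (f i j e) = insert e (lab i j))) \<and>
    (\<forall>xs. distinct xs \<and> set xs \<subseteq> {..<M} \<longrightarrow> (\<exists>i<N. accepts (f i) 0 xs))"
    using coverable_automata[OF cov pos(2)] pos(3) by auto
  then have aut: "cover_automata M N C f lab"
    using pos by unfold_locales blast+
  \<comment> \<open>At the bottom of the recursion about an \<open>R\<close>-fold halved list,
    \<open>n / q\<close> cities, is cut into groups of \<open>M\<close>, so the automata have about
    \<open>C^(n / (q * M))\<close> packed states.\<close>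
  define S where "S = real C powr (1 / real (q * M))"
  have qM: "0 < q * M" using pos by (simp add: q_def)
  have S1: "1 < S" unfolding S_def using pos qM by (intro gr_one_powr) auto
  have SqM: "S ^ (q * M) = real C"
    using S1 qM pos by (simp add: S_def powr_realpow[symmetric] powr_powr)
  \<comment> \<open>The \<open>q * M\<close>-th power of \<open>S * T / 4\<close> is
    \<open>C * T0^M / 4^M\<close>, which is below 1.\<close>
  have "S * T < 4"
  proof (rule ccontr)
    assume "\<not> S * T < 4"
    then have "1 \<le> S * (T / 4)" by simp
    then have "1 \<le> (S * (T / 4)) ^ (q * M)" by (rule one_le_power)
    also have "\<dots> = real C * ((T / 4) ^ q) ^ M" by (simp only: power_mult_distrib SqM power_mult[symmetric])
    also have "(T / 4) ^ q = T0 / 4" by (simp add: T0_def q_def)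
    finally show False using CT by (simp add: power_divide)
  qed
  moreover have "feasible_tradeoff S T"
  proof -
    define K where "K = 24 + 8 * R"
    define Q where "Q = K + N + C + M + N * C * M + 4"
    \<comment> \<open>The last factor, and the exponent \<open>2 * R + 4\<close> in
      \<open>ft\<close> in place of \<open>2 * R + 3\<close>, come from charging the word length
      \<open>1000 * Q * (n + 1)\<close> for every step.\<close>
    define At where "At = (10 * real (N * C * M) + 600 + 6000 * real (N * C) * 8000 ^ R) * (1000 * real Q)"
    define As where "As = 2000 * real K * real Q * (real (N * C * M) + 2 + real C)"
    define ft where "ft n = (ln At + real (2 * R + 4) * ln (real (Suc n))) / ln T" for n
    \<comment> \<open>One of the two factors \<open>n + 1\<close> is due to the word length, the
      other to the city that is part of a node number.\<close>
    define fs where "fs n = (ln As + real 2 * ln (real (Suc n))) / ln S" for n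
    have QK: "0 < real Q" "0 < real K" by (simp_all only: Q_def K_def of_nat_0_less_iff)
    have At: "0 < At" unfolding At_def
      using QK(1) by (intro mult_pos_pos add_pos_nonneg add_nonneg_pos mult_nonneg_nonneg) auto
    have As: "0 < As" using pos QK unfolding As_def by (intro mult_pos_pos add_nonneg_pos) auto
    have "\<exists>w s t. solves_tsp (tsp_com K M N C f R) n d w s t \<and>
           real (t * w) \<le> T powr (real n + ft n) \<and> real (2 * s * w) \<le> S powr (real n + fs n)"
      if n: "1 \<le> n" for n d
    proof -
      define D where "D = N * C * M + n + 2 + C ^ (n div 2 ^ R div M + 1) * Suc n"
      define w where "w = 1000 * Q * Suc n"
      have wr: "real w = 1000 * real Q * real (Suc n)" unfolding w_def by (simp only: of_nat_mult of_nat_numeral)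
      obtain t where t: "solves_tsp (tsp_com K M N C f R) n d w (K * D) t"
        and tb: "\<forall>T T0. 1 \<le> T \<and> T \<le> 4 \<and> 1 \<le> T0 \<and> T0 = 4 * (T / 4) ^ 2 ^ R \<and> real (N * C) \<le> T0 ^ M \<longrightarrow>
          real t \<le> (10 * real (N * C * M) + 600 + 6000 * real (N * C) * 8000 ^ R) * real (Suc n) ^ (2 * R + 3) * T ^ n"
        using tsp_com_solves[OF aut n, of R d] unfolding D_def Q_def K_def w_def by blast
      have "real t \<le> (10 * real (N * C * M) + 600 + 6000 * real (N * C) * 8000 ^ R) * real (Suc n) ^ (2 * R + 3) * T ^ n"
        using tb assms R NC T0_def by auto
      then have "real t * real w \<le> ((10 * real (N * C * M) + 600 + 6000 * real (N * C) * 8000 ^ R) *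
          real (Suc n) ^ (2 * R + 3) * T ^ n) * real w" by (intro mult_right_mono) auto
      also have "\<dots> = At * (real (Suc n) ^ (2 * R + 3) * real (Suc n)) * T ^ n"
        by (simp add: At_def wr del: of_nat_Suc)
      also have "real (Suc n) ^ (2 * R + 3) * real (Suc n) = real (Suc n) ^ (2 * R + 4)"
        unfolding power_Suc2[symmetric] by (rule arg_cong[where f = "power (real (Suc n))"]) simp
      finally have "real (t * w) \<le> At * real (Suc n) ^ (2 * R + 4) * T ^ n" by simp
      then have time: "real (t * w) \<le> T powr (real n + ft n)"
        unfolding ft_def using assms At by (intro le_powr_add_ln) auto
      have "real (C ^ (n div 2 ^ R div M + 1)) = real C * S ^ (q * M * (n div q div M))"
        unfolding power_mult[of S "q * M"] SqM by (simp add: q_def)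
      also have "\<dots> \<le> real C * S ^ n"
      proof (intro mult_left_mono power_increasing)
        have "M * (n div q div M) \<le> n div q" by simp
        then have "q * (M * (n div q div M)) \<le> q * (n div q)" by (intro mult_le_mono2)
        also have "\<dots> \<le> n" by simp
        finally show "q * M * (n div q div M) \<le> n" by (simp add: mult.assoc)
      qed (use S1 in auto)
      finally have Cn: "real (C ^ (n div 2 ^ R div M + 1)) \<le> real C * S ^ n" .
      have Sn: "1 \<le> S ^ n" using S1 by simp
      define P where "P = real (Suc n) * S ^ n"
      have "real (Suc n) * 1 \<le> P" unfolding P_def using Sn by (intro mult_left_mono) auto
      then have P: "real (Suc n) \<le> P" "1 \<le> P" by auto
      have "real D = real (N * C * M) * 1 + (real (Suc n) + 1) + real (C ^ (n div 2 ^ R div M + 1)) * real (Suc n)"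
        by (simp add: D_def algebra_simps)
      also have "\<dots> \<le> real (N * C * M) * P + 2 * P + real C * S ^ n * real (Suc n)"
      proof (intro add_mono mult_left_mono mult_right_mono)
        show "real (Suc n) + 1 \<le> 2 * P" using P by linarith
      qed (use P Cn in auto)
      also have "\<dots> = (real (N * C * M) + 2 + real C) * P" by (simp add: P_def algebra_simps)
      finally have Db: "real D \<le> (real (N * C * M) + 2 + real C) * P" .
      have "real (2 * (K * D) * w) = 2000 * real K * real Q * real (Suc n) * real D"
        by (simp add: wr del: of_nat_Suc)
      also have "\<dots> \<le> 2000 * real K * real Q * real (Suc n) * ((real (N * C * M) + 2 + real C) * P)"
        using Db by (intro mult_left_mono) auto
      also have "\<dots> = As * real (Suc n) ^ 2 * S ^ n"
        by (simp add: As_def P_def power2_eq_square del: of_nat_Suc)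
      finally have "real (2 * (K * D) * w) \<le> S powr (real n + fs n)"
        unfolding fs_def using S1 As by (intro le_powr_add_ln)
      then show ?thesis using t time by blast
    qed
    moreover have "ft \<in> o(\<lambda>n. real n)" "fs \<in> o(\<lambda>n. real n)"
      unfolding ft_def fs_def by (rule ln_poly_smallo)+
    ultimately show ?thesis using S1 assms unfolding feasible_tradeoff_def
      by (intro conjI exI[of _ "tsp_com K M N C f R"] exI[of _ ft] exI[of _ fs]) auto
  qed
  ultimately show ?thesis by blast
qed

end
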